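(* Let $d,n\ge1$ be integers, let $\Omega\subset\mathbb{R}^d$ be a bounded domain with $C^1$ boundary, let $d_1,\dots,d_n>0$, and let $F=(f_1,\dots,f_n):\mathbb{R}^n\to\mathbb{R}^n$ be locally Lipschitz continuous. Consider the reaction-diffusion system with homogeneous Neumann boundary conditions $$\frac{\partial u_i}{\partial t}-d_i\Delta u_i=f_i(u_1,\dots,u_n)\ \text{ in }\mathbb{R}^+\times\Omega,\qquad \frac{\partial u_i}{\partial\nu}=0\ \text{ on }\mathbb{R}^+\times\partial\Omega,\qquad i=1,\dots,n,\qquad (N)$$ and the condition $$(P)\qquad \forall i\in\{1,\dots,n\},\ \forall (u_j)_{j\neq i}\in[0,\infty)^{n-1},\quad f_i(u_1,\dots,u_{i-1},0,u_{i+1},\dots,u_n)\ge 0 .$$ (a) Assume $(P)$ and let $U(t,x)=(u_1(t,x),\dots,u_n(t,x))$ be any maximal positive trajectory of $(N)$ whose initial vector $U(0)=(u_{0,1},\dots,u_{0,n})\in C(\overline\Omega)^n$ satisfies $u_{0,i}(x)\ge0$ for all $x\in\Omega$ and all $i\in\{1,\dots,n\}$. Then $u_i(t,x)\ge0$ for all $i\in\{1,\dots,n\}$, all $x\in\Omega$ and all $t\in[0,T_{\max})$. (b) Conversely, if for every initial vector $U_0=(u_{0,1},\dots,u_{0,n})\in C(\overline\Omega)^n$ with all components positive (i.e. $u_{0,i}(x)>0$ for all $x\in\overline\Omega$ and all $i$), all components of the corresponding maximal positive trajectory $U(t,x)$ of $(N)$ are non-negative everywhere in $\Omega$ for all $t\in[0,T_{\max})$,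 then $F$ satisfies $(P)$. (c) In the situation of (a), whenever $j\in\{1,\dots,n\}$ is such that $u_j(0,\cdot)\not\equiv0$, we have $$\forall t\in(0,T_{\max}),\quad \inf_{x\in\overline\Omega}u_j(t,x)>0 .$$
   Context: "Domain" means nonempty connected open set. Let $X=C(\overline\Omega)$ (real-valued, sup norm). $S_i(t)$ denotes the contraction semigroup on $X$ generated by $d_i\Delta$ with homogeneous Neumann boundary conditions and its standard domain (the heat semigroup; it is the restriction to $C(\overline\Omega)$ of the $L^2(\Omega)$-semigroup generated by $d_i$ times the Neumann Laplacian, the latter being associated with the form $\int_\Omega\nabla u\cdot\nabla v\,dx$ on $H^1(\Omega)$). A maximal positive trajectory of $(N)$ is a maximal (in forward time, on $[0,T_{\max})$, $0<T_{\max}\le\infty$) mild solution, i.e. $U=(u_1,\dots,u_n)\in C([0,T_{\max}),X^n)$ with $$u_i(t)=S_i(t)u_i(0)+\int_0^tS_i(t-s)f_i(u_1(s),\dots,u_n(s))\,ds,\qquad t\in[0,T_{\max}),\ i=1,\dots,n .$$ "Positive" in "positive trajectory" refers to the time direction. *)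

theory Defs
  imports "HOL-Analysis.Analysis"
begin

section \<open>Domains with continuously differentiable boundary\<close>

primrec Ck :: "nat \<Rightarrow> (real ^ 'd \<Rightarrow> real) \<Rightarrow> bool" where
  "Ck 0 \<phi> \<longleftrightarrow> continuous_on UNIV \<phi>"
| "Ck (Suc k) \<phi> \<longleftrightarrow>
     (\<exists>G :: real ^ 'd \<Rightarrow> real ^ 'd.
        (\<forall>x. (\<phi> has_derivative (\<lambda>h. G x \<bullet> h)) (at x)) \<and> (\<forall>i. Ck k (\<lambda>x. G x $ i)))"

text \<open>
  Near each boundary point, \<open>\<Omega>\<close> is the strict epigraph, in the direction of some unit vector \<open>e\<close>,
  of a continuously differentiable function on the hyperplane orthogonal to \<open>e\<close>.  The function
  \<open>\<gamma>\<close> is defined on the whole space, but only its values on that hyperplane are used.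
\<close>

definition C1_boundary :: "(real ^ 'd) set \<Rightarrow> bool" where
  "C1_boundary \<Omega> \<longleftrightarrow>
     (\<forall>z \<in> frontier \<Omega>. \<exists>r > 0. \<exists>e \<gamma>. norm e = 1 \<and> Ck 1 \<gamma> \<and>
        \<Omega> \<inter> ball z r = {x \<in> ball z r. \<gamma> (x - (x \<bullet> e) *\<^sub>R e) < x \<bullet> e})"

section \<open>The Sobolev space and the Neumann Laplacian\<close>

definition test_functions :: "(real ^ 'd) set \<Rightarrow> (real ^ 'd \<Rightarrow> real) set" where
  "test_functions \<Omega> =
     {\<phi>. (\<forall>k. Ck k \<phi>) \<and> compact (closure {x. \<phi> x \<noteq> 0}) \<and> closure {x. \<phi> x \<noteq> 0} \<subseteq> \<Omega>}"

definition square_integrable ::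
    "(real ^ 'd) set \<Rightarrow> (real ^ 'd \<Rightarrow> 'b :: euclidean_space) \<Rightarrow> bool" where
  "square_integrable \<Omega> f \<longleftrightarrow>
     f \<in> borel_measurable (lebesgue_on \<Omega>) \<and> integrable (lebesgue_on \<Omega>) (\<lambda>x. (norm (f x))\<^sup>2)"

text \<open>
  \<open>H1 \<Omega> u g\<close>: the function \<open>u\<close> represents an element of the Sobolev space of order one (based on
  square-integrable functions), and \<open>g\<close> represents its weak gradient.
\<close>

definition H1 :: "(real ^ 'd) set \<Rightarrow> (real ^ 'd \<Rightarrow> real) \<Rightarrow> (real ^ 'd \<Rightarrow> real ^ 'd) \<Rightarrow> bool" where
  "H1 \<Omega> u g \<longleftrightarrow>
     square_integrable \<Omega> u \<and> square_integrable \<Omega> g \<and>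
     (\<forall>\<phi> \<in> test_functions \<Omega>. \<forall>k.
        (LINT x|lebesgue_on \<Omega>. u x * frechet_derivative \<phi> (at x) (axis k 1))
          = - (LINT x|lebesgue_on \<Omega>. g x $ k * \<phi> x))"

text \<open>
  Graph of the operator (with nonpositive spectrum) associated with the form
  \<open>(u, v) \<mapsto> \<integral> \<nabla>u \<bullet> \<nabla>v\<close> on the Sobolev space; the Neumann boundary condition is encoded by
  testing against all \<open>v\<close> of the Sobolev space.
\<close>

definition neumann_laplacian ::
    "(real ^ 'd) set \<Rightarrow> (real ^ 'd \<Rightarrow> real) \<Rightarrow> (real ^ 'd \<Rightarrow> real) \<Rightarrow> bool" where
  "neumann_laplacian \<Omega> u f \<longleftrightarrow>
     square_integrable \<Omega> f \<and>
     (\<exists>g. H1 \<Omega> u g \<and>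
        (\<forall>v w. H1 \<Omega> v w \<longrightarrow>
           (LINT x|lebesgue_on \<Omega>. g x \<bullet> w x) = - (LINT x|lebesgue_on \<Omega>. f x * v x)))"

section \<open>Contraction semigroups of continuous functions on a compact set\<close>

text \<open>
  Elements of the space of continuous real functions on a compact set \<open>K\<close> are represented by
  functions on the whole space that are continuous on \<open>K\<close>; values off \<open>K\<close> are irrelevant, and
  equalities are required on \<open>K\<close> only.  Linearity and contractivity force \<open>S t u\<close> to depend, on
  \<open>K\<close>, only on the restriction of \<open>u\<close> to \<open>K\<close>.  Convergence in sup norm is
  \<^const>\<open>uniform_limit\<close> on \<open>K\<close>.
\<close>

definition sup_norm :: "'a set \<Rightarrow> ('a \<Rightarrow> real) \<Rightarrow> real" where
  "sup_norm K u = (SUP x\<in>K. \<bar>u x\<bar>)"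

definition contraction_semigroup ::
    "'a :: topological_space set \<Rightarrow> (real \<Rightarrow> ('a \<Rightarrow> real) \<Rightarrow> 'a \<Rightarrow> real) \<Rightarrow> bool" where
  "contraction_semigroup K S \<longleftrightarrow>
     (\<forall>t \<ge> 0. \<forall>u. continuous_on K u \<longrightarrow> continuous_on K (S t u)) \<and>
     (\<forall>t \<ge> 0. \<forall>a b u v. continuous_on K u \<longrightarrow> continuous_on K v \<longrightarrow>
        (\<forall>x \<in> K. S t (\<lambda>y. a * u y + b * v y) x = a * S t u x + b * S t v x)) \<and>
     (\<forall>t \<ge> 0. \<forall>u. continuous_on K u \<longrightarrow> sup_norm K (S t u) \<le> sup_norm K u) \<and>
     (\<forall>u. continuous_on K u \<longrightarrow> (\<forall>x \<in> K. S 0 u x = u x)) \<and>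
     (\<forall>s \<ge> 0. \<forall>t \<ge> 0. \<forall>u. continuous_on K u \<longrightarrow> (\<forall>x \<in> K. S (s + t) u x = S s (S t u) x)) \<and>
     (\<forall>u. continuous_on K u \<longrightarrow> uniform_limit K (\<lambda>h. S h u) u (at_right 0))"

definition generator ::
    "'a :: topological_space set \<Rightarrow> (real \<Rightarrow> ('a \<Rightarrow> real) \<Rightarrow> 'a \<Rightarrow> real) \<Rightarrow>
     ('a \<Rightarrow> real) \<Rightarrow> ('a \<Rightarrow> real) \<Rightarrow> bool" where
  "generator K S u f \<longleftrightarrow>
     continuous_on K u \<and> continuous_on K f \<and>
     uniform_limit K (\<lambda>h x. (S h u x - u x) / h) f (at_right 0)"

text \<open>
  The generator is \<open>c\<close> times the part of the Neumann Laplacian in the continuous functions on the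
  closure.  Since a strongly continuous semigroup is determined by its generator, this
  characterizes \<open>S t u\<close> on \<open>closure \<Omega>\<close> for all \<open>t \<ge> 0\<close> and continuous \<open>u\<close>.
\<close>

definition neumann_heat_semigroup ::
    "(real ^ 'd) set \<Rightarrow> real \<Rightarrow> (real \<Rightarrow> (real ^ 'd \<Rightarrow> real) \<Rightarrow> real ^ 'd \<Rightarrow> real) \<Rightarrow> bool" where
  "neumann_heat_semigroup \<Omega> c S \<longleftrightarrow>
     contraction_semigroup (closure \<Omega>) S \<and>
     (\<forall>u f. continuous_on (closure \<Omega>) u \<longrightarrow> continuous_on (closure \<Omega>) f \<longrightarrow>
        (generator (closure \<Omega>) S u (\<lambda>x. c * f x) \<longleftrightarrow> neumann_laplacian \<Omega> u f))"

section \<open>Mild solutions and maximal trajectories\<close>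

definition time_interval :: "ereal \<Rightarrow> real set" where
  "time_interval T = {t. 0 \<le> t \<and> ereal t < T}"

text \<open>
  \<open>U t i x\<close> is \<open>u\<^sub>i(t, x)\<close>.  The function-valued integral in the variation of constants formula has
  an integrand that is continuous in sup norm, so it is evaluated pointwise.
\<close>

definition mild_solution ::
    "(real ^ 'd) set \<Rightarrow> ('n \<Rightarrow> real \<Rightarrow> (real ^ 'd \<Rightarrow> real) \<Rightarrow> real ^ 'd \<Rightarrow> real) \<Rightarrow>
     (real ^ 'n \<Rightarrow> real ^ 'n) \<Rightarrow> ereal \<Rightarrow> (real \<Rightarrow> 'n \<Rightarrow> real ^ 'd \<Rightarrow> real) \<Rightarrow> bool" where
  "mild_solution \<Omega> S F T U \<longleftrightarrow>
     (\<forall>i. \<forall>t \<in> time_interval T.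
        continuous_on (closure \<Omega>) (U t i) \<and>
        uniform_limit (closure \<Omega>) (\<lambda>s. U s i) (U t i) (at t within time_interval T) \<and>
        (\<forall>x \<in> closure \<Omega>.
           U t i x = S i t (U 0 i) x
             + integral {0..t} (\<lambda>s. S i (t - s) (\<lambda>y. F (\<chi> j. U s j y) $ i) x)))"

definition maximal_trajectory ::
    "(real ^ 'd) set \<Rightarrow> ('n \<Rightarrow> real \<Rightarrow> (real ^ 'd \<Rightarrow> real) \<Rightarrow> real ^ 'd \<Rightarrow> real) \<Rightarrow>
     (real ^ 'n \<Rightarrow> real ^ 'n) \<Rightarrow> ereal \<Rightarrow> (real \<Rightarrow> 'n \<Rightarrow> real ^ 'd \<Rightarrow> real) \<Rightarrow> bool" where
  "maximal_trajectory \<Omega> S F T U \<longleftrightarrow>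
     0 < T \<and> mild_solution \<Omega> S F T U \<and>
     \<not> (\<exists>T' V. T < T' \<and> mild_solution \<Omega> S F T' V \<and>
          (\<forall>t \<in> time_interval T. \<forall>i. \<forall>x \<in> closure \<Omega>. V t i x = U t i x))"

definition locally_Lipschitz :: "('a :: metric_space \<Rightarrow> 'b :: metric_space) \<Rightarrow> bool" where
  "locally_Lipschitz F \<longleftrightarrow> (\<forall>x. \<exists>r > 0. \<exists>L. L-lipschitz_on (cball x r) F)"

definition cond_P :: "(real ^ 'n \<Rightarrow> real ^ 'n) \<Rightarrow> bool" where
  "cond_P F \<longleftrightarrow> (\<forall>i u. u $ i = 0 \<and> (\<forall>j. j \<noteq> i \<longrightarrow> 0 \<le> u $ j) \<longrightarrow> 0 \<le> F u $ i)"

end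

theory Submission
  imports Defs
begin

text \<open>
  The heat semigroup fixes the constants and is a contraction, hence positive.  After adding a large
  multiple of \<open>u\<close> to the source term, condition \<open>(P)\<close> bounds the negative part of a mild solution
  by the time integral of its supremum; iterating this bound gives nonnegativity and the lower bound
  \<open>exp (- \<lambda> t) S t (u 0)\<close>.  So strict positivity reduces to that of the semigroup.

  For the latter, the powers \<open>w = ((R\<^sup>2 - \<bar>x - c\<bar>\<^sup>2)\<^sup>+) ^ n\<close> are weak Neumann subsolutions whenever the ball
  lies in \<open>\<Omega>\<close>, or its center lies on the inner normal at a boundary point and its radius is small
  (on the boundary part inside the ball the vector towards the center then points inwards).  If
  \<open>S t v\<close> vanished at \<open>z\<close>, the heat started at \<open>z\<close> would stay for a while in the set where the solution
  is not yet positive; there \<open>\<Delta>w \<ge> const n\<^sup>2 w\<close>, so \<open>S t w z\<close> would grow like \<open>exp (const n\<^sup>2 t)\<close>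
  whereas \<open>sup w / w z\<close> is only exponential in \<open>n\<close>.  This gives positivity first in \<open>\<Omega>\<close> by connectedness
  and then at the boundary.

  Conversely, spatially constant data evolve by the ordinary differential equation \<open>u' = F u\<close>, so a
  violation of \<open>(P)\<close> drives a small positive component negative.
\<close>

section \<open>Smooth functions and mollification\<close>

text \<open>The semigroup is known only through its generator, and the generator only through a weak
  form tested against \<open>H1\<close>; neither a heat kernel nor regularity of solutions is at
  hand. The basic objects are therefore the integrals of S s u over {0..t}: for every continuous u
  they lie in the domain of the generator, with value S t u - u, and they inherit from the form the
  symmetry of S in L^2. Symmetry allows a barrier w that violates the Neumann condition to be
  compared by duality: S t w is at least w plus the time integral of \<kappa> S s (\<Delta>w).

  A C^1 boundary need not satisfy an interior sphere condition, so the classical boundary point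
  lemma is out of reach. Here the ball may cross the boundary; only the sign of the flux of the
  barrier gradient matters, and this uses no more than continuity of the normal. The price is paid
  at the centre, near which \<Delta>w is negative: the set where positivity is still open has to
  keep a distance from it, and inside \<Omega> a separate argument with a cubic barrier shows that
  positivity at a point is never lost.\<close>

lemma Ck_imp_continuous: "Ck k f \<Longrightarrow> continuous_on UNIV f"
proof (cases k)
  case (Suc n)
  assume "Ck k f"
  with Suc show ?thesis
    by (auto intro!: has_derivative_continuous simp: continuous_on_eq_continuous_at)
qed simp

lemma Ck_SucD: "Ck (Suc k) f \<Longrightarrow> Ck k f"
proof (induction k arbitrary: f)
  case 0
  then have "continuous_on UNIV f" by (rule Ck_imp_continuous)
  then show ?case by simp
next
  case (Suc k)
  then obtain G where "\<forall>x. (f has_derivative (\<lambda>h. G x \<bullet> h)) (at x)" "\<forall>i. Ck (Suc k) (\<lambda>x. G x $ i)"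
    using Ck.simps(2) by blast
  then show ?case using Suc.IH by auto
qed

lemma Ck_const: "Ck k (\<lambda>x. c)"
proof (induction k arbitrary: c)
  case (Suc k)
  then show ?case by (auto intro!: exI[of _ "\<lambda>x. 0"] derivative_eq_intros)
qed simp

lemma Ck_component: "Ck k (\<lambda>x :: real ^ 'd. x $ i)"
proof (cases k)
  case (Suc n)
  have "((\<lambda>x. x $ i) has_derivative (\<lambda>h. axis i 1 \<bullet> h)) (at x)" for x :: "real ^ 'd"
    using bounded_linear_imp_has_derivative[OF bounded_linear_vec_nth] by (simp add: inner_axis')
  then show ?thesis using Suc by (auto intro!: exI[of _ "\<lambda>x. axis i 1"] Ck_const)
qed (auto intro!: continuous_intros)

lemma Ck_add: "Ck k f \<Longrightarrow> Ck k g \<Longrightarrow> Ck k (\<lambda>x. f x + g x)"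
proof (induction k arbitrary: f g)
  case (Suc k)
  then obtain F G where
    F: "\<forall>x. (f has_derivative (\<lambda>h. F x \<bullet> h)) (at x)" "\<forall>i. Ck k (\<lambda>x. F x $ i)" and
    G: "\<forall>x. (g has_derivative (\<lambda>h. G x \<bullet> h)) (at x)" "\<forall>i. Ck k (\<lambda>x. G x $ i)"
    by auto
  have "((\<lambda>x. f x + g x) has_derivative (\<lambda>h. (F x + G x) \<bullet> h)) (at x)" for x
    by (rule derivative_eq_intros F(1)[rule_format] G(1)[rule_format])+ (simp add: inner_add_left)
  then show ?case using F(2) G(2) Suc.IH by (auto intro!: exI[of _ "\<lambda>x. F x + G x"])
qed (auto intro!: continuous_intros)

lemma Ck_mult: "Ck k f \<Longrightarrow> Ck k g \<Longrightarrow> Ck k (\<lambda>x. f x * g x)"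
proof (induction k arbitrary: f g)
  case (Suc k)
  then obtain F G where
    F: "\<forall>x. (f has_derivative (\<lambda>h. F x \<bullet> h)) (at x)" "\<forall>i. Ck k (\<lambda>x. F x $ i)" and
    G: "\<forall>x. (g has_derivative (\<lambda>h. G x \<bullet> h)) (at x)" "\<forall>i. Ck k (\<lambda>x. G x $ i)"
    by auto
  have "((\<lambda>x. f x * g x) has_derivative (\<lambda>h. (f x *\<^sub>R G x + g x *\<^sub>R F x) \<bullet> h)) (at x)" for x
    by (rule derivative_eq_intros F(1)[rule_format] G(1)[rule_format])+ (simp add: inner_add_left mult.commute)
  moreover have "Ck k (\<lambda>x. (f x *\<^sub>R G x + g x *\<^sub>R F x) $ i)" for i
    using F(2) G(2) Suc.prems[THEN Ck_SucD] by (auto intro!: Ck_add Suc.IH)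
  ultimately show ?case by (auto intro!: exI[of _ "\<lambda>x. f x *\<^sub>R G x + g x *\<^sub>R F x"])
qed (auto intro!: continuous_intros)

text \<open>The classical flat function exp (-1/s), divided by powers of s: differentiation maps
  this family into its own linear span, so smoothness becomes an induction on the order, uniformly
  in \<open>m\<close>.\<close>

definition flat_exp :: "nat \<Rightarrow> real \<Rightarrow> real" where
  "flat_exp m s = (if s > 0 then exp (- (1 / s)) / s ^ m else 0)"

lemma flat_exp_nonneg: "0 \<le> flat_exp m s"
  by (simp add: flat_exp_def)

text \<open>A single term of the exponential series, (1/s)^(m+2) / (m+2)!, is below exp (1/s).
  Quadratic decay is what forces the difference quotient at 0 to vanish.\<close>

lemma flat_exp_le: "flat_exp m s \<le> fact (m + 2) * s\<^sup>2"
proof (cases "s > 0")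
  case True
  have "(1 / s) ^ (m + 2) / fact (m + 2) \<le> exp (1 / s)"
  proof -
    have "(1 / s) ^ (m + 2) /\<^sub>R fact (m + 2) \<le> (\<Sum>n. (1 / s) ^ n /\<^sub>R fact n)"
      using True sum_le_suminf[OF summable_exp_generic[of "1 / s"], of "{m + 2}"] by (simp del: fact_Suc)
    then show ?thesis by (simp add: exp_def field_simps)
  qed
  then have "1 \<le> exp (1 / s) * (fact (m + 2) * s ^ (m + 2))"
    using True by (simp add: field_simps del: fact_Suc)
  then have "exp (- (1 / s)) \<le> fact (m + 2) * s ^ (m + 2)"
    by (simp add: exp_minus field_simps del: fact_Suc)
  then have "exp (- (1 / s)) / s ^ m \<le> fact (m + 2) * s ^ (m + 2) / s ^ m"
    using True by (intro divide_right_mono) auto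
  then show ?thesis using True by (simp add: flat_exp_def power_add power2_eq_square del: fact_Suc)
qed (simp add: flat_exp_def)

lemma flat_exp_has_derivative:
  "(flat_exp m has_real_derivative flat_exp (m + 2) s - m * flat_exp (m + 1) s) (at s)"
proof -
  consider "s > 0" | "s < 0" | "s = 0" by linarith
  then show ?thesis
  proof cases
    case 1
    have "((\<lambda>s. exp (- (1 / s)) / s ^ m) has_real_derivative flat_exp (m + 2) s - m * flat_exp (m + 1) s) (at s)"
      using 1 by (auto intro!: derivative_eq_intros simp: flat_exp_def divide_simps)
        (cases m; simp add: algebra_simps power2_eq_square)
    then show ?thesis
      by (rule DERIV_cong_ev[THEN iffD2, rotated -1])
        (use 1 in \<open>auto simp: flat_exp_def intro!: eventually_mono[OF eventually_nhds_in_open[of "{0<..}"]]\<close>)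
  next
    case 2
    have "((\<lambda>s. 0) has_real_derivative flat_exp (m + 2) s - m * flat_exp (m + 1) s) (at s)"
      using 2 by (simp add: flat_exp_def)
    then show ?thesis
      by (rule DERIV_cong_ev[THEN iffD2, rotated -1])
        (use 2 in \<open>auto simp: flat_exp_def intro!: eventually_mono[OF eventually_nhds_in_open[of "{..<0}"]]\<close>)
  next
    case 3
    have "(\<lambda>h. flat_exp m h / h) \<midarrow>0\<rightarrow> 0"
    proof (rule Lim_null_comparison)
      show "\<forall>\<^sub>F h in at 0. norm (flat_exp m h / h) \<le> fact (m + 2) * \<bar>h\<bar>"
      proof (rule always_eventually, rule)
        fix h :: real
        have "\<bar>flat_exp m h\<bar> \<le> fact (m + 2) * \<bar>h\<bar> * \<bar>h\<bar>"
          using flat_exp_le[of m h] flat_exp_nonneg[of m h] by (simp add: power2_eq_square mult.assoc del: fact_Suc)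
        then show "norm (flat_exp m h / h) \<le> fact (m + 2) * \<bar>h\<bar>"
          by (cases "h = 0") (simp_all add: divide_simps mult.commute del: fact_Suc)
      qed
      show "((\<lambda>h. fact (m + 2) * \<bar>h\<bar>) \<longlongrightarrow> (0 :: real)) (at 0)"
        by (auto intro!: tendsto_eq_intros)
    qed
    then show ?thesis using 3 by (simp add: DERIV_def flat_exp_def)
  qed
qed

text \<open>The standard mollifier kernel before normalisation. The squared norm as argument keeps
  it differentiable at the centre.\<close>

definition bump :: "real \<Rightarrow> real ^ 'd \<Rightarrow> real" where
  "bump e x = flat_exp 0 (e\<^sup>2 - x \<bullet> x)"

lemma Ck_flat_exp: "Ck k (\<lambda>x :: real ^ 'd. flat_exp m (e - x \<bullet> x))"
proof (induction k arbitrary: m)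
  case 0
  have "isCont (flat_exp m) s" for s
    using flat_exp_has_derivative DERIV_isCont by blast
  then have "continuous_on UNIV (flat_exp m)" by (simp add: continuous_on_eq_continuous_at)
  then show ?case by (auto intro!: continuous_on_compose2[of UNIV "flat_exp m"] continuous_intros)
next
  case (Suc k)
  let ?D = "\<lambda>x :: real ^ 'd. flat_exp (m + 2) (e - x \<bullet> x) - m * flat_exp (m + 1) (e - x \<bullet> x)"
  have "((\<lambda>x :: real ^ 'd. flat_exp m (e - x \<bullet> x)) has_derivative (\<lambda>h. ((- 2 * ?D x) *\<^sub>R x) \<bullet> h)) (at x)" for x :: "real ^ 'd"
  proof -
    have "((\<lambda>x :: real ^ 'd. e - x \<bullet> x) has_derivative (\<lambda>h. - 2 * (x \<bullet> h))) (at x)"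
      by (auto intro!: derivative_eq_intros simp: inner_commute)
    from DERIV_compose_FDERIV[OF flat_exp_has_derivative this, of m]
    show ?thesis
      by (rule has_derivative_eq_rhs) (simp add: fun_eq_iff algebra_simps)
  qed
  moreover have "Ck k (\<lambda>x. ((- 2 * ?D x) *\<^sub>R x) $ i)" for i
  proof -
    have "Ck k (\<lambda>x. (- 2 * (flat_exp (m + 2) (e - x \<bullet> x) + (- real m) * flat_exp (m + 1) (e - x \<bullet> x))) * x $ i)"
      by (intro Ck_mult Ck_add Ck_const Ck_component Suc.IH)
    then show ?thesis by simp
  qed
  ultimately show ?case by (auto simp del: mult_minus_left intro!: exI[of _ "\<lambda>x. (- 2 * ?D x) *\<^sub>R x"])
qed

lemma Ck_bump: "Ck k (bump e)"
  unfolding bump_def[abs_def] by (rule Ck_flat_exp)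

lemma bump_nonneg: "0 \<le> bump e x"
  by (simp add: bump_def flat_exp_nonneg)

lemma bump_eq_0: "0 < e \<Longrightarrow> e \<le> norm x \<Longrightarrow> bump e x = 0"
  using power_mono[of e "norm x" 2] by (auto simp: bump_def flat_exp_def dot_square_norm not_less)

lemma bump_pos: "0 < e \<Longrightarrow> norm x < e \<Longrightarrow> 0 < bump e x"
  using power_strict_mono[of "norm x" e 2] by (simp add: bump_def flat_exp_def dot_square_norm)

section \<open>Integrals of continuous functions with compact support\<close>

lemma has_integral_UNIV_supported:
  fixes f :: "'a :: euclidean_space \<Rightarrow> real"
  assumes "continuous_on UNIV f" "\<And>x. x \<notin> cbox a b \<Longrightarrow> f x = 0"
  shows "(f has_integral integral (cbox a b) f) UNIV"
  using has_integral_on_superset[of f "integral (cbox a b) f" "cbox a b" UNIV] assms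
    integrable_continuous[of a b f] continuous_on_subset[of UNIV f "cbox a b"]
  by (auto simp: integrable_integral)

lemma integral_supported:
  fixes f :: "'a :: euclidean_space \<Rightarrow> real"
  assumes "continuous_on UNIV f" "\<And>x. x \<notin> cbox a b \<Longrightarrow> f x = 0"
  shows "integral UNIV f = integral (cbox a b) f"
  using has_integral_UNIV_supported[OF assms] by (rule integral_unique)

lemma bounded_subset_cbox_ball:
  fixes C :: "'a :: euclidean_space set"
  assumes "bounded C"
  obtains a where "\<And>x. x \<in> C \<Longrightarrow> cball x r \<subseteq> cbox (- a) a"
proof -
  from assms have "bounded (\<Union>x\<in>C. cball x r)"
  proof -
    obtain B where "\<And>x. x \<in> C \<Longrightarrow> norm x \<le> B" using assms by (auto simp: bounded_iff)
    then have "norm y \<le> B + r" if "x \<in> C" "y \<in> cball x r" for x y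
      using that norm_triangle_ineq[of x "y - x"] by (fastforce simp: dist_norm norm_minus_commute)
    then show ?thesis unfolding bounded_iff by blast
  qed
  then obtain a where "(\<Union>x\<in>C. cball x r) \<subseteq> cbox (- a) a"
    using bounded_subset_cbox_symmetric by blast
  then show thesis using that by blast
qed

lemma gradient_eq_0_outside:
  fixes \<psi> :: "real ^ 'd \<Rightarrow> real"
  assumes "closed C" "\<And>x. x \<notin> C \<Longrightarrow> \<psi> x = 0" "(\<psi> has_derivative (\<lambda>h. G \<bullet> h)) (at x)" "x \<notin> C"
  shows "G = 0"
proof -
  have "((\<lambda>x. 0) has_derivative (\<lambda>h. G \<bullet> h)) (at x)"
    by (rule has_derivative_transform_within_open[OF assms(3), of "- C"]) (use assms in auto)
  then have "(\<lambda>h. G \<bullet> h) = (\<lambda>h. 0)"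
    by (rule has_derivative_unique) (rule has_derivative_const)
  then have "G \<bullet> G = 0" by metis
  then show ?thesis by simp
qed

text \<open>Translation invariance: the integral of \<open>F (x + h e\<^sub>k)\<close> does not depend on \<open>h\<close>.\<close>

lemma integral_partial_derivative_eq_0:
  fixes F :: "real ^ 'd \<Rightarrow> real"
  assumes F: "\<And>x. (F has_derivative (\<lambda>h. G x \<bullet> h)) (at x)" and G: "continuous_on UNIV G"
    and C: "compact C" "\<And>x. x \<notin> C \<Longrightarrow> F x = 0"
  shows "integral UNIV (\<lambda>x. G x $ k) = 0"
proof -
  have cF: "continuous_on UNIV F"
    using F by (auto intro!: has_derivative_continuous simp: continuous_on_eq_continuous_at)
  obtain a where a: "\<And>x. x \<in> C \<Longrightarrow> cball x 1 \<subseteq> cbox (- a) a"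
    using bounded_subset_cbox_ball[of C 1] compact_imp_bounded[OF C(1)] by blast
  \<comment> \<open>The box leaves a margin of 1 around the support, so shifts by at most 1 keep the
    support inside one fixed box, over which Leibniz's rule applies.\<close>
  define \<Psi> where "\<Psi> h = integral (cbox (- a) a) (\<lambda>x. F (x + h *\<^sub>R axis k 1))" for h
  have \<Psi>: "\<Psi> h = \<Psi> 0" if "h \<in> {-1..1}" for h
  proof -
    define c :: "real ^ 'd" where "c = h *\<^sub>R axis k 1"
    have nc: "norm c \<le> 1" using that by (auto simp: c_def)
    have out: "F (x + c) = 0" if "x \<notin> cbox (- a) a" for x
    proof (rule C(2))
      have "x \<in> cball (x + c) 1" using nc by (simp add: dist_norm)
      from subsetD[OF a this] that show "x + c \<notin> C" by auto
    qed
    have out0: "F x = 0" if "x \<notin> cbox (- a) a" for x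
    proof (rule C(2), rule notI)
      assume "x \<in> C"
      have "x \<in> cball x 1" by simp
      from subsetD[OF a[OF \<open>x \<in> C\<close>] this] that show False by simp
    qed
    have out1: "F x = 0" if "x \<notin> cbox (- a + c) (a + c)" for x
    proof (rule C(2), rule notI)
      assume "x \<in> C"
      have "x - c \<in> cball x 1" using nc by (simp add: dist_norm)
      from subsetD[OF a[OF \<open>x \<in> C\<close>] this] have "x - c \<in> cbox (- a) a" .
      then show False using that by (auto simp: mem_box inner_diff_left inner_add_left algebra_simps)
    qed
    have "\<Psi> h = integral (cbox (- a + c) (a + c)) F"
      using integral_shift_cbox[of "- a + c" c "a + c" F] by (simp add: \<Psi>_def c_def)
    also have "\<dots> = integral UNIV F" by (rule integral_supported[symmetric]) (use cF out1 in auto)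
    also have "\<dots> = \<Psi> 0" unfolding \<Psi>_def by (simp add: integral_supported[OF cF out0])
    finally show ?thesis .
  qed
  have "((\<lambda>h. integral (cbox (- a) a) (\<lambda>x. F (x + h *\<^sub>R axis k 1))) has_vector_derivative
      integral (cbox (- a) a) (\<lambda>x. G (x + 0 *\<^sub>R axis k 1) $ k)) (at 0 within {-1..1})"
  proof (rule leibniz_rule_vector_derivative)
    fix h :: real and x :: "real ^ 'd"
    have "((\<lambda>h. x + h *\<^sub>R axis k 1) has_derivative (\<lambda>h. h *\<^sub>R axis k 1)) (at h within {-1..1})"
      by (auto intro!: derivative_eq_intros)
    from has_derivative_compose[OF this F] 
    show "((\<lambda>h. F (x + h *\<^sub>R axis k 1)) has_vector_derivative G (x + h *\<^sub>R axis k 1) $ k) (at h within {-1..1})"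
      by (simp add: has_vector_derivative_def inner_axis)
  next
    fix h :: real
    show "(\<lambda>x. F (x + h *\<^sub>R axis k 1)) integrable_on cbox (- a) a"
      by (intro integrable_continuous continuous_on_compose2[OF cF] continuous_intros) auto
  next
    show "continuous_on ({- 1..1} \<times> cbox (- a) a) (\<lambda>(h, x). G (x + h *\<^sub>R axis k 1) $ k)"
      unfolding split_beta by (intro continuous_intros continuous_on_compose2[OF G]) auto
  qed auto
  then have "(\<Psi> has_vector_derivative integral (cbox (- a) a) (\<lambda>x. G x $ k)) (at 0 within {-1..1})"
    unfolding \<Psi>_def[abs_def] by simp
  from has_vector_derivative_transform[OF _ _ this, of "\<lambda>h. \<Psi> 0"] \<Psi>[symmetric]
  have "((\<lambda>h. \<Psi> 0) has_vector_derivative integral (cbox (- a) a) (\<lambda>x. G x $ k)) (at 0 within {-1..1})"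
    by simp
  moreover have "((\<lambda>h. \<Psi> 0) has_vector_derivative 0) (at (0 :: real) within {-1..1})"
    by simp
  ultimately have "integral (cbox (- a) a) (\<lambda>x. G x $ k) = 0"
    using vector_derivative_unique_within_closed_interval[of "-1 :: real" 1 0 "\<lambda>h. \<Psi> 0"] by simp
  moreover have "G x $ k = 0" if "x \<notin> cbox (- a) a" for x
  proof -
    have "x \<notin> C"
    proof
      assume "x \<in> C"
      have "x \<in> cball x 1" by simp
      from subsetD[OF a[OF \<open>x \<in> C\<close>] this] that show False by simp
    qed
    from gradient_eq_0_outside[OF compact_imp_closed[OF C(1)] C(2) F this] show ?thesis by simp
  qed
  ultimately show ?thesis
    by (subst integral_supported[of _ "- a" a]) (use G in \<open>auto intro!: continuous_intros\<close>)
qed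

text \<open>\<open>Ck (Suc k)\<close> yields a gradient for each k separately; uniqueness of the
  derivative identifies all of them.\<close>

lemma Ck_gradient:
  fixes f :: "real ^ 'd \<Rightarrow> real"
  assumes "\<And>k. Ck k f"
  obtains G where "\<And>x. (f has_derivative (\<lambda>h. G x \<bullet> h)) (at x)" "\<And>k i. Ck k (\<lambda>x. G x $ i)"
proof -
  obtain G where G: "\<And>x. (f has_derivative (\<lambda>h. G x \<bullet> h)) (at x)"
    using assms[of "Suc 0"] by auto
  have "Ck k (\<lambda>x. G x $ i)" for k i
  proof -
    obtain G' where G': "\<And>x. (f has_derivative (\<lambda>h. G' x \<bullet> h)) (at x)" "Ck k (\<lambda>x. G' x $ i)"
      using assms[of "Suc k"] by auto
    have "G x $ i = G' x $ i" for x
      using has_derivative_unique[OF G G'(1), of x] fun_cong[of _ _ "axis i 1"] by (metis cart_eq_inner_axis)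
    then show ?thesis using G'(2) by simp
  qed
  with G show thesis using that by blast
qed

text \<open>The derivative falls on the kernel alone, so continuity of \<open>\<psi>\<close>
  suffices. The same formula, with a component of \<open>G\<close> as the new kernel, drives the
  induction for higher orders.\<close>

lemma convolution_has_derivative:
  fixes \<rho> \<psi> :: "real ^ 'd \<Rightarrow> real"
  assumes \<rho>: "\<And>x. (\<rho> has_derivative (\<lambda>h. G x \<bullet> h)) (at x)" and G: "continuous_on UNIV G"
    and \<psi>: "continuous_on UNIV \<psi>"
  shows "((\<lambda>x. integral (cbox a b) (\<lambda>y. \<rho> (x - y) * \<psi> y)) has_derivative
    (\<lambda>h. (\<chi> i. integral (cbox a b) (\<lambda>y. G (x - y) $ i * \<psi> y)) \<bullet> h)) (at x)"
proof -
  have c\<rho>: "continuous_on UNIV \<rho>"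
    using \<rho> by (auto intro!: has_derivative_continuous simp: continuous_on_eq_continuous_at)
  let ?f = "\<lambda>x y. blinfun_inner_right (\<psi> y *\<^sub>R G (x - y))"
  have "((\<lambda>x. integral (cbox a b) (\<lambda>y. \<rho> (x - y) * \<psi> y)) has_derivative integral (cbox a b) (?f x)) (at x within UNIV)"
  proof (rule leibniz_rule)
    fix x y :: "real ^ 'd"
    have "((\<lambda>x. \<rho> (x - y)) has_derivative (\<lambda>h. G (x - y) \<bullet> h)) (at x)"
      by (rule has_derivative_compose[OF _ \<rho>, of "\<lambda>x. x - y" "\<lambda>h. h", simplified])
        (auto intro!: derivative_eq_intros)
    from has_derivative_mult_left[OF this, of "\<psi> y"]
    show "((\<lambda>x. \<rho> (x - y) * \<psi> y) has_derivative blinfun_apply (?f x y)) (at x within UNIV)"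
      by (simp add: mult.commute inner_scaleR_left[abs_def])
  next
    show "continuous_on (UNIV \<times> cbox a b) (\<lambda>(x, t). ?f x t)"
      unfolding split_beta
      by (intro continuous_intros bounded_linear.continuous_on[OF bounded_linear_blinfun_inner_right]
        continuous_on_compose2[OF G] continuous_on_compose2[OF \<psi>]) auto
  qed (auto intro!: integrable_continuous continuous_intros continuous_on_compose2[OF c\<rho>] continuous_on_compose2[OF \<psi>])
  moreover
  have "blinfun_apply (integral (cbox a b) (?f x)) h
      = (\<chi> i. integral (cbox a b) (\<lambda>y. G (x - y) $ i * \<psi> y)) \<bullet> h" for h
  proof -
    have "?f x integrable_on cbox a b"
      by (intro integrable_continuous continuous_intros bounded_linear.continuous_on[OF bounded_linear_blinfun_inner_right]
        continuous_on_compose2[OF G] continuous_on_compose2[OF \<psi>]) auto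
    then have "blinfun_apply (integral (cbox a b) (?f x)) h = integral (cbox a b) (\<lambda>y. \<Sum>i\<in>UNIV. (G (x - y) $ i * \<psi> y) * h $ i)"
      by (subst blinfun_apply_integral) (auto simp: inner_vec_def sum_distrib_left mult_ac)
    also have "\<dots> = (\<Sum>i\<in>UNIV. integral (cbox a b) (\<lambda>y. (G (x - y) $ i * \<psi> y) * h $ i))"
      by (intro integral_sum integrable_continuous continuous_intros
        continuous_on_compose2[OF G] continuous_on_compose2[OF \<psi>]) auto
    finally show ?thesis by (simp add: inner_vec_def)
  qed
  then have "blinfun_apply (integral (cbox a b) (?f x)) = (\<lambda>h. (\<chi> i. integral (cbox a b) (\<lambda>y. G (x - y) $ i * \<psi> y)) \<bullet> h)"
    by (rule ext)
  ultimately show ?thesis by (simp only:)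
qed

lemma continuous_on_vec_componentwise:
  "(\<And>i. continuous_on S (\<lambda>x. f x $ i)) \<Longrightarrow> continuous_on S f"
  using continuous_on_vec_lambda[of S "\<lambda>i x. f x $ i"] by simp

lemma Ck_convolution:
  fixes \<rho> \<psi> :: "real ^ 'd \<Rightarrow> real"
  assumes "\<And>k. Ck k \<rho>" "continuous_on UNIV \<psi>"
  shows "Ck k (\<lambda>x. integral (cbox a b) (\<lambda>y. \<rho> (x - y) * \<psi> y))"
  using assms(1)
proof (induction k arbitrary: \<rho>)
  case 0
  obtain G where G: "\<And>x. (\<rho> has_derivative (\<lambda>h. G x \<bullet> h)) (at x)" "\<And>k i. Ck k (\<lambda>x. G x $ i)"
    using Ck_gradient[OF 0] by blast
  have "continuous_on UNIV G"
    using G(2)[THEN Ck_imp_continuous] by (rule continuous_on_vec_componentwise)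
  from convolution_has_derivative[OF G(1) this assms(2)]
  show ?case by (auto intro!: has_derivative_continuous simp: continuous_on_eq_continuous_at)
next
  case (Suc k)
  obtain G where G: "\<And>x. (\<rho> has_derivative (\<lambda>h. G x \<bullet> h)) (at x)" "\<And>k i. Ck k (\<lambda>x. G x $ i)"
    using Ck_gradient[OF Suc.prems] by blast
  have "continuous_on UNIV G"
    using G(2)[THEN Ck_imp_continuous] by (rule continuous_on_vec_componentwise)
  from convolution_has_derivative[OF G(1) this assms(2)] Suc.IH[OF G(2)]
  show ?case unfolding Ck.simps
    by (intro exI[of _ "\<lambda>x. \<chi> i. integral (cbox a b) (\<lambda>y. G (x - y) $ i * \<psi> y)"]) simp
qed

text \<open>Prepares the passage from smooth to C^1 test functions. Mollifying commutes with taking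
  the gradient, so one small radius controls the function and its gradient uniformly, while the
  support grows by at most that radius and stays in \<open>\<Omega>\<close>.\<close>

lemma mollification:
  fixes \<psi> :: "real ^ 'd \<Rightarrow> real"
  assumes \<psi>: "\<And>x. (\<psi> has_derivative (\<lambda>h. G x \<bullet> h)) (at x)" and G: "continuous_on UNIV G"
    and C: "compact C" "C \<subseteq> \<Omega>" "\<And>x. x \<notin> C \<Longrightarrow> \<psi> x = 0" and "open \<Omega>" and "0 < \<epsilon>"
  obtains \<phi> H where "\<phi> \<in> test_functions \<Omega>" "\<And>x. (\<phi> has_derivative (\<lambda>h. H x \<bullet> h)) (at x)"
    "continuous_on UNIV H"
    "\<And>x. \<bar>\<phi> x - \<psi> x\<bar> \<le> \<epsilon>" "\<And>x k. \<bar>H x $ k - G x $ k\<bar> \<le> \<epsilon>"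
proof -
  have c\<psi>: "continuous_on UNIV \<psi>"
    using \<psi> by (auto intro!: has_derivative_continuous simp: continuous_on_eq_continuous_at)
  have G0: "G x = 0" if "x \<notin> C" for x
    by (rule gradient_eq_0_outside[OF compact_imp_closed[OF C(1)] C(3) \<psi> that])
  obtain a where a: "\<And>x. x \<in> C \<Longrightarrow> cball x 1 \<subseteq> cbox (- a) a"
    using bounded_subset_cbox_ball[of C 1] compact_imp_bounded[OF C(1)] by blast
  have Ca: "x \<in> cbox (- a) a" if "x \<in> C" for x using a[OF that] by auto
  obtain d0 where d0: "d0 > 0" "\<And>x y. x \<in> C \<Longrightarrow> norm (y - x) \<le> d0 \<Longrightarrow> y \<in> \<Omega>"
  proof (cases "C = {}")
    case True then show ?thesis using that[of 1] by auto
  next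
    case False
    obtain e where "e > 0" "(\<Union>x\<in>C. cball x e) \<subseteq> \<Omega>"
      using compact_subset_open_imp_cball_epsilon_subset[OF C(1) \<open>open \<Omega>\<close> C(2)] by blast
    then show ?thesis using that[of e] by (force simp: dist_norm norm_minus_commute)
  qed
  have unif: "\<exists>d>0. \<forall>x y. norm (y - x) \<le> d \<longrightarrow> \<bar>f y - f x\<bar> \<le> \<epsilon>"
    if f: "continuous_on UNIV f" "\<And>x. x \<notin> C \<Longrightarrow> f x = 0" for f :: "real ^ 'd \<Rightarrow> real"
  proof -
    have "uniformly_continuous_on (cbox (- a) a) f"
      by (intro compact_uniformly_continuous continuous_on_subset[OF f(1)]) auto
    then obtain d where d: "d > 0" "\<And>x y. x \<in> cbox (- a) a \<Longrightarrow> y \<in> cbox (- a) a \<Longrightarrow> dist y x < d \<Longrightarrow> dist (f y) (f x) < \<epsilon>"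
      using \<open>0 < \<epsilon>\<close> unfolding uniformly_continuous_on_def by metis
    have "\<bar>f y - f x\<bar> \<le> \<epsilon>" if "norm (y - x) \<le> min 1 (d / 2)" for x y
    proof (cases "x \<in> C \<or> y \<in> C")
      case True
      then have "x \<in> cbox (- a) a \<and> y \<in> cbox (- a) a"
        using a[of x] a[of y] Ca[of x] Ca[of y] that by (auto simp: dist_norm norm_minus_commute subset_iff)
      then show ?thesis using d(2)[of x y] that \<open>d > 0\<close> by (auto simp: dist_norm)
    next
      case False
      then show ?thesis using f(2)[of x] f(2)[of y] \<open>0 < \<epsilon>\<close> by simp
    qed
    then show ?thesis using \<open>d > 0\<close> by (intro exI[of _ "min 1 (d / 2)"]) auto
  qed
  obtain d1 where d1: "d1 > 0" "\<And>x y. norm (y - x) \<le> d1 \<Longrightarrow> \<bar>\<psi> y - \<psi> x\<bar> \<le> \<epsilon>"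
    using unif[OF c\<psi> C(3)] by blast
  have "\<exists>d>0. \<forall>x y. norm (y - x) \<le> d \<longrightarrow> \<bar>G y $ k - G x $ k\<bar> \<le> \<epsilon>" for k
    by (rule unif) (use G G0 in \<open>auto intro!: continuous_intros\<close>)
  then obtain d2 where d2: "\<And>k. d2 k > 0" "\<And>k x y. norm (y - x) \<le> d2 k \<Longrightarrow> \<bar>G y $ k - G x $ k\<bar> \<le> \<epsilon>"
    by metis
  \<comment> \<open>One radius for all requirements: distance of the support to the complement of
    \<open>\<Omega>\<close>, and the moduli of continuity of \<open>\<psi>\<close> and of every
    component of \<open>G\<close>.\<close>
  define e where "e = Min (insert d0 (insert d1 (range d2)))"
  have e: "e > 0" "e \<le> d0" "e \<le> d1" "\<And>k. e \<le> d2 k"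
    using d0(1) d1(1) d2(1) by (simp_all add: e_def) (metis Min_le finite finite_imageI min.coboundedI2 rangeI)
  have cb: "continuous_on UNIV (bump e :: real ^ 'd \<Rightarrow> real)" using Ck_imp_continuous[OF Ck_bump] .
  obtain b where b: "cball 0 e \<subseteq> cbox (- b) (b :: real ^ 'd)"
    using bounded_subset_cbox_symmetric[OF bounded_cball] by blast
  have b0: "bump e x = 0" if "x \<notin> cbox (- b) b" for x
  proof -
    have "x \<notin> cball 0 e" using b that by blast
    then show ?thesis by (intro bump_eq_0[OF e(1)]) simp
  qed
  define Z where "Z = integral (cbox (- b) b) (bump e)"
  have intZ: "(bump e has_integral Z) (cbox (- b) b)"
    unfolding Z_def by (intro integrable_integral integrable_continuous continuous_on_subset[OF cb]) auto
  have "Z \<noteq> 0"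
  proof
    assume "Z = 0"
    have "ball 0 e \<subseteq> box (- b) b"
      using interior_mono[OF b] by (simp add: interior_cbox)
    moreover have "0 \<in> ball (0 :: real ^ 'd) e" "0 \<in> cball (0 :: real ^ 'd) e" using e(1) by auto
    ultimately have "box (- b) b \<noteq> {}" "0 \<in> cbox (- b) b" using b by blast+
    moreover have "(bump e has_integral 0) (cbox (- b) b)" using intZ \<open>Z = 0\<close> by simp
    moreover have "continuous_on (cbox (- b) b) (bump e)" by (rule continuous_on_subset[OF cb]) simp
    ultimately have "bump e (0 :: real ^ 'd) = 0"
      using has_integral_0_cbox_imp_0[of "- b" b "bump e" 0] bump_nonneg by blast
    then show False using bump_pos[of e "0 :: real ^ 'd"] e(1) by simp
  qed
  moreover have "0 \<le> Z" unfolding Z_def by (rule integral_nonneg) (use intZ bump_nonneg in auto)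
  ultimately have Z: "Z > 0" by simp
  define \<rho> where "\<rho> = (\<lambda>x :: real ^ 'd. (1 / Z) * bump e x)"
  have Ck\<rho>: "Ck k \<rho>" for k unfolding \<rho>_def by (intro Ck_mult Ck_const Ck_bump)
  have c\<rho>: "continuous_on UNIV \<rho>" using Ck_imp_continuous[OF Ck\<rho>] .
  have \<rho>: "\<rho> x \<ge> 0" "e \<le> norm x \<Longrightarrow> \<rho> x = 0" "x \<notin> cbox (- b) b \<Longrightarrow> \<rho> x = 0" "\<rho> (- x) = \<rho> x" for x
    using Z b0 bump_eq_0[OF e(1)] by (auto simp: \<rho>_def bump_nonneg) (simp add: bump_def)
  obtain G\<rho> where G\<rho>: "\<And>x. (\<rho> has_derivative (\<lambda>h. G\<rho> x \<bullet> h)) (at x)" "\<And>k i. Ck k (\<lambda>x. G\<rho> x $ i)"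
    using Ck_gradient[OF Ck\<rho>] by blast
  have cG\<rho>: "continuous_on UNIV G\<rho>"
    using G\<rho>(2)[THEN Ck_imp_continuous] by (rule continuous_on_vec_componentwise)
  have int1: "((\<lambda>y. \<rho> (x - y)) has_integral 1) UNIV" for x
  proof -
    have "(\<rho> has_integral 1) (cbox (- b) b)"
      using has_integral_mult_right[OF intZ, of "1 / Z"] Z by (simp add: \<rho>_def)
    from has_integral_shift_cbox[OF this, of "- x"]
    have "((\<lambda>y. \<rho> (y + - x)) has_integral 1) (cbox (- b + x) (b + x))" by simp
    moreover have "(\<lambda>y. \<rho> (y + - x)) = (\<lambda>y. \<rho> (x - y))"
      using \<rho>(4) by (metis add.commute minus_diff_eq uminus_add_conv_diff)
    ultimately have *: "((\<lambda>y. \<rho> (x - y)) has_integral 1) (cbox (- b + x) (b + x))" by simp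
    have "\<rho> (x - y) = 0" if "y \<notin> cbox (- b + x) (b + x)" for y
    proof -
      have "y - x \<notin> cbox (- b) b" using that by (auto simp: mem_box inner_diff_left inner_add_left algebra_simps)
      then have "\<rho> (y - x) = 0" by (rule \<rho>(3))
      then show ?thesis using \<rho>(4)[of "y - x"] by (simp only: minus_diff_eq)
    qed
    then show ?thesis by (intro has_integral_on_superset[OF *]) auto
  qed
  \<comment> \<open>The convolution is a weighted mean, with total weight 1, of values of f at
    distance at most e from x.\<close>
  have avg: "\<bar>integral (cbox (- a) a) (\<lambda>y. \<rho> (x - y) * f y) - f x\<bar> \<le> \<epsilon>"
    if f: "continuous_on UNIV f" "\<And>x. x \<notin> C \<Longrightarrow> f x = 0" "\<And>x y. norm (y - x) \<le> e \<Longrightarrow> \<bar>f y - f x\<bar> \<le> \<epsilon>" for f :: "real ^ 'd \<Rightarrow> real" and x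
  proof -
    let ?I = "integral (cbox (- a) a) (\<lambda>y. \<rho> (x - y) * f y)"
    have "((\<lambda>y. \<rho> (x - y) * f y) has_integral ?I) UNIV"
      using f(2) Ca by (intro has_integral_UNIV_supported continuous_intros f continuous_on_compose2[OF c\<rho>]) auto
    from has_integral_diff[OF this has_integral_mult_left[OF int1[of x], of "f x"]]
    have I: "((\<lambda>y. \<rho> (x - y) * (f y - f x)) has_integral (?I - f x)) UNIV"
      by (simp add: algebra_simps)
    have E: "((\<lambda>y. \<rho> (x - y) * \<epsilon>) has_integral \<epsilon>) UNIV"
      using has_integral_mult_left[OF int1[of x], of \<epsilon>] by simp
    have le: "\<bar>\<rho> (x - y) * (f y - f x)\<bar> \<le> \<rho> (x - y) * \<epsilon>" for y
    proof (cases "norm (y - x) \<le> e")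
      case True
      then show ?thesis using f(3)[OF True] \<rho>(1)[of "x - y"] by (auto simp: abs_mult intro!: mult_left_mono)
    next
      case False
      then show ?thesis using \<rho>(2)[of "x - y"] by (simp add: norm_minus_commute)
    qed
    have "?I - f x \<le> \<epsilon>"
      by (rule has_integral_le[OF I E]) (use le abs_le_D1 in blast)
    moreover have "- (?I - f x) \<le> \<epsilon>"
      by (rule has_integral_le[OF has_integral_neg[OF I] E]) (use le abs_le_D2 in blast)
    ultimately show ?thesis by simp
  qed
  have out0: "\<psi> y = 0" "G y = 0" if "y \<notin> cbox (- a) a" for y
    using that Ca C(3) G0 by blast+
  define \<phi> where "\<phi> x = integral (cbox (- a) a) (\<lambda>y. \<rho> (x - y) * \<psi> y)" for x
  define H where "H x = (\<chi> k. integral (cbox (- a) a) (\<lambda>y. G\<rho> (x - y) $ k * \<psi> y))" for x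
  have \<phi>': "(\<phi> has_derivative (\<lambda>h. H x \<bullet> h)) (at x)" for x
    unfolding \<phi>_def[abs_def] H_def by (rule convolution_has_derivative[OF G\<rho>(1) cG\<rho> c\<psi>])
  have Ck\<phi>: "Ck k \<phi>" for k
    unfolding \<phi>_def[abs_def] by (rule Ck_convolution[OF Ck\<rho> c\<psi>])
  have cH: "continuous_on UNIV H"
    unfolding H_def continuous_on_vec_componentwise
    using Ck_convolution[OF G\<rho>(2) c\<psi>, THEN Ck_imp_continuous] by (intro continuous_on_vec_lambda) auto
  have H: "H x $ k = integral (cbox (- a) a) (\<lambda>y. \<rho> (x - y) * G y $ k)" for x k
  proof -
    \<comment> \<open>Integration by parts: \<open>?G\<close> is the gradient in y of
      \<open>?F\<close>, and the integral of each of its components vanishes. This moves the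
      derivative from the kernel to \<open>\<psi>\<close>.\<close>
    let ?F = "\<lambda>y. \<rho> (x - y) * \<psi> y" and ?G = "\<lambda>y. \<rho> (x - y) *\<^sub>R G y - \<psi> y *\<^sub>R G\<rho> (x - y)"
    have "integral UNIV (\<lambda>y. ?G y $ k) = 0"
    proof (rule integral_partial_derivative_eq_0[of ?F])
      fix y
      have "((\<lambda>y. \<rho> (x - y)) has_derivative (\<lambda>h. G\<rho> (x - y) \<bullet> (- h))) (at y)"
        by (rule has_derivative_compose[OF _ G\<rho>(1)]) (auto intro!: derivative_eq_intros)
      from has_derivative_mult[OF this \<psi>] show "(?F has_derivative (\<lambda>h. ?G y \<bullet> h)) (at y)"
        by (simp add: inner_diff_left algebra_simps)
    next
      show "continuous_on UNIV ?G"
        by (intro continuous_intros G c\<psi> continuous_on_compose2[OF cG\<rho>] continuous_on_compose2[OF c\<rho>]) auto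
    next
      show "compact C" by (rule C(1))
      show "\<rho> (x - y) * \<psi> y = 0" if "y \<notin> C" for y using C(3)[OF that] by simp
    qed
    moreover have "integral UNIV (\<lambda>y. ?G y $ k) = integral (cbox (- a) a) (\<lambda>y. ?G y $ k)"
      using out0
      by (intro integral_supported)
        (auto intro!: continuous_intros G c\<psi> continuous_on_compose2[OF cG\<rho>] continuous_on_compose2[OF c\<rho>])
    moreover have "integral (cbox (- a) a) (\<lambda>y. ?G y $ k) =
        integral (cbox (- a) a) (\<lambda>y. \<rho> (x - y) * G y $ k) - integral (cbox (- a) a) (\<lambda>y. G\<rho> (x - y) $ k * \<psi> y)"
      by (subst integral_diff[symmetric])
        (auto intro!: integrable_continuous continuous_intros continuous_on_subset[OF G] continuous_on_subset[OF c\<psi>]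
          continuous_on_compose2[OF cG\<rho>] continuous_on_compose2[OF c\<rho>] simp: mult.commute)
    ultimately show ?thesis by (simp add: H_def)
  qed
  show thesis
  proof
    show "(\<phi> has_derivative (\<lambda>h. H x \<bullet> h)) (at x)" for x by (rule \<phi>')
    show "continuous_on UNIV H" by (rule cH)
    show "\<bar>\<phi> x - \<psi> x\<bar> \<le> \<epsilon>" for x
      unfolding \<phi>_def
    proof (rule avg)
      show "\<bar>\<psi> y - \<psi> x\<bar> \<le> \<epsilon>" if "norm (y - x) \<le> e" for x y
        using d1(2) e(3) that order_trans by blast
    qed (use c\<psi> C(3) in auto)
    show "\<bar>H x $ k - G x $ k\<bar> \<le> \<epsilon>" for x k
      unfolding H
    proof (rule avg)
      show "\<bar>G y $ k - G x $ k\<bar> \<le> \<epsilon>" if "norm (y - x) \<le> e" for x y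
        using d2(2) e(4) that order_trans by blast
    qed (use G G0 in \<open>auto intro!: continuous_intros\<close>)
    define D where "D = {x + y |x y. x \<in> C \<and> y \<in> cball 0 e}"
    have D: "compact D" unfolding D_def by (intro compact_sums C) auto
    have "\<phi> x = 0" if "x \<notin> D" for x
    proof -
      have "\<rho> (x - y) * \<psi> y = 0" for y
      proof (cases "y \<in> C \<and> norm (x - y) \<le> e")
        case True
        then have "x \<in> D" unfolding D_def by (intro CollectI exI[of _ y] exI[of _ "x - y"]) auto
        with that show ?thesis by simp
      qed (use C(3) \<rho>(2) in auto)
      then have "(\<lambda>y. \<rho> (x - y) * \<psi> y) = (\<lambda>y. 0)" by blast
      then show ?thesis by (simp add: \<phi>_def)
    qed
    then have sub: "{x. \<phi> x \<noteq> 0} \<subseteq> D" by auto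
    then have "closure {x. \<phi> x \<noteq> 0} \<subseteq> D" using D compact_imp_closed by (intro closure_minimal) auto
    moreover have "D \<subseteq> \<Omega>"
    proof
      fix w assume "w \<in> D"
      then obtain x y where "w = x + y" "x \<in> C" "norm y \<le> e" by (auto simp: D_def)
      then show "w \<in> \<Omega>" using d0(2)[of x w] e(2) by simp
    qed
    ultimately show "\<phi> \<in> test_functions \<Omega>"
      using Ck\<phi> compact_closure bounded_subset[OF compact_imp_bounded[OF D] sub]
      unfolding test_functions_def by blast
  qed
qed

section \<open>The Sobolev space on a bounded open set\<close>

text \<open>Embeds L^2 into L^1 on a set of finite measure.\<close>

lemma le_one_plus_square: "a \<le> 1 + a\<^sup>2" for a :: real
proof -
  have "0 \<le> (a - 1 / 2)\<^sup>2" by simp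
  then show ?thesis by (simp add: power2_diff power_divide)
qed

locale bounded_open_set =
  fixes \<Omega> :: "(real ^ 'd) set"
  assumes open_\<Omega>: "open \<Omega>" and bounded_\<Omega>: "bounded \<Omega>"
begin

abbreviation "M\<^sub>\<Omega> \<equiv> lebesgue_on \<Omega>"

lemma \<Omega>_lebesgue [measurable, simp]: "\<Omega> \<in> sets lebesgue"
  using lmeasurable_open[OF bounded_\<Omega> open_\<Omega>] by auto

lemma finite_measure_\<Omega>: "finite_measure M\<^sub>\<Omega>"
  by (rule finite_measure_lebesgue_on[OF lmeasurable_open[OF bounded_\<Omega> open_\<Omega>]])

lemma compact_closure_\<Omega>: "compact (closure \<Omega>)"
  using bounded_\<Omega> by simp

lemma measurable_continuous_closure:
  fixes f :: "real ^ 'd \<Rightarrow> 'b :: euclidean_space"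
  assumes "continuous_on (closure \<Omega>) f"
  shows "f \<in> borel_measurable M\<^sub>\<Omega>"
  using continuous_on_subset[OF assms closure_subset]
  by (rule continuous_imp_measurable_on_sets_lebesgue) simp

lemma bounded_continuous_closure:
  fixes f :: "real ^ 'd \<Rightarrow> 'b :: euclidean_space"
  assumes "continuous_on (closure \<Omega>) f"
  obtains B where "\<And>x. x \<in> closure \<Omega> \<Longrightarrow> norm (f x) \<le> B"
proof -
  obtain B where "\<forall>y\<in>f ` closure \<Omega>. norm y \<le> B"
    using compact_imp_bounded[OF compact_continuous_image[OF assms compact_closure_\<Omega>]]
    unfolding bounded_iff by blast
  then show thesis using that by blast
qed

lemma integrable_mult_continuous:
  fixes f g :: "real ^ 'd \<Rightarrow> real"
  assumes "continuous_on (closure \<Omega>) f" "integrable M\<^sub>\<Omega> g"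
  shows "integrable M\<^sub>\<Omega> (\<lambda>x. f x * g x)"
proof -
  obtain B where B: "\<And>x. x \<in> closure \<Omega> \<Longrightarrow> norm (f x) \<le> B"
    using bounded_continuous_closure[OF assms(1)] by blast
  show ?thesis
  proof (rule Bochner_Integration.integrable_bound)
    show "integrable M\<^sub>\<Omega> (\<lambda>x. B * g x)" using assms(2) by simp
    show "(\<lambda>x. f x * g x) \<in> borel_measurable M\<^sub>\<Omega>"
      using measurable_continuous_closure[OF assms(1)] borel_measurable_integrable[OF assms(2)] by simp
    show "AE x in M\<^sub>\<Omega>. norm (f x * g x) \<le> norm (B * g x)"
    proof (rule AE_I2)
      fix x assume "x \<in> space M\<^sub>\<Omega>"
      then have "norm (f x) \<le> B" using B closure_subset by auto
      then show "norm (f x * g x) \<le> norm (B * g x)"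
        by (auto simp: abs_mult intro!: mult_right_mono)
    qed
  qed
qed

lemma integrable_const_\<Omega>: "integrable M\<^sub>\<Omega> (\<lambda>x. c :: real)"
  using finite_measure.integrable_const[OF finite_measure_\<Omega>] .

lemma integrable_continuous_closure:
  fixes f :: "real ^ 'd \<Rightarrow> real"
  assumes "continuous_on (closure \<Omega>) f"
  shows "integrable M\<^sub>\<Omega> f"
  using integrable_mult_continuous[OF assms integrable_const_\<Omega>[of 1]] by simp

lemma square_integrable_continuous_closure:
  fixes f :: "real ^ 'd \<Rightarrow> 'b :: euclidean_space"
  assumes "continuous_on (closure \<Omega>) f"
  shows "square_integrable \<Omega> f"
  unfolding square_integrable_def
  using measurable_continuous_closure[OF assms]
  by (auto intro!: integrable_continuous_closure continuous_intros assms)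

lemma square_integrable_component:
  fixes g :: "real ^ 'd \<Rightarrow> real ^ 'd"
  assumes "square_integrable \<Omega> g"
  shows "integrable M\<^sub>\<Omega> (\<lambda>x. g x $ k)"
proof (rule Bochner_Integration.integrable_bound)
  show "integrable M\<^sub>\<Omega> (\<lambda>x. 1 + (norm (g x))\<^sup>2)"
    using assms integrable_const_\<Omega>[of 1] by (auto simp: square_integrable_def)
  have "g \<in> borel_measurable M\<^sub>\<Omega>" using assms by (simp add: square_integrable_def)
  then show "(\<lambda>x. g x $ k) \<in> borel_measurable M\<^sub>\<Omega>"
    by (simp add: cart_eq_inner_axis)
  have "norm (g x $ k) \<le> norm (1 + (norm (g x))\<^sup>2)" for x
    using component_le_norm_cart[of "g x" k] le_one_plus_square[of "norm (g x)"] by simp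
  then show "AE x in M\<^sub>\<Omega>. norm (g x $ k) \<le> norm (1 + (norm (g x))\<^sup>2)" by simp
qed

lemma square_integrable_imp_integrable:
  fixes g :: "real ^ 'd \<Rightarrow> real"
  assumes "square_integrable \<Omega> g"
  shows "integrable M\<^sub>\<Omega> g"
proof (rule Bochner_Integration.integrable_bound)
  show "integrable M\<^sub>\<Omega> (\<lambda>x. 1 + (norm (g x))\<^sup>2)"
    using assms integrable_const_\<Omega>[of 1] by (auto simp: square_integrable_def)
  show "g \<in> borel_measurable M\<^sub>\<Omega>" using assms by (simp add: square_integrable_def)
  have "norm (g x) \<le> norm (1 + (norm (g x))\<^sup>2)" for x
    unfolding real_norm_def by (rule order_trans[OF le_one_plus_square abs_ge_self])
  then show "AE x in M\<^sub>\<Omega>. norm (g x) \<le> norm (1 + (norm (g x))\<^sup>2)" by (rule AE_I2)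
qed

lemma LINT_supported:
  fixes f :: "real ^ 'd \<Rightarrow> real"
  assumes "continuous_on UNIV f" "\<And>x. x \<notin> \<Omega> \<Longrightarrow> f x = 0"
  shows "(LINT x|M\<^sub>\<Omega>. f x) = integral UNIV f"
proof -
  have "(LINT x|M\<^sub>\<Omega>. f x) = integral \<Omega> f"
    by (intro lebesgue_integral_eq_integral integrable_continuous_closure continuous_on_subset[OF assms(1)]) auto
  also have "\<dots> = integral UNIV (\<lambda>x. if x \<in> \<Omega> then f x else 0)"
    by (rule integral_restrict_UNIV[symmetric])
  also have "(\<lambda>x. if x \<in> \<Omega> then f x else 0) = f" using assms(2) by auto
  finally show ?thesis .
qed

lemma test_functionsD:
  assumes "\<phi> \<in> test_functions \<Omega>"
  obtains C H where "compact C" "C \<subseteq> \<Omega>" "\<And>x. x \<notin> C \<Longrightarrow> \<phi> x = 0"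
    "\<And>x. (\<phi> has_derivative (\<lambda>h. H x \<bullet> h)) (at x)" "continuous_on UNIV H"
    "\<And>x k. frechet_derivative \<phi> (at x) (axis k 1) = H x $ k"
proof -
  have Ck: "Ck k \<phi>" for k using assms by (auto simp: test_functions_def)
  obtain H where H: "\<And>x. (\<phi> has_derivative (\<lambda>h. H x \<bullet> h)) (at x)" "\<And>k i. Ck k (\<lambda>x. H x $ i)"
    using Ck_gradient[OF Ck] by blast
  show thesis
  proof (rule that[of "closure {x. \<phi> x \<noteq> 0}" H])
    show "compact (closure {x. \<phi> x \<noteq> 0})" "closure {x. \<phi> x \<noteq> 0} \<subseteq> \<Omega>"
      using assms by (auto simp: test_functions_def)
    show "\<phi> x = 0" if "x \<notin> closure {x. \<phi> x \<noteq> 0}" for x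
      using that closure_subset[of "{x. \<phi> x \<noteq> 0}"] by auto
    show "continuous_on UNIV H"
      using H(2)[THEN Ck_imp_continuous] by (rule continuous_on_vec_componentwise)
    show "frechet_derivative \<phi> (at x) (axis k 1) = H x $ k" for x k
      by (simp add: frechet_derivative_at[OF H(1), symmetric] inner_axis)
  qed (rule H(1))
qed

text \<open>\<open>H1\<close> tests with smooth functions only, whereas cutoffs built from a C^1
  boundary graph are merely C^1. Mollification converges uniformly together with the gradient, and
  \<open>v\<close> and the components of \<open>g\<close> are integrable, so the identity survives
  the limit.\<close>

lemma H1_C1_test:
  assumes H1: "H1 \<Omega> v g"
    and \<psi>: "\<And>x. (\<psi> has_derivative (\<lambda>h. G x \<bullet> h)) (at x)" and G: "continuous_on UNIV G"
    and C: "compact C" "C \<subseteq> \<Omega>" "\<And>x. x \<notin> C \<Longrightarrow> \<psi> x = 0"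
  shows "(LINT x|M\<^sub>\<Omega>. v x * G x $ k) = - (LINT x|M\<^sub>\<Omega>. g x $ k * \<psi> x)"
proof -
  have c\<psi>: "continuous_on UNIV \<psi>"
    using \<psi> by (auto intro!: has_derivative_continuous simp: continuous_on_eq_continuous_at)
  have iv: "integrable M\<^sub>\<Omega> v" and ig: "integrable M\<^sub>\<Omega> (\<lambda>x. g x $ k)"
    using H1 square_integrable_imp_integrable square_integrable_component by (auto simp: H1_def)
  have cont: "integrable M\<^sub>\<Omega> (\<lambda>x. w x * f x)" if "integrable M\<^sub>\<Omega> w" "continuous_on UNIV f" for w f :: "real ^ 'd \<Rightarrow> real"
    using integrable_mult_continuous[OF continuous_on_subset[OF that(2)] that(1)] by (simp add: mult.commute)
  let ?L = "(LINT x|M\<^sub>\<Omega>. v x * G x $ k)" and ?R = "(LINT x|M\<^sub>\<Omega>. g x $ k * \<psi> x)"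
  let ?B = "(LINT x|M\<^sub>\<Omega>. \<bar>v x\<bar>) + (LINT x|M\<^sub>\<Omega>. \<bar>g x $ k\<bar>)"
  have key: "\<bar>?L + ?R\<bar> \<le> \<epsilon> * ?B" if \<epsilon>: "\<epsilon> > 0" for \<epsilon>
  proof -
    obtain \<phi> H where \<phi>: "\<phi> \<in> test_functions \<Omega>" "\<And>x. (\<phi> has_derivative (\<lambda>h. H x \<bullet> h)) (at x)"
      "continuous_on UNIV H" "\<And>x. \<bar>\<phi> x - \<psi> x\<bar> \<le> \<epsilon>" "\<And>x k. \<bar>H x $ k - G x $ k\<bar> \<le> \<epsilon>"
      using mollification[OF \<psi> G C open_\<Omega> \<epsilon>] by blast
    have c\<phi>: "continuous_on UNIV \<phi>"
      using \<phi>(2) by (auto intro!: has_derivative_continuous simp: continuous_on_eq_continuous_at)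
    have fd: "frechet_derivative \<phi> (at x) (axis k 1) = H x $ k" for x
      by (simp add: frechet_derivative_at[OF \<phi>(2), symmetric] inner_axis)
    have cH: "continuous_on UNIV (\<lambda>x. H x $ k)" and cG: "continuous_on UNIV (\<lambda>x. G x $ k)"
      using \<phi>(3) G by (auto intro!: continuous_intros)
    have eq: "(LINT x|M\<^sub>\<Omega>. v x * H x $ k) + (LINT x|M\<^sub>\<Omega>. g x $ k * \<phi> x) = 0"
    proof -
      have "(LINT x|M\<^sub>\<Omega>. v x * frechet_derivative \<phi> (at x) (axis k 1)) = - (LINT x|M\<^sub>\<Omega>. g x $ k * \<phi> x)"
        using H1 \<phi>(1) unfolding H1_def by blast
      then show ?thesis unfolding fd by linarith
    qed
    have "?L + ?R = ?L - (LINT x|M\<^sub>\<Omega>. v x * H x $ k) + (?R - (LINT x|M\<^sub>\<Omega>. g x $ k * \<phi> x))"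
      using eq by simp
    also have "\<dots> = (LINT x|M\<^sub>\<Omega>. v x * (G x $ k - H x $ k)) + (LINT x|M\<^sub>\<Omega>. g x $ k * (\<psi> x - \<phi> x))"
      using cont[OF iv cG] cont[OF iv cH] cont[OF ig c\<psi>] cont[OF ig c\<phi>]
      by (simp add: right_diff_distrib)
    also have "\<bar>\<dots>\<bar> \<le> (LINT x|M\<^sub>\<Omega>. \<bar>v x * (G x $ k - H x $ k)\<bar>) + (LINT x|M\<^sub>\<Omega>. \<bar>g x $ k * (\<psi> x - \<phi> x)\<bar>)"
      by (intro order_trans[OF abs_triangle_ineq] add_mono integral_abs_bound)
    also have "\<dots> \<le> (LINT x|M\<^sub>\<Omega>. \<epsilon> * \<bar>v x\<bar>) + (LINT x|M\<^sub>\<Omega>. \<epsilon> * \<bar>g x $ k\<bar>)"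
    proof (intro add_mono integral_mono)
      show "integrable M\<^sub>\<Omega> (\<lambda>x. \<bar>v x * (G x $ k - H x $ k)\<bar>)" "integrable M\<^sub>\<Omega> (\<lambda>x. \<bar>g x $ k * (\<psi> x - \<phi> x)\<bar>)"
        by (intro integrable_abs cont iv ig continuous_intros cG cH c\<psi> c\<phi>)+
      show "integrable M\<^sub>\<Omega> (\<lambda>x. \<epsilon> * \<bar>v x\<bar>)" "integrable M\<^sub>\<Omega> (\<lambda>x. \<epsilon> * \<bar>g x $ k\<bar>)"
        using iv ig by auto
      show "\<bar>v x * (G x $ k - H x $ k)\<bar> \<le> \<epsilon> * \<bar>v x\<bar>" for x
        using mult_right_mono[OF \<phi>(5)[of x k] abs_ge_zero[of "v x"]] by (simp add: abs_mult abs_minus_commute mult.commute)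
      show "\<bar>g x $ k * (\<psi> x - \<phi> x)\<bar> \<le> \<epsilon> * \<bar>g x $ k\<bar>" for x
        using mult_right_mono[OF \<phi>(4)[of x] abs_ge_zero[of "g x $ k"]] by (simp add: abs_mult abs_minus_commute mult.commute)
    qed
    finally show ?thesis by (simp add: distrib_left)
  qed
  define B where "B = ?B"
  have "0 \<le> B" by (simp add: B_def)
  have "\<bar>?L + ?R\<bar> \<le> 0 + e" if "e > 0" for e
  proof -
    have "\<bar>?L + ?R\<bar> \<le> e / (B + 1) * B"
      using key[of "e / (B + 1)"] that \<open>0 \<le> B\<close> unfolding B_def[symmetric] by simp
    also have "\<dots> \<le> e" using that \<open>0 \<le> B\<close> by (simp add: divide_le_eq)
    finally show ?thesis by simp
  qed
  then have "\<bar>?L + ?R\<bar> \<le> 0" by (rule field_le_epsilon)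
  then show ?thesis by simp
qed

text \<open>The product with a test function is C^1 with compact support in \<open>\<Omega>\<close>,
  so each of its partial derivatives integrates to 0; the product rule then gives the weak
  gradient.\<close>

lemma H1_continuously_differentiable:
  assumes u: "\<And>x. (u has_derivative (\<lambda>h. G x \<bullet> h)) (at x)" and G: "continuous_on UNIV G"
  shows "H1 \<Omega> u G"
  unfolding H1_def
proof (intro conjI ballI allI)
  have cu: "continuous_on UNIV u"
    using u by (auto intro!: has_derivative_continuous simp: continuous_on_eq_continuous_at)
  show "square_integrable \<Omega> u" "square_integrable \<Omega> G"
    using cu G by (auto intro: square_integrable_continuous_closure continuous_on_subset)
  fix \<phi> k assume "\<phi> \<in> test_functions \<Omega>"
  then obtain C H where C: "compact C" "C \<subseteq> \<Omega>" "\<And>x. x \<notin> C \<Longrightarrow> \<phi> x = 0" and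
    \<phi>: "\<And>x. (\<phi> has_derivative (\<lambda>h. H x \<bullet> h)) (at x)" "continuous_on UNIV H"
    "\<And>x k. frechet_derivative \<phi> (at x) (axis k 1) = H x $ k"
    by (rule test_functionsD) blast
  have c\<phi>: "continuous_on UNIV \<phi>"
    using \<phi>(1) by (auto intro!: has_derivative_continuous simp: continuous_on_eq_continuous_at)
  have H0: "H x = 0" if "x \<notin> C" for x
    by (rule gradient_eq_0_outside[OF compact_imp_closed[OF C(1)] C(3) \<phi>(1) that])
  let ?F = "\<lambda>x. u x * \<phi> x" and ?G = "\<lambda>x. u x *\<^sub>R H x + \<phi> x *\<^sub>R G x"
  have cG: "continuous_on UNIV (\<lambda>x. ?G x $ k)"
    by (intro continuous_intros cu c\<phi> \<phi>(2) G)
  have "integral UNIV (\<lambda>x. ?G x $ k) = 0"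
  proof (rule integral_partial_derivative_eq_0[of ?F])
    show "(?F has_derivative (\<lambda>h. ?G x \<bullet> h)) (at x)" for x
      using has_derivative_mult[OF u \<phi>(1), of x] by (simp add: inner_add_left mult.commute)
    show "continuous_on UNIV ?G" by (intro continuous_intros cu c\<phi> \<phi>(2) G)
    show "compact C" by fact
    show "u x * \<phi> x = 0" if "x \<notin> C" for x using C(3)[OF that] by simp
  qed
  moreover have "?G x $ k = 0" if "x \<notin> \<Omega>" for x
  proof -
    have "x \<notin> C" using that C(2) by blast
    then show ?thesis using C(3) H0 by simp
  qed
  ultimately have "(LINT x|M\<^sub>\<Omega>. ?G x $ k) = 0"
    using LINT_supported[OF cG] by simp
  moreover have "integrable M\<^sub>\<Omega> (\<lambda>x. u x * H x $ k)" "integrable M\<^sub>\<Omega> (\<lambda>x. G x $ k * \<phi> x)"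
    by (rule integrable_continuous_closure, rule continuous_on_subset[of UNIV],
        intro continuous_intros cu c\<phi> \<phi>(2) G, simp)+
  ultimately show "(LINT x|M\<^sub>\<Omega>. u x * frechet_derivative \<phi> (at x) (axis k 1)) = - (LINT x|M\<^sub>\<Omega>. G x $ k * \<phi> x)"
    by (simp add: \<phi>(3) mult.commute)
qed

lemma neumann_laplacian_const: "neumann_laplacian \<Omega> (\<lambda>x. 1) (\<lambda>x. 0)"
  unfolding neumann_laplacian_def
proof (intro conjI exI allI impI)
  show "square_integrable \<Omega> (\<lambda>x. 0 :: real)"
    by (intro square_integrable_continuous_closure continuous_intros)
  show "H1 \<Omega> (\<lambda>x. 1) (\<lambda>x. 0)"
    by (rule H1_continuously_differentiable) (auto intro!: derivative_eq_intros)
qed simp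

end

section \<open>Contraction semigroups\<close>

text \<open>The factor exp (- M s) makes a plus M times the integral nonincreasing. The constant
  \<open>a\<close> may be negative: applied to the negative of a function, the lemma yields
  exponential growth.\<close>

lemma gronwall:
  fixes \<phi> :: "real \<Rightarrow> real"
  assumes cont: "continuous_on {0..T} \<phi>" and M: "0 \<le> M"
    and le: "\<And>t. t \<in> {0..T} \<Longrightarrow> \<phi> t \<le> a + M * integral {0..t} \<phi>"
    and t: "t \<in> {0..T}"
  shows "\<phi> t \<le> a * exp (M * t)"
proof -
  define I where "I s = integral {0..s} \<phi>" for s
  define E where "E s = exp (- (M * s)) * (a + M * I s)" for s
  define E' where "E' s = exp (- (M * s)) * (M * (\<phi> s - (a + M * I s)))" for s
  have I': "(I has_real_derivative \<phi> s) (at s within {0..T})" if "s \<in> {0..T}" for s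
    using integral_has_real_derivative[OF cont that] by (simp add: I_def[abs_def])
  have E'_: "(E has_real_derivative E' s) (at s within {0..T})" if "s \<in> {0..T}" for s
    unfolding E_def[abs_def] E'_def
    by (rule derivative_eq_intros I'[OF that] refl)+ (simp add: algebra_simps)
  have "\<exists>s\<in>{0..t}. E t - E 0 = (\<lambda>h. h * E' s) (t - 0)"
  proof (rule mvt_very_simple)
    show "(E has_derivative (\<lambda>h. h * E' s)) (at s within {0..t})" if "0 \<le> s" "s \<le> t" for s
    proof -
      have "s \<in> {0..T}" "{0..t} \<subseteq> {0..T}" using that t by auto
      from has_derivative_subset[OF E'_[OF this(1), unfolded has_field_derivative_def] this(2)]
      show ?thesis by (simp add: mult.commute[of _ "E' s"])
    qed
  qed (use t in simp)
  then obtain s where s: "s \<in> {0..t}" "E t - E 0 = t * E' s" by auto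
  have "E' s \<le> 0"
    unfolding E'_def I_def using le[of s] s(1) t M by (intro mult_nonneg_nonpos) auto
  then have "E t \<le> E 0"
    using s(2) t mult_nonneg_nonpos[of t "E' s"] by auto
  also have "E 0 = a" by (simp add: E_def I_def)
  finally have "a + M * I t \<le> a * exp (M * t)"
    by (simp add: E_def exp_minus field_simps)
  then show ?thesis using le[OF t] by (simp add: I_def)
qed

section \<open>Curves in the space of continuous functions and their Riemann sums\<close>

lemma riemann_sum_bound:
  fixes f :: "real \<Rightarrow> real"
  assumes "0 \<le> h" "continuous_on {0..real N * h} f"
    and "\<And>k s. k < N \<Longrightarrow> s \<in> {real k * h..real (Suc k) * h} \<Longrightarrow> \<bar>f s - f (real k * h)\<bar> \<le> \<epsilon>"
  shows "\<bar>integral {0..real N * h} f - (\<Sum>k<N. h * f (real k * h))\<bar> \<le> real N * (h * \<epsilon>)"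
  using assms(2,3)
proof (induction N)
  case (Suc N)
  let ?a = "real N * h" and ?b = "real (Suc N) * h"
  have ab: "0 \<le> ?a" "?a \<le> ?b" using \<open>0 \<le> h\<close> by (auto intro: mult_right_mono)
  have c1: "continuous_on {0..?a} f" and c2: "continuous_on {?a..?b} f"
    using ab by (auto intro: continuous_on_subset[OF Suc.prems(1)])
  have split: "integral {0..?b} f = integral {0..?a} f + integral {?a..?b} f"
    using Henstock_Kurzweil_Integration.integral_combine[OF ab integrable_continuous_real[OF Suc.prems(1)]] by simp
  have "\<bar>integral {?a..?b} f - h * f ?a\<bar> = \<bar>integral {?a..?b} (\<lambda>s. f s - f ?a)\<bar>"
  proof -
    have "integral {?a..?b} (\<lambda>s. f s - f ?a) = integral {?a..?b} f - integral {?a..?b} (\<lambda>s. f ?a)"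
      by (intro Henstock_Kurzweil_Integration.integral_diff integrable_continuous_real c2 continuous_intros)
    also have "integral {?a..?b} (\<lambda>s. f ?a) = h * f ?a"
      using ab by (simp add: algebra_simps)
    finally show ?thesis by simp
  qed
  also have "\<dots> \<le> \<epsilon> * (?b - ?a)"
    using integral_bound[of ?a ?b "\<lambda>s. f s - f ?a" \<epsilon>] Suc.prems(2)[of N] ab c2
    by (simp add: continuous_on_diff)
  finally have 1: "\<bar>integral {?a..?b} f - h * f ?a\<bar> \<le> h * \<epsilon>" by (simp add: algebra_simps)
  have 2: "\<bar>integral {0..?a} f - (\<Sum>k<N. h * f (real k * h))\<bar> \<le> real N * (h * \<epsilon>)"
    by (rule Suc.IH[OF c1]) (use Suc.prems(2) in auto)
  have "real (Suc N) * (h * \<epsilon>) = real N * (h * \<epsilon>) + h * \<epsilon>" by (simp add: algebra_simps)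
  moreover have "(\<Sum>k<Suc N. h * f (real k * h)) = (\<Sum>k<N. h * f (real k * h)) + h * f ?a" by simp
  ultimately show ?case using 1 2 unfolding split by linarith
qed simp

text \<open>Translates continuity of a curve in sup norm into continuity of a function of time and
  space; \<open>joint_continuousD\<close> goes back by compactness of K. All time integrals of
  functions are treated through this joint continuity.\<close>

lemma joint_continuousI:
  fixes \<Phi> :: "real \<Rightarrow> 'a :: metric_space \<Rightarrow> real"
  assumes c: "\<And>s. s \<in> I \<Longrightarrow> continuous_on K (\<Phi> s)"
    and u: "\<And>s \<epsilon>. s \<in> I \<Longrightarrow> 0 < \<epsilon> \<Longrightarrow> \<exists>\<delta>>0. \<forall>r\<in>I. \<bar>r - s\<bar> < \<delta> \<longrightarrow> (\<forall>x\<in>K. \<bar>\<Phi> r x - \<Phi> s x\<bar> \<le> \<epsilon>)"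
  shows "continuous_on (I \<times> K) (\<lambda>(s, x). \<Phi> s x)"
  unfolding continuous_on_iff
proof (intro ballI allI impI)
  fix p \<epsilon> assume "p \<in> I \<times> K" and \<epsilon>: "0 < (\<epsilon> :: real)"
  then obtain s x where p: "p = (s, x)" "s \<in> I" "x \<in> K" by auto
  obtain d1 where d1: "d1 > 0" "\<And>r y. r \<in> I \<Longrightarrow> \<bar>r - s\<bar> < d1 \<Longrightarrow> y \<in> K \<Longrightarrow> \<bar>\<Phi> r y - \<Phi> s y\<bar> \<le> \<epsilon> / 2"
    using u[OF p(2), of "\<epsilon> / 2"] \<epsilon> by auto
  obtain d2 where d2: "d2 > 0" "\<And>y. y \<in> K \<Longrightarrow> dist y x < d2 \<Longrightarrow> dist (\<Phi> s y) (\<Phi> s x) < \<epsilon> / 2"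
    using c[OF p(2)] p(3) \<epsilon> unfolding continuous_on_iff by (meson half_gt_zero)
  show "\<exists>d>0. \<forall>q\<in>I \<times> K. dist q p < d \<longrightarrow> dist (case q of (s, x) \<Rightarrow> \<Phi> s x) (case p of (s, x) \<Rightarrow> \<Phi> s x) < \<epsilon>"
  proof (intro exI[of _ "min d1 d2"] conjI ballI impI)
    fix q assume "q \<in> I \<times> K" and q: "dist q p < min d1 d2"
    then obtain r y where ry: "q = (r, y)" "r \<in> I" "y \<in> K" by auto
    have "\<bar>r - s\<bar> < d1" "dist y x < d2"
      using q dist_fst_le[of q p] dist_snd_le[of q p] by (auto simp: ry p dist_real_def)
    from d1(2)[OF ry(2) this(1) ry(3)] d2(2)[OF ry(3) this(2)]
    show "dist (case q of (s, x) \<Rightarrow> \<Phi> s x) (case p of (s, x) \<Rightarrow> \<Phi> s x) < \<epsilon>"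
      unfolding ry p dist_real_def prod.case by arith
  qed (use d1 d2 in auto)
qed

lemma joint_continuousD:
  fixes \<Phi> :: "real \<Rightarrow> 'a :: metric_space \<Rightarrow> real"
  assumes "continuous_on (I \<times> K) (\<lambda>(s, x). \<Phi> s x)" "compact K" "s \<in> I" "0 < \<epsilon>"
  shows "\<exists>\<delta>>0. \<forall>r\<in>I. \<bar>r - s\<bar> < \<delta> \<longrightarrow> (\<forall>x\<in>K. \<bar>\<Phi> r x - \<Phi> s x\<bar> \<le> \<epsilon>)"
proof -
  obtain X where X: "s \<in> X" "open X" "\<forall>r\<in>X \<inter> I. \<forall>x\<in>K. dist (\<Phi> r x) (\<Phi> s x) \<le> \<epsilon>"
    using continuous_on_prod_compactE[OF assms] by auto
  obtain d where "d > 0" "ball s d \<subseteq> X" using X(1,2) open_contains_ball by blast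
  then have "r \<in> X" if "\<bar>r - s\<bar> < d" for r using that by (auto simp: dist_real_def subset_iff)
  then show ?thesis using X(3) \<open>d > 0\<close> by (intro exI[of _ d]) (auto simp: dist_real_def)
qed

lemma joint_continuous_slice:
  assumes "continuous_on (I \<times> K) (\<lambda>(s, x). \<Phi> s x)" "s \<in> I"
  shows "continuous_on K (\<Phi> s)"
proof -
  have "continuous_on K (\<lambda>x. (s, x))" by (intro continuous_intros)
  from continuous_on_compose2[OF assms(1) this] assms(2) show ?thesis by auto
qed

lemma joint_continuous_time:
  assumes "continuous_on (I \<times> K) (\<lambda>(s, x). \<Phi> s x)" "x \<in> K"
  shows "continuous_on I (\<lambda>s. \<Phi> s x)"
proof -
  have "continuous_on I (\<lambda>s. (s, x))" by (intro continuous_intros)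
  from continuous_on_compose2[OF assms(1) this] assms(2) show ?thesis by auto
qed

text \<open>Convergence uniform in x is convergence in sup norm, so a linear contraction can be
  carried through the limit; this takes the place of vector-valued integration.\<close>

lemma joint_riemann_sum:
  fixes \<Phi> :: "real \<Rightarrow> 'a :: metric_space \<Rightarrow> real"
  assumes c: "continuous_on ({0..t} \<times> K) (\<lambda>(s, x). \<Phi> s x)" and K: "compact K" and t: "0 \<le> t" and \<epsilon>: "0 < \<epsilon>"
  shows "\<forall>\<^sub>F N in sequentially. \<forall>x\<in>K.
    \<bar>integral {0..t} (\<lambda>s. \<Phi> s x) - (\<Sum>k<N. (t / real N) * \<Phi> (real k * (t / real N)) x)\<bar> \<le> \<epsilon>"
proof -
  have "uniformly_continuous_on ({0..t} \<times> K) (\<lambda>(s, x). \<Phi> s x)"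
    by (intro compact_uniformly_continuous c compact_Times K) simp
  moreover have "0 < \<epsilon> / (t + 1)" using t \<epsilon> by simp
  ultimately obtain d where d: "d > 0" "\<And>p q. p \<in> {0..t} \<times> K \<Longrightarrow> q \<in> {0..t} \<times> K \<Longrightarrow> dist q p < d \<Longrightarrow>
      dist ((\<lambda>(s, x). \<Phi> s x) q) ((\<lambda>(s, x). \<Phi> s x) p) < \<epsilon> / (t + 1)"
    unfolding uniformly_continuous_on_def by meson
  obtain N0 :: nat where N0: "t / d < N0" using reals_Archimedean2 by blast
  have "\<bar>integral {0..t} (\<lambda>s. \<Phi> s x) - (\<Sum>k<N. (t / real N) * \<Phi> (real k * (t / real N)) x)\<bar> \<le> \<epsilon>" if "N \<ge> max N0 1" "x \<in> K" for N x
  proof -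
    define h where "h = t / N"
    have N: "N > 0" "real N0 \<le> real N" using that by auto
    have "h \<ge> 0" "real N * h = t" using N t by (auto simp: h_def)
    have "t < d * N0" using N0 d(1) by (simp add: divide_less_eq mult.commute)
    also have "\<dots> \<le> d * N" using N d(1) by (intro mult_left_mono) auto
    finally have "t < d * N" .
    then have "h < d" using N by (simp add: h_def divide_less_eq)
    have "\<bar>integral {0..real N * h} (\<lambda>s. \<Phi> s x) - (\<Sum>k<N. h * \<Phi> (k * h) x)\<bar> \<le> real N * (h * (\<epsilon> / (t + 1)))"
    proof (rule riemann_sum_bound)
      show "continuous_on {0..real N * h} (\<lambda>s. \<Phi> s x)"
        unfolding \<open>real N * h = t\<close> by (rule joint_continuous_time[OF c that(2)])
      fix k s assume k: "k < N" and s: "s \<in> {real k * h..real (Suc k) * h}"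
      have "real (Suc k) * h \<le> real N * h" using k \<open>h \<ge> 0\<close> by (intro mult_right_mono) auto
      then have "real k * h \<in> {0..t}" "s \<in> {0..t}" "\<bar>s - real k * h\<bar> < d"
        using s \<open>h < d\<close> \<open>h \<ge> 0\<close> \<open>real N * h = t\<close> by (auto simp: algebra_simps intro: order_trans[of 0 "h * real k"])
      then show "\<bar>\<Phi> s x - \<Phi> (real k * h) x\<bar> \<le> \<epsilon> / (t + 1)"
        using d(2)[of "(real k * h, x)" "(s, x)"] that(2) by (simp add: dist_real_def dist_Pair_Pair)
    qed (use \<open>h \<ge> 0\<close> in simp)
    also have "real N * (h * (\<epsilon> / (t + 1))) = t * (\<epsilon> / (t + 1))"
      using \<open>real N * h = t\<close> by (metis mult.assoc)
    also have "\<dots> \<le> \<epsilon>" using t \<epsilon> by (simp add: field_simps)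
    finally show ?thesis unfolding \<open>real N * h = t\<close> by (simp only: h_def)
  qed
  then show ?thesis unfolding eventually_sequentially by blast
qed

lemma continuous_on_time_integral:
  fixes \<Phi> :: "real \<Rightarrow> 'a :: metric_space \<Rightarrow> real"
  assumes c: "continuous_on ({0..t} \<times> K) (\<lambda>(s, x). \<Phi> s x)"
  shows "continuous_on K (\<lambda>x. integral {0..t} (\<lambda>s. \<Phi> s x))"
proof -
  have "continuous_on (K \<times> {0..t}) (\<lambda>p. (snd p, fst p))" by (intro continuous_intros)
  from continuous_on_compose2[OF c this]
  have "continuous_on (K \<times> cbox 0 t) (\<lambda>(x, s). \<Phi> s x)"
    by (force simp: split_beta)
  from integral_continuous_on_param[OF this] show ?thesis by simp
qed

locale compact_semigroup =
  fixes K :: "'a :: metric_space set" and S :: "real \<Rightarrow> ('a \<Rightarrow> real) \<Rightarrow> 'a \<Rightarrow> real"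
  assumes compact_K: "compact K" and K_nonempty: "K \<noteq> {}" and semigroup: "contraction_semigroup K S"
begin

abbreviation C :: "('a \<Rightarrow> real) \<Rightarrow> bool" where "C \<equiv> continuous_on K"

lemma C_bound:
  assumes "C u"
  obtains B where "0 \<le> B" "\<And>x. x \<in> K \<Longrightarrow> \<bar>u x\<bar> \<le> B"
proof -
  obtain B where "\<forall>y\<in>u ` K. norm y \<le> B"
    using compact_imp_bounded[OF compact_continuous_image[OF assms compact_K]]
    unfolding bounded_iff by blast
  moreover obtain x where "x \<in> K" using K_nonempty by blast
  ultimately show thesis using that[of B] by force
qed

lemma S_cont: "0 \<le> t \<Longrightarrow> C u \<Longrightarrow> C (S t u)"
  using semigroup by (simp add: contraction_semigroup_def)

lemma S_lin: "0 \<le> t \<Longrightarrow> C u \<Longrightarrow> C v \<Longrightarrow> x \<in> K \<Longrightarrow>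
    S t (\<lambda>y. a * u y + b * v y) x = a * S t u x + b * S t v x"
  using semigroup by (simp add: contraction_semigroup_def)

lemma S_zero: "C u \<Longrightarrow> x \<in> K \<Longrightarrow> S 0 u x = u x"
  using semigroup by (simp add: contraction_semigroup_def)

lemma S_semigroup: "0 \<le> s \<Longrightarrow> 0 \<le> t \<Longrightarrow> C u \<Longrightarrow> x \<in> K \<Longrightarrow> S (s + t) u x = S s (S t u) x"
  using semigroup by (simp add: contraction_semigroup_def)

lemma S_bound:
  assumes "0 \<le> t" "C u" "\<And>x. x \<in> K \<Longrightarrow> \<bar>u x\<bar> \<le> B" "x \<in> K"
  shows "\<bar>S t u x\<bar> \<le> B"
proof -
  obtain B' where B': "\<And>x. x \<in> K \<Longrightarrow> \<bar>S t u x\<bar> \<le> B'" using C_bound[OF S_cont[OF assms(1,2)]] by blast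
  have "\<bar>S t u x\<bar> \<le> sup_norm K (S t u)"
    unfolding sup_norm_def by (rule cSUP_upper[OF assms(4)]) (auto intro!: bdd_aboveI2 B')
  also have "\<dots> \<le> sup_norm K u"
    using semigroup assms(1,2) by (simp add: contraction_semigroup_def)
  also have "\<dots> \<le> B"
    unfolding sup_norm_def using K_nonempty assms(3) by (intro cSUP_least) auto
  finally show ?thesis .
qed

lemma S_diff: "0 \<le> t \<Longrightarrow> C u \<Longrightarrow> C v \<Longrightarrow> x \<in> K \<Longrightarrow> S t (\<lambda>y. u y - v y) x = S t u x - S t v x"
  using S_lin[of t u v x 1 "-1"] by simp

lemma S_add: "0 \<le> t \<Longrightarrow> C u \<Longrightarrow> C v \<Longrightarrow> x \<in> K \<Longrightarrow> S t (\<lambda>y. u y + v y) x = S t u x + S t v x"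
  using S_lin[of t u v x 1 1] by simp

lemma S_cmult: "0 \<le> t \<Longrightarrow> C u \<Longrightarrow> x \<in> K \<Longrightarrow> S t (\<lambda>y. a * u y) x = a * S t u x"
  using S_lin[of t u u x a 0] by simp

lemma S_diff_bound:
  assumes "0 \<le> t" "C u" "C v" "\<And>x. x \<in> K \<Longrightarrow> \<bar>u x - v x\<bar> \<le> B" "x \<in> K"
  shows "\<bar>S t u x - S t v x\<bar> \<le> B"
  using S_bound[OF assms(1) continuous_on_diff[OF assms(2,3)] assms(4,5)] S_diff[OF assms(1-3,5)] by simp

lemma S_cong:
  assumes "0 \<le> t" "C u" "\<And>x. x \<in> K \<Longrightarrow> u x = v x" "x \<in> K"
  shows "S t u x = S t v x"
proof -
  have "C v" using assms(2,3) continuous_on_cong[of K K u v] by simp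
  then show ?thesis using S_diff_bound[OF assms(1,2), of v 0 x] assms(3,4) by simp
qed

lemma S_sum:
  fixes N :: nat
  assumes "0 \<le> t" "\<And>k. C (u k)" "x \<in> K"
  shows "S t (\<lambda>y. \<Sum>k<N. a * u k y) x = (\<Sum>k<N. a * S t (u k) x)"
proof (induction N)
  case 0
  show ?case using S_cmult[OF assms(1) _ assms(3), of "\<lambda>y. 0" 0] by simp
next
  case (Suc N)
  have "C (\<lambda>y. \<Sum>k<N. a * u k y)" "C (\<lambda>y. a * u N y)" using assms(2) by (auto intro!: continuous_intros)
  from S_add[OF assms(1) this assms(3)] show ?case
    using Suc S_cmult[OF assms(1,2,3)] by simp
qed

lemma S_strong_continuity:
  assumes "C u" "0 < \<epsilon>"
  shows "\<exists>\<delta>>0. \<forall>h. 0 \<le> h \<and> h < \<delta> \<longrightarrow> (\<forall>x\<in>K. \<bar>S h u x - u x\<bar> \<le> \<epsilon>)"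
proof -
  have "uniform_limit K (\<lambda>h. S h u) u (at_right 0)"
    using semigroup assms(1) by (simp add: contraction_semigroup_def)
  then have "\<forall>\<^sub>F h in at_right 0. \<forall>x\<in>K. dist (S h u x) (u x) < \<epsilon>"
    using assms(2) by (auto simp: uniform_limit_iff)
  then obtain d where d: "d > 0" "\<And>h. 0 < h \<Longrightarrow> h < d \<Longrightarrow> \<forall>x\<in>K. dist (S h u x) (u x) < \<epsilon>"
    unfolding eventually_at_right_field by auto
  have "\<bar>S h u x - u x\<bar> \<le> \<epsilon>" if "0 \<le> h" "h < d" "x \<in> K" for h x
  proof (cases "h = 0")
    case True
    then show ?thesis using S_zero[OF assms(1) that(3)] assms(2) by simp
  next
    case False
    then show ?thesis using d(2)[of h] that by (force simp: dist_real_def)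
  qed
  then show ?thesis using d(1) by blast
qed

lemma S_increment_bound:
  assumes "C u" "0 \<le> s" "0 \<le> h" "\<And>x. x \<in> K \<Longrightarrow> \<bar>S h u x - u x\<bar> \<le> \<epsilon>" "x \<in> K"
  shows "\<bar>S (s + h) u x - S s u x\<bar> \<le> \<epsilon>"
  using S_diff_bound[OF assms(2) S_cont[OF assms(3,1)] assms(1,4,5)] S_semigroup[OF assms(2,3,1,5)] by simp

text \<open>Contractivity separates the two variations: a change of the datum costs at most its sup
  norm at any time, and a change of the time costs at most one short increment of the orbit of the
  fixed datum \<open>\<Phi> s\<close>.\<close>

lemma S_joint_continuous:
  fixes \<Phi> :: "real \<Rightarrow> 'a \<Rightarrow> real"
  assumes \<Phi>: "continuous_on (I \<times> K) (\<lambda>(s, x). \<Phi> s x)" and \<tau>: "continuous_on I \<tau>" "\<And>s. s \<in> I \<Longrightarrow> 0 \<le> \<tau> s"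
  shows "continuous_on (I \<times> K) (\<lambda>(s, x). S (\<tau> s) (\<Phi> s) x)"
proof (rule joint_continuousI)
  show "C (S (\<tau> s) (\<Phi> s))" if "s \<in> I" for s
    by (intro S_cont \<tau> that joint_continuous_slice[OF \<Phi>])
next
  fix s \<epsilon> assume s: "s \<in> I" and \<epsilon>: "0 < (\<epsilon> :: real)"
  have Cs: "C (\<Phi> r)" if "r \<in> I" for r by (rule joint_continuous_slice[OF \<Phi> that])
  obtain d1 where d1: "d1 > 0" "\<And>r x. r \<in> I \<Longrightarrow> \<bar>r - s\<bar> < d1 \<Longrightarrow> x \<in> K \<Longrightarrow> \<bar>\<Phi> r x - \<Phi> s x\<bar> \<le> \<epsilon> / 2"
    using joint_continuousD[OF \<Phi> compact_K s, of "\<epsilon> / 2"] \<epsilon> by auto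
  obtain d2 where d2: "d2 > 0" "\<And>h x. 0 \<le> h \<Longrightarrow> h < d2 \<Longrightarrow> x \<in> K \<Longrightarrow> \<bar>S h (\<Phi> s) x - \<Phi> s x\<bar> \<le> \<epsilon> / 2"
    using S_strong_continuity[OF Cs[OF s], of "\<epsilon> / 2"] \<epsilon> by auto
  obtain d3 where d3: "d3 > 0" "\<And>r. r \<in> I \<Longrightarrow> \<bar>r - s\<bar> < d3 \<Longrightarrow> \<bar>\<tau> r - \<tau> s\<bar> < d2"
    using \<tau>(1) s d2(1) unfolding continuous_on_iff dist_real_def by blast
  have "\<bar>S (\<tau> r) (\<Phi> r) x - S (\<tau> s) (\<Phi> s) x\<bar> \<le> \<epsilon>" if r: "r \<in> I" "\<bar>r - s\<bar> < min d1 d3" and x: "x \<in> K" for r x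
  proof -
    have "\<bar>S (\<tau> r) (\<Phi> r) x - S (\<tau> r) (\<Phi> s) x\<bar> \<le> \<epsilon> / 2"
      using d1(2) r by (intro S_diff_bound Cs \<tau> s x) auto
    moreover have "\<bar>S (\<tau> r) (\<Phi> s) x - S (\<tau> s) (\<Phi> s) x\<bar> \<le> \<epsilon> / 2"
    proof (cases "\<tau> s \<le> \<tau> r")
      case True
      have "\<bar>\<tau> r - \<tau> s\<bar> < d2" using d3(2) r by auto
      then show ?thesis
        using True S_increment_bound[OF Cs[OF s] \<tau>(2)[OF s], of "\<tau> r - \<tau> s" "\<epsilon> / 2" x] d2(2)[of "\<tau> r - \<tau> s"] x by simp
    next
      case False
      have "\<bar>\<tau> r - \<tau> s\<bar> < d2" using d3(2) r by auto
      then show ?thesis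
        using False S_increment_bound[OF Cs[OF s] \<tau>(2)[OF r(1)], of "\<tau> s - \<tau> r" "\<epsilon> / 2" x] d2(2)[of "\<tau> s - \<tau> r"] x
        by (simp add: abs_minus_commute)
    qed
    ultimately show ?thesis by arith
  qed
  then show "\<exists>\<delta>>0. \<forall>r\<in>I. \<bar>r - s\<bar> < \<delta> \<longrightarrow> (\<forall>x\<in>K. \<bar>S (\<tau> r) (\<Phi> r) x - S (\<tau> s) (\<Phi> s) x\<bar> \<le> \<epsilon>)"
    using d1(1) d3(1) by (intro exI[of _ "min d1 d3"]) auto
qed

lemma S_orbit_continuous:
  assumes "C u" "0 \<le> a"
  shows "continuous_on ({0..t} \<times> K) (\<lambda>(s, x). S (a + s) u x)"
proof (rule S_joint_continuous)
  show "continuous_on ({0..t} \<times> K) (\<lambda>(s, x). u x)"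
    by (auto simp: split_beta intro!: continuous_on_compose2[OF assms(1)] continuous_intros)
qed (use assms in \<open>auto intro!: continuous_intros\<close>)

text \<open>Linearity gives the identity for Riemann sums, and contractivity transfers it to the
  integral.\<close>

lemma S_time_integral:
  fixes \<Phi> :: "real \<Rightarrow> 'a \<Rightarrow> real"
  assumes \<Phi>: "continuous_on ({0..t} \<times> K) (\<lambda>(s, x). \<Phi> s x)" and t: "0 \<le> t" and \<tau>: "0 \<le> \<tau>" and x: "x \<in> K"
  shows "S \<tau> (\<lambda>x. integral {0..t} (\<lambda>s. \<Phi> s x)) x = integral {0..t} (\<lambda>s. S \<tau> (\<Phi> s) x)"
proof -
  let ?u = "\<lambda>x. integral {0..t} (\<lambda>s. \<Phi> s x)"
  have S\<Phi>: "continuous_on ({0..t} \<times> K) (\<lambda>(s, x). S \<tau> (\<Phi> s) x)"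
    by (rule S_joint_continuous[OF \<Phi>]) (use \<tau> in auto)
  have "\<bar>S \<tau> ?u x - integral {0..t} (\<lambda>s. S \<tau> (\<Phi> s) x)\<bar> \<le> 0 + \<epsilon>" if "0 < \<epsilon>" for \<epsilon>
  proof -
    have "0 < \<epsilon> / 2" using that by simp
    from eventually_conj[OF eventually_gt_at_top[of 0] eventually_conj[OF joint_riemann_sum[OF \<Phi> compact_K t this] joint_riemann_sum[OF S\<Phi> compact_K t this]]]
    obtain N where "0 < N" and N: "\<And>x. x \<in> K \<Longrightarrow> \<bar>?u x - (\<Sum>k<N. (t / real N) * \<Phi> (real k * (t / real N)) x)\<bar> \<le> \<epsilon> / 2"
      "\<And>x. x \<in> K \<Longrightarrow> \<bar>integral {0..t} (\<lambda>s. S \<tau> (\<Phi> s) x) - (\<Sum>k<N. (t / real N) * S \<tau> (\<Phi> (real k * (t / real N))) x)\<bar> \<le> \<epsilon> / 2"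
      unfolding eventually_sequentially by auto
    \<comment> \<open>The cap at N keeps every node in {0..t}, including those with index beyond N,
      because \<open>S_sum\<close> asks for continuity of all members of the family.\<close>
    define p where "p k = min (real k) (real N) * (t / real N)" for k :: nat
    have p: "p k \<in> {0..t}" for k
    proof -
      have "p k \<le> real N * (t / real N)" unfolding p_def using t by (intro mult_right_mono) auto
      then show ?thesis using t \<open>0 < N\<close> by (simp add: p_def)
    qed
    have Ck: "C (\<Phi> (p k))" for k by (rule joint_continuous_slice[OF \<Phi> p])
    have pk: "p k = real k * (t / real N)" if "k < N" for k using that by (simp add: p_def)
    let ?R = "\<lambda>x. \<Sum>k<N. (t / real N) * \<Phi> (p k) x"
    have "S \<tau> ?R x = (\<Sum>k<N. (t / real N) * S \<tau> (\<Phi> (p k)) x)"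
      by (rule S_sum[OF \<tau> Ck x])
    then have "\<bar>integral {0..t} (\<lambda>s. S \<tau> (\<Phi> s) x) - S \<tau> ?R x\<bar> \<le> \<epsilon> / 2"
      using N(2)[OF x] pk by simp
    moreover have "\<bar>S \<tau> ?u x - S \<tau> ?R x\<bar> \<le> \<epsilon> / 2"
      using N(1) pk by (intro S_diff_bound \<tau> x continuous_on_time_integral[OF \<Phi>] continuous_intros Ck) simp
    ultimately show ?thesis by arith
  qed
  then have "\<bar>S \<tau> ?u x - integral {0..t} (\<lambda>s. S \<tau> (\<Phi> s) x)\<bar> \<le> 0" by (rule field_le_epsilon)
  then show ?thesis by simp
qed

text \<open>The standard supply of elements of the generator's domain: a continuous \<open>u\<close>
  need not belong to it, but its orbit integrals always do.\<close>

definition orbit_integral :: "real \<Rightarrow> ('a \<Rightarrow> real) \<Rightarrow> 'a \<Rightarrow> real" where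
  "orbit_integral t u x = integral {0..t} (\<lambda>s. S s u x)"

lemma orbit_joint: "C u \<Longrightarrow> continuous_on ({0..t} \<times> K) (\<lambda>(s, x). S s u x)"
  using S_orbit_continuous[of u 0 t] by simp

lemma orbit_continuous_time: "C u \<Longrightarrow> x \<in> K \<Longrightarrow> continuous_on {0..t} (\<lambda>s. S s u x)"
  by (rule joint_continuous_time[OF orbit_joint])

lemma orbit_integral_cont: "C u \<Longrightarrow> C (orbit_integral t u)"
  unfolding orbit_integral_def[abs_def] by (rule continuous_on_time_integral[OF orbit_joint])

lemma S_orbit_integral:
  assumes "C u" "0 \<le> t" "0 \<le> \<tau>" "x \<in> K"
  shows "S \<tau> (orbit_integral t u) x = orbit_integral (\<tau> + t) u x - orbit_integral \<tau> u x"
proof -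
  have "S \<tau> (orbit_integral t u) x = integral {0..t} (\<lambda>s. S \<tau> (S s u) x)"
    unfolding orbit_integral_def[abs_def] by (rule S_time_integral[OF orbit_joint[OF assms(1)] assms(2-4)])
  also have "\<dots> = integral {0..t} (\<lambda>s. S (s + \<tau>) u x)"
    using assms by (intro Henstock_Kurzweil_Integration.integral_cong) (auto simp: S_semigroup add.commute[of _ \<tau>])
  also have "\<dots> = integral {\<tau>..\<tau> + t} (\<lambda>s. S s u x)"
    using integral_shift_Icc_real[of 0 t "\<lambda>s. S s u x" \<tau>] by (simp add: o_def add.commute)
  also have "\<dots> = orbit_integral (\<tau> + t) u x - orbit_integral \<tau> u x"
    unfolding orbit_integral_def
    using Henstock_Kurzweil_Integration.integral_combine[of 0 \<tau> "\<tau> + t" "\<lambda>s. S s u x"]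
      integrable_continuous_real[OF orbit_continuous_time[OF assms(1,4), of "\<tau> + t"]] assms(2,3) by simp
  finally show ?thesis .
qed

lemma orbit_integral_diff:
  assumes "C u" "C v" "x \<in> K"
  shows "orbit_integral t (\<lambda>y. u y - v y) x = orbit_integral t u x - orbit_integral t v x"
proof -
  have "orbit_integral t (\<lambda>y. u y - v y) x = integral {0..t} (\<lambda>s. S s u x - S s v x)"
    unfolding orbit_integral_def using assms
    by (intro Henstock_Kurzweil_Integration.integral_cong S_diff) auto
  also have "\<dots> = orbit_integral t u x - orbit_integral t v x"
    unfolding orbit_integral_def
    by (intro Henstock_Kurzweil_Integration.integral_diff integrable_continuous_real orbit_continuous_time assms)
  finally show ?thesis .
qed

text \<open>Both sides equal the integral of the orbit over {0..t+h} minus those over {0..t} and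
  {0..h}. This expression is symmetric in t and h, so the increment over a short time becomes an
  integral over a short interval.\<close>

lemma orbit_integral_increment:
  assumes "C u" "0 \<le> t" "0 \<le> h" "x \<in> K"
  shows "S h (orbit_integral t u) x - orbit_integral t u x = orbit_integral h (\<lambda>y. S t u y - u y) x"
proof -
  have "S t (orbit_integral h u) x = orbit_integral h (S t u) x"
    unfolding orbit_integral_def[abs_def]
    using assms S_semigroup[of t _ u x] S_semigroup[of _ t u x]
    by (subst S_time_integral[OF orbit_joint[OF assms(1)] assms(3,2,4)])
      (intro Henstock_Kurzweil_Integration.integral_cong, simp add: add.commute)
  then show ?thesis
    using S_orbit_integral[OF assms(1,2,3,4)] S_orbit_integral[OF assms(1,3,2,4)]
      orbit_integral_diff[OF S_cont[OF assms(2,1)] assms(1,4), of h] by (simp add: add.commute)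
qed

lemma orbit_integral_near:
  assumes "C u" "0 \<le> h" "\<And>s x. 0 \<le> s \<Longrightarrow> s \<le> h \<Longrightarrow> x \<in> K \<Longrightarrow> \<bar>S s u x - v x\<bar> \<le> \<epsilon>" "x \<in> K"
  shows "\<bar>orbit_integral h u x - h * v x\<bar> \<le> \<epsilon> * h"
proof -
  have "orbit_integral h u x - h * v x = integral {0..h} (\<lambda>s. S s u x) - integral {0..h} (\<lambda>s. v x)"
    using assms(2) by (simp add: orbit_integral_def)
  also have "\<dots> = integral {0..h} (\<lambda>s. S s u x - v x)"
    by (intro Henstock_Kurzweil_Integration.integral_diff[symmetric] integrable_continuous_real orbit_continuous_time assms continuous_intros)
  also have "\<bar>\<dots>\<bar> \<le> \<epsilon> * (h - 0)"
    using integral_bound[of 0 h "\<lambda>s. S s u x - v x" \<epsilon>] assms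
    by (simp add: continuous_on_diff orbit_continuous_time)
  finally show ?thesis by simp
qed

lemma generator_orbit_integral:
  assumes "C u" "0 \<le> t"
  shows "generator K S (orbit_integral t u) (\<lambda>x. S t u x - u x)"
  unfolding generator_def
proof (intro conjI)
  show "C (orbit_integral t u)" by (rule orbit_integral_cont[OF assms(1)])
  show CG: "C (\<lambda>x. S t u x - u x)" by (intro continuous_intros S_cont assms)
  let ?G = "\<lambda>x. S t u x - u x"
  show "uniform_limit K (\<lambda>h x. (S h (orbit_integral t u) x - orbit_integral t u x) / h) ?G (at_right 0)"
    unfolding uniform_limit_iff
  proof (intro allI impI)
    fix e :: real assume "0 < e"
    then obtain d where d: "d > 0" "\<And>h x. 0 \<le> h \<Longrightarrow> h < d \<Longrightarrow> x \<in> K \<Longrightarrow> \<bar>S h ?G x - ?G x\<bar> \<le> e / 2"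
      using S_strong_continuity[OF CG, of "e / 2"] by auto
    have "dist ((S h (orbit_integral t u) x - orbit_integral t u x) / h) (?G x) < e" if "0 < h" "h < d" "x \<in> K" for h x
    proof -
      have "\<bar>orbit_integral h ?G x - h * ?G x\<bar> \<le> e / 2 * h"
        using that d(2) by (intro orbit_integral_near CG) auto
      also have "\<dots> < e * h" using \<open>0 < e\<close> that(1) by simp
      finally have "\<bar>orbit_integral h ?G x - h * ?G x\<bar> / h < e" using that(1) by (simp add: divide_less_eq)
      moreover have "(orbit_integral h ?G x) / h - ?G x = (orbit_integral h ?G x - h * ?G x) / h"
        using that(1) by (simp add: diff_divide_distrib)
      ultimately show ?thesis
        using orbit_integral_increment[OF assms, of h x] that by (simp add: dist_real_def)
    qed
    then show "\<forall>\<^sub>F h in at_right 0. \<forall>x\<in>K. dist ((S h (orbit_integral t u) x - orbit_integral t u x) / h) (?G x) < e"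
      unfolding eventually_at_right_field using d(1) by blast
  qed
qed

lemma S_fixes:
  assumes u: "generator K S u (\<lambda>x. 0)" and t: "0 \<le> t" and x: "x \<in> K"
  shows "S t u x = u x"
proof (cases "t = 0")
  case True
  then show ?thesis using u S_zero x by (simp add: generator_def)
next
  case False
  then have t: "0 < t" using t by simp
  have Cu: "C u" and lim: "uniform_limit K (\<lambda>h x. (S h u x - u x) / h) (\<lambda>x. 0) (at_right 0)"
    using u by (auto simp: generator_def)
  have "\<bar>S t u x - u x\<bar> \<le> 0 + e" if "0 < e" for e
  proof -
    have "\<forall>\<^sub>F h in at_right 0. \<forall>x\<in>K. dist ((S h u x - u x) / h) 0 < e / t"
      using lim \<open>0 < e\<close> t unfolding uniform_limit_iff by simp
    then obtain d where d: "d > 0" "\<And>h. 0 < h \<Longrightarrow> h < d \<Longrightarrow> \<forall>x\<in>K. dist ((S h u x - u x) / h) 0 < e / t"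
      unfolding eventually_at_right_field by auto
    obtain N :: nat where N: "t / d < N" using reals_Archimedean2 by blast
    then have N0: "0 < real N" using divide_pos_pos[OF t d(1)] by linarith
    define h where "h = t / N"
    have h: "0 < h" "h < d" "real N * h = t"
      using t N N0 d(1) by (auto simp: h_def field_simps)
    have inc: "\<bar>S h u x - u x\<bar> \<le> e / t * h" if "x \<in> K" for x
    proof -
      have "\<bar>S h u x - u x\<bar> / h < e / t" using d(2)[OF h(1,2)] that h(1) by (simp add: dist_real_def)
      then show ?thesis using h(1) by (simp add: divide_less_eq less_imp_le)
    qed
    have "\<bar>S (real k * h) u x - u x\<bar> \<le> real k * (e / t * h)" for k
    proof (induction k)
      case 0
      then show ?case using S_zero[OF Cu x] by simp
    next
      case (Suc k)
      have "\<bar>S (real k * h + h) u x - S (real k * h) u x\<bar> \<le> e / t * h"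
        by (rule S_increment_bound[OF Cu _ _ inc x]) (use h in auto)
      moreover have "real (Suc k) * h = real k * h + h" "real (Suc k) * (e / t * h) = real k * (e / t * h) + e / t * h"
        by (simp_all only: of_nat_Suc distrib_right mult_1 add.commute)
      ultimately show ?case using Suc by (simp only:)
    qed
    from this[of N] show ?thesis using h(3) t by (simp add: mult.left_commute)
  qed
  then have "\<bar>S t u x - u x\<bar> \<le> 0" by (rule field_le_epsilon)
  then show ?thesis by simp
qed

end

locale markov_semigroup = compact_semigroup +
  assumes generator_1: "generator K S (\<lambda>x. 1) (\<lambda>x. 0)"
begin

lemma S_const: "0 \<le> t \<Longrightarrow> x \<in> K \<Longrightarrow> S t (\<lambda>y. c) x = c"
  using S_cmult[of t "\<lambda>y. 1" x c] S_fixes[OF generator_1] by simp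

text \<open>A contraction that fixes the constants is positive: \<open>\<bar>u - B / 2\<bar> \<le> B / 2\<close> is preserved.\<close>

lemma S_nonneg:
  assumes "0 \<le> t" "C u" "\<And>x. x \<in> K \<Longrightarrow> 0 \<le> u x" "x \<in> K"
  shows "0 \<le> S t u x"
proof -
  obtain B where B: "\<And>x. x \<in> K \<Longrightarrow> \<bar>u x\<bar> \<le> B" using C_bound[OF assms(2)] by blast
  have "\<bar>S t u x - S t (\<lambda>y. B / 2) x\<bar> \<le> B / 2"
  proof (rule S_diff_bound[OF assms(1,2)])
    show "\<bar>u x - B / 2\<bar> \<le> B / 2" if "x \<in> K" for x using B[OF that] assms(3)[OF that] by (auto simp: abs_if)
  qed (use assms in auto)
  then show ?thesis using S_const[OF assms(1,4)] by (simp add: abs_if split: if_splits)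
qed

lemma S_mono:
  assumes "0 \<le> t" "C u" "C v" "\<And>x. x \<in> K \<Longrightarrow> u x \<le> v x" "x \<in> K"
  shows "S t u x \<le> S t v x"
  using S_nonneg[OF assms(1) continuous_on_diff[OF assms(3,2)] _ assms(5)] assms(4) S_diff[OF assms(1,3,2,5)] by simp

lemma S_lower_const:
  assumes "0 \<le> t" "C u" "\<And>x. x \<in> K \<Longrightarrow> c \<le> u x" "x \<in> K"
  shows "c \<le> S t u x"
  using S_mono[OF assms(1) _ assms(2), of "\<lambda>y. c" x] assms(3,4) S_const[OF assms(1,4)] by simp

lemma S_upper_const:
  assumes "0 \<le> t" "C u" "\<And>x. x \<in> K \<Longrightarrow> u x \<le> c" "x \<in> K"
  shows "S t u x \<le> c"
  using S_mono[OF assms(1,2), of "\<lambda>y. c" x] assms(3,4) S_const[OF assms(1,4)] by simp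

end

section \<open>Radial weak subsolutions\<close>

lemma pos_part_power_has_derivative:
  "((\<lambda>s :: real. (max 0 s) ^ (m + 2)) has_real_derivative real (m + 2) * (max 0 s) ^ (m + 1)) (at s)"
proof -
  consider "s > 0" | "s < 0" | "s = 0" by linarith
  then show ?thesis
  proof cases
    case 1
    have "((\<lambda>s. s ^ (m + 2)) has_real_derivative real (m + 2) * (max 0 s) ^ (m + 1)) (at s)"
      using 1 DERIV_pow[of "m + 2" s] by simp
    then show ?thesis
      by (rule DERIV_cong_ev[THEN iffD2, rotated -1])
        (use 1 in \<open>auto simp: max_def intro!: eventually_mono[OF eventually_nhds_in_open[of "{0<..}"]]\<close>)
  next
    case 2
    have "((\<lambda>s. 0) has_real_derivative real (m + 2) * (max 0 s) ^ (m + 1)) (at s)"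
      using 2 by simp
    then show ?thesis
      by (rule DERIV_cong_ev[THEN iffD2, rotated -1])
        (use 2 in \<open>auto simp: max_def intro!: eventually_mono[OF eventually_nhds_in_open[of "{..<0}"]]\<close>)
  next
    case 3
    have "(\<lambda>h. (max 0 h) ^ (m + 2) / h) \<midarrow>0\<rightarrow> (0 :: real)"
    proof (rule Lim_null_comparison)
      have "norm ((max 0 h) ^ (m + 2) / h) \<le> \<bar>h\<bar> ^ (m + 1)" for h :: real
      proof (cases "h > 0")
        case False
        then have "max 0 h = 0" by simp
        show ?thesis unfolding \<open>max 0 h = 0\<close> by simp
      qed (simp add: max_absorb2)
      then show "\<forall>\<^sub>F h in at 0. norm ((max 0 h) ^ (m + 2) / h) \<le> \<bar>h\<bar> ^ (m + 1)"
        by (intro always_eventually allI)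
      show "((\<lambda>h. \<bar>h\<bar> ^ (m + 1)) \<longlongrightarrow> (0 :: real)) (at 0)"
        by (auto intro!: tendsto_eq_intros)
    qed
    then show ?thesis using 3 by (simp add: DERIV_def)
  qed
qed

definition radial_pos :: "real ^ 'd \<Rightarrow> real \<Rightarrow> real ^ 'd \<Rightarrow> real" where
  "radial_pos c R x = max 0 (R\<^sup>2 - (x - c) \<bullet> (x - c))"

text \<open>The exponent starts at 3 so that the gradient, of power n + 2, is C^1 across the sphere
  and can serve as a test field.\<close>

definition barrier :: "nat \<Rightarrow> real ^ 'd \<Rightarrow> real \<Rightarrow> real ^ 'd \<Rightarrow> real" where
  "barrier n c R x = radial_pos c R x ^ (n + 3)"

definition barrier_grad :: "nat \<Rightarrow> real ^ 'd \<Rightarrow> real \<Rightarrow> real ^ 'd \<Rightarrow> real ^ 'd" where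
  "barrier_grad n c R x = (- 2 * real (n + 3) * radial_pos c R x ^ (n + 2)) *\<^sub>R (x - c)"

text \<open>With p = R^2 - |x - c|^2 and N = n + 3 these are the terms N (N - 1) p^(N-2) |grad p|^2
  and N p^(N-1) \<Delta>p of the Laplacian. The first is quadratic in n, the negative one only
  linear; they compete near the centre, where grad p vanishes.\<close>

definition barrier_lap :: "nat \<Rightarrow> real ^ 'd \<Rightarrow> real \<Rightarrow> real ^ 'd \<Rightarrow> real" where
  "barrier_lap n c R x = 4 * real (n + 3) * real (n + 2) * radial_pos c R x ^ (n + 1) * ((x - c) \<bullet> (x - c))
     - 2 * real (n + 3) * real CARD('d) * radial_pos c R x ^ (n + 2)"

lemma radial_pos_nonneg: "0 \<le> radial_pos c R x"
  by (simp add: radial_pos_def)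

lemma radial_pos_le: "radial_pos c R x \<le> R\<^sup>2"
  by (simp add: radial_pos_def)

lemma radial_pos_eq_0: "0 \<le> R \<Longrightarrow> x \<notin> ball c R \<Longrightarrow> radial_pos c R x = 0"
  using power_mono[of R "norm (x - c)" 2]
  by (auto simp: radial_pos_def dist_norm norm_minus_commute dot_square_norm max_def)

lemma radial_pos_pos: "x \<in> ball c R \<Longrightarrow> 0 < radial_pos c R x"
  using power_strict_mono[of "norm (x - c)" R 2]
  by (auto simp: radial_pos_def dist_norm norm_minus_commute dot_square_norm less_max_iff_disj)

lemma continuous_radial_pos: "continuous_on A (radial_pos c R)"
  unfolding radial_pos_def[abs_def] by (intro continuous_intros)

lemma continuous_barrier: "continuous_on A (barrier n c R)"
  unfolding barrier_def[abs_def] by (intro continuous_intros continuous_radial_pos)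

lemma continuous_barrier_grad: "continuous_on A (barrier_grad n c R)"
  unfolding barrier_grad_def[abs_def] by (intro continuous_intros continuous_radial_pos)

lemma continuous_barrier_lap: "continuous_on A (barrier_lap n c R)"
  unfolding barrier_lap_def[abs_def] by (intro continuous_intros continuous_radial_pos)

lemma radial_pos_power_has_derivative:
  "((\<lambda>x. radial_pos c R x ^ (m + 2)) has_derivative
     (\<lambda>h. ((- 2 * real (m + 2) * radial_pos c R x ^ (m + 1)) *\<^sub>R (x - c)) \<bullet> h)) (at x)"
proof -
  have "((\<lambda>x. R\<^sup>2 - (x - c) \<bullet> (x - c)) has_derivative (\<lambda>h. - 2 * ((x - c) \<bullet> h))) (at x)"
    by (auto intro!: derivative_eq_intros simp: inner_commute)
  from DERIV_compose_FDERIV[OF pos_part_power_has_derivative this, of m]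
  show ?thesis
    unfolding radial_pos_def[abs_def] by (rule has_derivative_eq_rhs) (simp add: fun_eq_iff algebra_simps)
qed

lemma barrier_has_derivative:
  "(barrier n c R has_derivative (\<lambda>h. barrier_grad n c R x \<bullet> h)) (at x)"
  using radial_pos_power_has_derivative[of c R "n + 1" x]
  unfolding barrier_def[abs_def] barrier_grad_def by (simp add: numeral_eq_Suc)

definition barrier_hessian :: "nat \<Rightarrow> real ^ 'd \<Rightarrow> real \<Rightarrow> 'd \<Rightarrow> real ^ 'd \<Rightarrow> real ^ 'd" where
  "barrier_hessian n c R i x = (- 2 * real (n + 3)) *\<^sub>R
     (radial_pos c R x ^ (n + 2) *\<^sub>R axis i 1
      + ((x - c) $ i * (- 2 * real (n + 2) * radial_pos c R x ^ (n + 1))) *\<^sub>R (x - c))"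

lemma barrier_grad_has_derivative:
  "((\<lambda>x. barrier_grad n c R x $ i) has_derivative (\<lambda>h. barrier_hessian n c R i x \<bullet> h)) (at x)"
proof -
  have "((\<lambda>x. (x - c) $ i) has_derivative (\<lambda>h. axis i 1 \<bullet> h)) (at x)"
  proof -
    have "((\<lambda>x. x $ i - c $ i) has_derivative (\<lambda>h. h $ i - 0)) (at x)"
      by (intro has_derivative_diff bounded_linear_imp_has_derivative[OF bounded_linear_vec_nth] has_derivative_const)
    then show ?thesis by (simp add: inner_axis')
  qed
  from has_derivative_mult_right[OF has_derivative_mult[OF radial_pos_power_has_derivative[of c R n x] this], of "- 2 * real (n + 3)"]
  have "((\<lambda>x. - 2 * real (n + 3) * (radial_pos c R x ^ (n + 2) * (x - c) $ i)) has_derivative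
    (\<lambda>h. barrier_hessian n c R i x \<bullet> h)) (at x)"
    by (rule has_derivative_eq_rhs)
      (simp only: barrier_hessian_def inner_add_left inner_scaleR_left fun_eq_iff mult_ac simp_thms)
  moreover have "(\<lambda>x. barrier_grad n c R x $ i) = (\<lambda>x. - 2 * real (n + 3) * (radial_pos c R x ^ (n + 2) * (x - c) $ i))"
    by (simp only: barrier_grad_def vector_scaleR_component real_scaleR_def mult.assoc)
  ultimately show ?thesis by (simp only:)
qed

lemma continuous_barrier_hessian: "continuous_on A (barrier_hessian n c R i)"
  unfolding barrier_hessian_def[abs_def] by (intro continuous_intros continuous_radial_pos)

text \<open>\<open>barrier_hessian n c R i\<close> is the gradient of the i-th component of
  \<open>barrier_grad\<close>, so this sum is the divergence of the barrier gradient, the form in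
  which it appears in the flux inequality.\<close>

lemma barrier_lap_eq_div: "(\<Sum>i\<in>UNIV. barrier_hessian n c R i x $ i) = barrier_lap n c R x"
  for c :: "real ^ 'd"
proof -
  have alg: "- 2 * N * (P + a * (- 2 * M * Q) * a) = - 2 * N * P + 4 * N * M * Q * (a * a)" for N P a M Q :: real
    by (simp add: algebra_simps)
  have alg2: "k * (- 2 * N * P) + Y = Y - 2 * N * k * P" for N P k Y :: real
    by (simp add: algebra_simps)
  have "(\<Sum>i\<in>UNIV. barrier_hessian n c R i x $ i) = (\<Sum>i\<in>(UNIV :: 'd set). - 2 * real (n + 3) * radial_pos c R x ^ (n + 2)
      + 4 * real (n + 3) * real (n + 2) * radial_pos c R x ^ (n + 1) * ((x - c) $ i * (x - c) $ i))"
    unfolding barrier_hessian_def vector_scaleR_component vector_add_component axis_nth real_scaleR_def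
    by (intro sum.cong refl) (simp only: alg mult_1_right)
  also have "\<dots> = real CARD('d) * (- 2 * real (n + 3) * radial_pos c R x ^ (n + 2))
      + 4 * real (n + 3) * real (n + 2) * radial_pos c R x ^ (n + 1) * ((x - c) \<bullet> (x - c))"
    by (simp only: sum.distrib sum_constant sum_distrib_left[symmetric] inner_vec_def inner_real_def)
  also have "\<dots> = barrier_lap n c R x"
    unfolding barrier_lap_def by (simp only: alg2)
  finally show ?thesis .
qed

context bounded_open_set
begin

text \<open>
  Testing against the compactly supported fields \<open>\<eta> X\<close> avoids boundary traces: the boundary flux
  of \<open>v X\<close> is replaced by the integral of \<open>v (\<nabla>\<eta> \<bullet> X)\<close>, whose sign is known.
\<close>

lemma weak_flux_nonpos:
  fixes X :: "real ^ 'd \<Rightarrow> real ^ 'd" and \<eta> :: "nat \<Rightarrow> real ^ 'd \<Rightarrow> real"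
  assumes X: "\<And>i x. ((\<lambda>x. X x $ i) has_derivative (\<lambda>h. D i x \<bullet> h)) (at x)" "\<And>i. continuous_on UNIV (D i)"
    and \<eta>: "\<And>m x. (\<eta> m has_derivative (\<lambda>h. E m x \<bullet> h)) (at x)" "\<And>m. continuous_on UNIV (E m)"
      "\<And>m x. 0 \<le> \<eta> m x" "\<And>m x. \<eta> m x \<le> 1" "\<And>x. x \<in> \<Omega> \<Longrightarrow> (\<lambda>m. \<eta> m x) \<longlonglongrightarrow> 1 \<or> X x = 0 \<and> (\<forall>i. D i x = 0)"
    and supp: "\<And>m. \<exists>C. compact C \<and> C \<subseteq> \<Omega> \<and> (\<forall>x. x \<notin> C \<longrightarrow> \<eta> m x *\<^sub>R X x = 0)"
    and flux: "\<And>m x. x \<in> \<Omega> \<Longrightarrow> 0 \<le> E m x \<bullet> X x"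
    and v: "H1 \<Omega> v g" "\<And>x. x \<in> \<Omega> \<Longrightarrow> 0 \<le> v x"
  shows "(LINT x|M\<^sub>\<Omega>. X x \<bullet> g x) \<le> - (LINT x|M\<^sub>\<Omega>. (\<Sum>i\<in>UNIV. D i x $ i) * v x)"
proof -
  let ?div = "\<lambda>x. \<Sum>i\<in>UNIV. D i x $ i"
  have iv: "integrable M\<^sub>\<Omega> v" and ig: "\<And>k. integrable M\<^sub>\<Omega> (\<lambda>x. g x $ k)"
    using v(1) square_integrable_imp_integrable square_integrable_component by (auto simp: H1_def)
  have cX: "continuous_on UNIV X"
    by (rule continuous_on_vec_componentwise)
      (use X(1) in \<open>auto intro!: has_derivative_continuous simp: continuous_on_eq_continuous_at\<close>)
  have c\<eta>: "continuous_on UNIV (\<eta> m)" for m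
    using \<eta>(1) by (auto intro!: has_derivative_continuous simp: continuous_on_eq_continuous_at)
  have cont: "integrable M\<^sub>\<Omega> (\<lambda>x. f x * w x)" if "integrable M\<^sub>\<Omega> w" "continuous_on UNIV f" for w f :: "real ^ 'd \<Rightarrow> real"
    using integrable_mult_continuous[OF continuous_on_subset[OF that(2)] that(1)] by simp
  define P where "P x = X x \<bullet> g x + ?div x * v x" for x
  have iXg: "integrable M\<^sub>\<Omega> (\<lambda>x. X x \<bullet> g x)"
    unfolding inner_vec_def inner_real_def
    by (intro Bochner_Integration.integrable_sum cont ig continuous_intros cX)
  have idv: "integrable M\<^sub>\<Omega> (\<lambda>x. ?div x * v x)"
    by (intro cont iv continuous_intros X(2))
  have iP: "integrable M\<^sub>\<Omega> P" unfolding P_def[abs_def] by (intro Bochner_Integration.integrable_add iXg idv)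
  have le0: "(LINT x|M\<^sub>\<Omega>. \<eta> m x * P x) \<le> 0" for m
  proof -
    obtain C where C: "compact C" "C \<subseteq> \<Omega>" "\<And>x. x \<notin> C \<Longrightarrow> \<eta> m x *\<^sub>R X x = 0"
      using supp[of m] by blast
    \<comment> \<open>Each component of the cut-off field is an admissible C^1 test function for the
      weak gradient of v. After summation over i the term with \<open>E m\<close> is the flux
      through the layer in which the cutoff varies.\<close>
    have *: "(LINT x|M\<^sub>\<Omega>. v x * (\<eta> m x *\<^sub>R D i x + (X x $ i) *\<^sub>R E m x) $ i) = - (LINT x|M\<^sub>\<Omega>. g x $ i * (\<eta> m x * X x $ i))" for i
    proof (rule H1_C1_test[OF v(1) _ _ C(1,2)])
      show "((\<lambda>x. \<eta> m x * X x $ i) has_derivative (\<lambda>h. (\<eta> m x *\<^sub>R D i x + (X x $ i) *\<^sub>R E m x) \<bullet> h)) (at x)" for x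
        using has_derivative_mult[OF \<eta>(1)[of m x] X(1)[of i x]] by (simp add: inner_add_left mult.commute)
      show "continuous_on UNIV (\<lambda>x. \<eta> m x *\<^sub>R D i x + (X x $ i) *\<^sub>R E m x)"
        by (intro continuous_intros c\<eta> cX X(2) \<eta>(2))
      show "\<eta> m x * X x $ i = 0" if "x \<notin> C" for x
        using C(3)[OF that] by (auto simp: vec_eq_iff)
    qed
    have i1: "integrable M\<^sub>\<Omega> (\<lambda>x. v x * (\<eta> m x *\<^sub>R D i x + (X x $ i) *\<^sub>R E m x) $ i)" for i
      by (subst mult.commute) (intro cont iv continuous_intros c\<eta> cX X(2) \<eta>(2))
    have i2: "integrable M\<^sub>\<Omega> (\<lambda>x. g x $ i * (\<eta> m x * X x $ i))" for i
      by (subst mult.commute) (intro cont ig continuous_intros c\<eta> cX)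
    have "(LINT x|M\<^sub>\<Omega>. (\<Sum>i\<in>UNIV. v x * (\<eta> m x *\<^sub>R D i x + (X x $ i) *\<^sub>R E m x) $ i) + (\<Sum>i\<in>UNIV. g x $ i * (\<eta> m x * X x $ i))) = 0"
      using * i1 i2 by (simp add: Bochner_Integration.integral_sum sum_negf del: vector_add_component vector_scaleR_component)
    also have "(\<lambda>x. (\<Sum>i\<in>UNIV. v x * (\<eta> m x *\<^sub>R D i x + (X x $ i) *\<^sub>R E m x) $ i) + (\<Sum>i\<in>UNIV. g x $ i * (\<eta> m x * X x $ i)))
        = (\<lambda>x. \<eta> m x * P x + v x * (E m x \<bullet> X x))"
      by (simp add: fun_eq_iff P_def inner_vec_def sum.distrib sum_distrib_left sum_distrib_right algebra_simps)
    finally have "(LINT x|M\<^sub>\<Omega>. \<eta> m x * P x + v x * (E m x \<bullet> X x)) = 0" .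
    moreover have "(LINT x|M\<^sub>\<Omega>. \<eta> m x * P x) \<le> (LINT x|M\<^sub>\<Omega>. \<eta> m x * P x + v x * (E m x \<bullet> X x))"
    proof (rule integral_mono)
      show "integrable M\<^sub>\<Omega> (\<lambda>x. \<eta> m x * P x)" by (intro cont iP c\<eta>)
      moreover have "integrable M\<^sub>\<Omega> (\<lambda>x. v x * (E m x \<bullet> X x))"
        by (subst mult.commute) (intro cont iv continuous_intros cX \<eta>(2))
      ultimately show "integrable M\<^sub>\<Omega> (\<lambda>x. \<eta> m x * P x + v x * (E m x \<bullet> X x))" by simp
      show "\<eta> m x * P x \<le> \<eta> m x * P x + v x * (E m x \<bullet> X x)" if "x \<in> space M\<^sub>\<Omega>" for x
        using that v(2)[of x] flux[of x m] by simp
    qed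
    ultimately show ?thesis by simp
  qed
  have "(\<lambda>m. LINT x|M\<^sub>\<Omega>. \<eta> m x * P x) \<longlonglongrightarrow> (LINT x|M\<^sub>\<Omega>. P x)"
  proof (rule integral_dominated_convergence[where w = "\<lambda>x. \<bar>P x\<bar>"])
    show "P \<in> borel_measurable M\<^sub>\<Omega>" "integrable M\<^sub>\<Omega> (\<lambda>x. \<bar>P x\<bar>)" using iP by auto
    show "(\<lambda>x. \<eta> m x * P x) \<in> borel_measurable M\<^sub>\<Omega>" for m
      by (intro borel_measurable_integrable cont iP c\<eta>)
    show "AE x in M\<^sub>\<Omega>. (\<lambda>m. \<eta> m x * P x) \<longlonglongrightarrow> P x"
    proof (rule AE_I2)
      fix x assume "x \<in> space M\<^sub>\<Omega>"
      \<comment> \<open>At points where the cutoffs do not tend to 1 the field and its derivatives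
        vanish, hence so does \<open>P\<close>.\<close>
      then consider "(\<lambda>m. \<eta> m x) \<longlonglongrightarrow> 1" | "P x = 0" using \<eta>(5)[of x] by (auto simp: P_def)
      then show "(\<lambda>m. \<eta> m x * P x) \<longlonglongrightarrow> P x"
      proof cases
        case 1
        then have "(\<lambda>m. \<eta> m x * P x) \<longlonglongrightarrow> 1 * P x" by (intro tendsto_intros)
        then show ?thesis by simp
      qed simp
    qed
    show "AE x in M\<^sub>\<Omega>. norm (\<eta> m x * P x) \<le> \<bar>P x\<bar>" for m
      using \<eta>(3,4) by (intro AE_I2) (auto simp: abs_mult intro!: mult_left_le_one_le)
  qed
  from LIMSEQ_le_const2[OF this] le0 have "(LINT x|M\<^sub>\<Omega>. P x) \<le> 0" by blast
  then show ?thesis unfolding P_def using iXg idv by simp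
qed

text \<open>The trace-free form of the statement that the barrier has nonpositive outward normal
  derivative on the boundary of \<open>\<Omega>\<close>. All exponents n are included because the
  ball stays fixed while n grows.\<close>

definition good_ball :: "real ^ 'd \<Rightarrow> real \<Rightarrow> bool" where
  "good_ball c R \<longleftrightarrow> (\<forall>n v g. H1 \<Omega> v g \<longrightarrow> (\<forall>x\<in>\<Omega>. 0 \<le> v x) \<longrightarrow>
     (LINT x|M\<^sub>\<Omega>. barrier_grad n c R x \<bullet> g x) \<le> - (LINT x|M\<^sub>\<Omega>. barrier_lap n c R x * v x))"

text \<open>The barrier gradient has compact support in \<open>\<Omega>\<close>, so the constant
  cutoff 1 works and there is no flux.\<close>

lemma good_ball_interior:
  assumes "0 \<le> R" "cball c R \<subseteq> \<Omega>"
  shows "good_ball c R"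
  unfolding good_ball_def
proof (intro allI impI)
  fix n v g assume v: "H1 \<Omega> v g" "\<forall>x\<in>\<Omega>. 0 \<le> v x"
  show "(LINT x|M\<^sub>\<Omega>. barrier_grad n c R x \<bullet> g x) \<le> - (LINT x|M\<^sub>\<Omega>. barrier_lap n c R x * v x)"
    unfolding barrier_lap_eq_div[symmetric]
  proof (rule weak_flux_nonpos[where X = "barrier_grad n c R" and D = "barrier_hessian n c R" and \<eta> = "\<lambda>_ _. 1" and E = "\<lambda>_ _. 0"])
    have "barrier_grad n c R x = 0" if "x \<notin> cball c R" for x
      using radial_pos_eq_0[OF assms(1), of x c] that by (simp add: barrier_grad_def)
    then show "\<exists>C. compact C \<and> C \<subseteq> \<Omega> \<and> (\<forall>x. x \<notin> C \<longrightarrow> 1 *\<^sub>R barrier_grad n c R x = 0)" for m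
      using assms(2) by (intro exI[of _ "cball c R"]) auto
  qed (use v in \<open>auto intro!: barrier_grad_has_derivative continuous_barrier_hessian\<close>)
qed

text \<open>The centre is z + h \<mu> with \<mu> an inward normal at z, and the radius is twice the
  distance to z, so the ball crosses the boundary. For small h the normal varies little over the
  ball and the boundary is nearly flat, so at boundary points of the ball the direction towards the
  centre still points into \<open>\<Omega>\<close>.\<close>

lemma good_ball_frontier:
  assumes C1: "C1_boundary \<Omega>" and z: "z \<in> frontier \<Omega>"
  obtains c R where "0 < R" "z \<in> ball c R" "c \<notin> frontier \<Omega>" "good_ball c R"
proof -
  obtain r e \<gamma> where r: "r > 0" and e: "norm e = 1" and \<gamma>: "Ck 1 \<gamma>"
    and graph: "\<Omega> \<inter> ball z r = {x \<in> ball z r. \<gamma> (x - (x \<bullet> e) *\<^sub>R e) < x \<bullet> e}"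
    using C1 z unfolding C1_boundary_def by blast
  obtain G where G: "\<And>x. (\<gamma> has_derivative (\<lambda>h. G x \<bullet> h)) (at x)" "\<And>i. continuous_on UNIV (\<lambda>x. G x $ i)"
    using \<gamma> by auto
  have cG: "continuous_on UNIV G" using G(2) by (rule continuous_on_vec_componentwise)
  define pr where "pr x = x - (x \<bullet> e) *\<^sub>R e" for x
  \<comment> \<open>A C^1 defining function, positive exactly on \<open>\<Omega>\<close> within the
    ball around z; \<open>\<nu>\<close> is its gradient and thus an inward normal on the boundary,
    not normalised.\<close>
  define y where "y x = x \<bullet> e - \<gamma> (pr x)" for x
  define \<nu> where "\<nu> x = e - (G (pr x) - (G (pr x) \<bullet> e) *\<^sub>R e)" for x
  have ee: "e \<bullet> e = 1" using e by (simp add: dot_square_norm)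
  have y': "(y has_derivative (\<lambda>h. \<nu> x \<bullet> h)) (at x)" for x
  proof -
    have "(pr has_derivative (\<lambda>h. h - (h \<bullet> e) *\<^sub>R e)) (at x)"
      unfolding pr_def[abs_def] by (auto intro!: derivative_eq_intros)
    from has_derivative_diff[OF bounded_linear_imp_has_derivative[OF bounded_linear_inner_left, of e] has_derivative_compose[OF this G(1)]]
    show ?thesis
      unfolding y_def[abs_def]
      by (rule has_derivative_eq_rhs) (simp add: fun_eq_iff \<nu>_def inner_diff_left inner_diff_right inner_commute mult.commute)
  qed
  have cpr: "continuous_on UNIV pr" unfolding pr_def[abs_def] by (intro continuous_intros)
  have c\<nu>: "continuous_on UNIV \<nu>"
    unfolding \<nu>_def[abs_def] by (intro continuous_intros continuous_on_compose2[OF cG cpr]) auto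
  have cy: "continuous_on UNIV y"
    using y' by (auto intro!: has_derivative_continuous simp: continuous_on_eq_continuous_at)
  have mem: "x \<in> \<Omega> \<longleftrightarrow> 0 < y x" if "x \<in> ball z r" for x
  proof -
    have "x \<in> \<Omega> \<inter> ball z r \<longleftrightarrow> x \<in> {x \<in> ball z r. \<gamma> (x - (x \<bullet> e) *\<^sub>R e) < x \<bullet> e}"
      by (simp only: graph)
    then show ?thesis using that by (simp add: y_def pr_def)
  qed
  have y0: "y x = 0" if "x \<in> frontier \<Omega>" "x \<in> ball z r" for x
  proof -
    have "x \<notin> \<Omega>" using that(1) open_\<Omega> by (simp add: frontier_def interior_open)
    then have "y x \<le> 0" using mem[OF that(2)] by simp
    moreover have "0 \<le> y x"
    proof (rule ccontr)
      assume "\<not> 0 \<le> y x"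
      then have xU: "x \<in> ball z r \<inter> {x. y x < 0}" using that(2) by auto
      have "open (ball z r \<inter> {x. y x < 0})"
        by (intro open_Int open_ball open_Collect_less cy continuous_intros)
      moreover have "x \<in> closure \<Omega>" using that(1) by (simp add: frontier_def)
      ultimately obtain x' where "x' \<in> \<Omega>" "x' \<in> ball z r" "y x' < 0"
        using xU unfolding closure_iff_nhds_not_empty by blast
      then show False using mem[of x'] by simp
    qed
    ultimately show ?thesis by simp
  qed
  define \<mu> where "\<mu> = \<nu> z"
  have "\<mu> \<bullet> e = 1" by (simp add: \<mu>_def \<nu>_def inner_diff_left ee)
  then have \<mu>: "norm \<mu> > 0" by auto
  have yz: "y z = 0" using y0[OF z] r by simp
  \<comment> \<open>In units of h |\<mu>|^2, linearising y over the distance 3 h |\<mu>| costs 3/14,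
    and turning the normal over the length R = 2 h |\<mu>| costs 2/14. Of the main term 1 at least
    one half remains, which is \<open>\<kappa>\<close>.\<close>
  let ?\<epsilon> = "norm \<mu> / 14"
  have "0 < ?\<epsilon>" using \<mu> by simp
  obtain d1 where d1: "d1 > 0" "\<And>x. norm (x - z) < d1 \<Longrightarrow> norm (\<nu> x - \<mu>) < ?\<epsilon>"
    using c\<nu> \<open>0 < ?\<epsilon>\<close> unfolding continuous_on_iff dist_norm \<mu>_def by blast
  obtain d2 where d2: "d2 > 0" "\<And>x. norm (x - z) < d2 \<Longrightarrow> norm (y x - y z - \<mu> \<bullet> (x - z)) \<le> ?\<epsilon> * norm (x - z)"
    using y'[of z] \<open>0 < ?\<epsilon>\<close> unfolding has_derivative_at_alt \<mu>_def by blast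
  \<comment> \<open>The ball around c reaches at most R + |c - z| = 3 h |\<mu>| from z; the 4 in the
    denominator makes this strictly smaller than r, d1 and d2.\<close>
  define h where "h = min r (min d1 d2) / (4 * norm \<mu>)"
  have h: "h > 0" using r d1(1) d2(1) \<mu> by (simp add: h_def)
  have "3 * (h * norm \<mu>) < 4 * (h * norm \<mu>)" using h \<mu> by simp
  moreover have "4 * (h * norm \<mu>) = min r (min d1 d2)" using \<mu> by (simp add: h_def)
  ultimately have h3: "3 * (h * norm \<mu>) < r" "3 * (h * norm \<mu>) < d1" "3 * (h * norm \<mu>) < d2" by linarith+
  define c where "c = z + h *\<^sub>R \<mu>"
  define R where "R = 2 * (h * norm \<mu>)"
  have R: "R > 0" using h \<mu> by (simp add: R_def)
  have near: "norm (x - z) \<le> 3 * (h * norm \<mu>)" if "x \<in> cball c R" for x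
  proof -
    have "x - z = (x - c) + h *\<^sub>R \<mu>" by (simp add: c_def)
    then have "norm (x - z) \<le> norm (x - c) + norm (h *\<^sub>R \<mu>)" by (metis norm_triangle_ineq)
    then show ?thesis using that h by (simp add: R_def dist_norm norm_minus_commute)
  qed
  have inball: "x \<in> ball z r" if "x \<in> cball c R" for x
    using near[OF that] h3(1) by (simp add: dist_norm norm_minus_commute)
  define \<kappa> where "\<kappa> = h * (norm \<mu>)\<^sup>2 / 2"
  have \<kappa>: "\<kappa> > 0" using h \<mu> by (simp add: \<kappa>_def)
  \<comment> \<open>The inequality covers a whole layer: the direction towards c points inwards
    wherever y is below \<open>\<kappa>\<close>, not only on the boundary, where y = 0.\<close>
  have flux: "\<kappa> - y x \<le> \<nu> x \<bullet> (c - x)" if x: "x \<in> cball c R" for x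
  proof -
    have nx: "norm (x - z) \<le> 3 * (h * norm \<mu>)" by (rule near[OF x])
    have a1: "\<mu> \<bullet> (x - z) \<le> y x + ?\<epsilon> * (3 * (h * norm \<mu>))"
    proof -
      have "\<bar>y x - \<mu> \<bullet> (x - z)\<bar> \<le> ?\<epsilon> * norm (x - z)" using d2(2)[of x] nx h3 yz by simp
      also have "\<dots> \<le> ?\<epsilon> * (3 * (h * norm \<mu>))" using nx by (intro mult_left_mono) auto
      finally show ?thesis by linarith
    qed
    have a2: "- (?\<epsilon> * R) \<le> (\<nu> x - \<mu>) \<bullet> (c - x)"
    proof -
      have "\<bar>(\<nu> x - \<mu>) \<bullet> (c - x)\<bar> \<le> norm (\<nu> x - \<mu>) * norm (c - x)" by (rule Cauchy_Schwarz_ineq2)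
      also have "\<dots> \<le> ?\<epsilon> * R" using d1(2)[of x] nx h3 x by (intro mult_mono) (auto simp: dist_norm)
      finally show ?thesis by linarith
    qed
    have "\<nu> x \<bullet> (c - x) = h * (norm \<mu>)\<^sup>2 - \<mu> \<bullet> (x - z) + (\<nu> x - \<mu>) \<bullet> (c - x)"
      by (simp add: c_def inner_diff_left inner_diff_right inner_add_right dot_square_norm algebra_simps)
    moreover have "?\<epsilon> * (3 * (h * norm \<mu>)) = 3 / 14 * (h * (norm \<mu>)\<^sup>2)" "?\<epsilon> * R = 2 / 14 * (h * (norm \<mu>)\<^sup>2)"
      by (simp_all add: R_def power2_eq_square)
    moreover have "0 \<le> h * (norm \<mu>)\<^sup>2" using h by simp
    ultimately show ?thesis using a1 a2 unfolding \<kappa>_def by linarith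
  qed
  show thesis
  proof (rule that)
    show "0 < R" by (rule R)
    show "z \<in> ball c R" using h \<mu> by (simp add: c_def R_def dist_norm)
    show "c \<notin> frontier \<Omega>"
    proof
      assume "c \<in> frontier \<Omega>"
      moreover have "c \<in> cball c R" using R by simp
      ultimately have "y c = 0" "\<kappa> - y c \<le> 0" using y0[of c] inball[of c] flux[of c] by simp_all
      then show False using \<kappa> by simp
    qed
    show "good_ball c R"
      unfolding good_ball_def
    proof (intro allI impI)
      fix n v g assume v: "H1 \<Omega> v g" "\<forall>x\<in>\<Omega>. 0 \<le> v x"
      \<comment> \<open>The index is shifted so that already the first cutoff varies only where y <
        2 / M < \<open>\<kappa>\<close>, that is, inside the layer with the right sign of the
        flux.\<close>
      obtain m0 :: nat where m0: "2 / \<kappa> < m0" using reals_Archimedean2 by blast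
      define M where "M m = real (m + m0 + 1)" for m :: nat
      have M: "M m > 0" "2 / M m < \<kappa>" for m
      proof -
        show *: "M m > 0" by (simp add: M_def)
        have "2 / \<kappa> < M m" using m0 by (simp add: M_def)
        then show "2 / M m < \<kappa>" using \<kappa> * by (simp add: divide_less_eq mult.commute)
      qed
      define P where "P s = (max 0 s) ^ 2" for s :: real
      have P': "(P has_real_derivative 2 * max 0 s) (at s)" for s
        using pos_part_power_has_derivative[of 0 s] by (simp add: P_def[abs_def] numeral_2_eq_2)
      have cP: "continuous_on UNIV P" unfolding P_def[abs_def] by (intro continuous_intros)
      \<comment> \<open>A C^1 step function, 0 up to 1 and equal to 1 from 2 on, composed of squared
        positive parts.\<close>
      define \<theta> where "\<theta> s = 1 - P (1 - P (s - 1))" for s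
      define \<theta>' where "\<theta>' s = 2 * max 0 (1 - P (s - 1)) * (2 * max 0 (s - 1))" for s
      have \<theta>'_: "(\<theta> has_real_derivative \<theta>' s) (at s)" for s
        unfolding \<theta>_def[abs_def] \<theta>'_def
        by (rule derivative_eq_intros DERIV_chain2[OF P'] refl)+ simp
      have \<theta>0: "\<theta> s = 0" if "s \<le> 1" for s using that by (simp add: \<theta>_def P_def)
      have P1: "1 \<le> P (s - 1)" if "2 \<le> s" for s using that by (simp add: P_def one_le_power)
      have \<theta>1: "\<theta> s = 1" "\<theta>' s = 0" if "2 \<le> s" for s
        using P1[OF that] by (simp_all add: \<theta>_def \<theta>'_def P_def[of "1 - P (s - 1)"])
      have \<theta>'_nn: "0 \<le> \<theta>' s" for s by (simp add: \<theta>'_def)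
      have \<theta>01: "0 \<le> \<theta> s" "\<theta> s \<le> 1" for s
      proof -
        have "0 \<le> P t" for t by (simp add: P_def)
        then show "\<theta> s \<le> 1" by (simp add: \<theta>_def)
        have "max 0 (1 - P (s - 1)) \<le> 1" using \<open>0 \<le> P (s - 1)\<close> by simp
        then have "P (1 - P (s - 1)) \<le> 1" unfolding P_def[of "1 - P (s - 1)"] by (intro power_le_one) auto
        then show "0 \<le> \<theta> s" by (simp add: \<theta>_def)
      qed
      have c\<theta>': "continuous_on UNIV \<theta>'"
        unfolding \<theta>'_def[abs_def] by (intro continuous_intros continuous_on_compose2[OF cP]) auto
      show "(LINT x|M\<^sub>\<Omega>. barrier_grad n c R x \<bullet> g x) \<le> - (LINT x|M\<^sub>\<Omega>. barrier_lap n c R x * v x)"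
        unfolding barrier_lap_eq_div[symmetric]
      proof (rule weak_flux_nonpos[where X = "barrier_grad n c R" and D = "barrier_hessian n c R" and \<eta> = "\<lambda>m x. \<theta> (M m * y x)" and E = "\<lambda>m x. (\<theta>' (M m * y x) * M m) *\<^sub>R \<nu> x"])
        show "((\<lambda>x. \<theta> (M m * y x)) has_derivative (\<lambda>h. ((\<theta>' (M m * y x) * M m) *\<^sub>R \<nu> x) \<bullet> h)) (at x)" for m x
          using DERIV_compose_FDERIV[OF \<theta>'_ has_derivative_mult_right[OF y'], of "M m" x]
          by (rule has_derivative_eq_rhs) (simp add: fun_eq_iff)
        show "continuous_on UNIV (\<lambda>x. (\<theta>' (M m * y x) * M m) *\<^sub>R \<nu> x)" for m
          by (intro continuous_intros c\<nu> continuous_on_compose2[OF c\<theta>'] cy) auto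
        show "(\<lambda>m. \<theta> (M m * y x)) \<longlonglongrightarrow> 1 \<or> barrier_grad n c R x = 0 \<and> (\<forall>i. barrier_hessian n c R i x = 0)"
          if "x \<in> \<Omega>" for x
        proof (cases "x \<in> ball c R")
          case True
          then have "0 < y x" using mem[of x] inball[of x] that by simp
          obtain m1 :: nat where m1: "2 / y x < m1" using reals_Archimedean2 by blast
          have "\<theta> (M m * y x) = 1" if "m \<ge> m1" for m
          proof (rule \<theta>1(1))
            have "2 / y x < M m" using m1 that by (simp add: M_def)
            then show "2 \<le> M m * y x" using \<open>0 < y x\<close> by (simp add: divide_less_eq less_imp_le)
          qed
          then have "\<forall>\<^sub>F m in sequentially. \<theta> (M m * y x) = 1" unfolding eventually_sequentially by blast
          then show ?thesis by (simp add: tendsto_eventually)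
        next
          case False
          then show ?thesis using radial_pos_eq_0[of R x c] R by (simp add: barrier_grad_def barrier_hessian_def)
        qed
        show "\<exists>C. compact C \<and> C \<subseteq> \<Omega> \<and> (\<forall>x. x \<notin> C \<longrightarrow> \<theta> (M m * y x) *\<^sub>R barrier_grad n c R x = 0)" for m
        proof (intro exI conjI allI impI)
          have "compact (cball c R \<inter> {x. 1 \<le> M m * y x})"
            by (intro compact_Int_closed compact_cball closed_Collect_le continuous_intros cy)
          then show "compact (cball c R \<inter> {x. 1 \<le> M m * y x})" .
          show "cball c R \<inter> {x. 1 \<le> M m * y x} \<subseteq> \<Omega>"
          proof
            fix x assume x: "x \<in> cball c R \<inter> {x. 1 \<le> M m * y x}"
            then have "0 < M m * y x" by simp
            then have "0 < y x" using M(1)[of m] by (simp add: zero_less_mult_iff)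
            then show "x \<in> \<Omega>" using mem inball x by blast
          qed
          fix x assume "x \<notin> cball c R \<inter> {x. 1 \<le> M m * y x}"
          then consider "x \<notin> cball c R" | "M m * y x \<le> 1" by force
          then show "\<theta> (M m * y x) *\<^sub>R barrier_grad n c R x = 0"
          proof cases
            case 1
            then show ?thesis using radial_pos_eq_0[of R x c] R by (simp add: barrier_grad_def)
          qed (simp add: \<theta>0)
        qed
        show "0 \<le> ((\<theta>' (M m * y x) * M m) *\<^sub>R \<nu> x) \<bullet> barrier_grad n c R x" if "x \<in> \<Omega>" for m x
        proof (cases "x \<in> ball c R \<and> M m * y x < 2")
          case False
          then show ?thesis using radial_pos_eq_0[of R x c] R \<theta>1(2)[of "M m * y x"] by (auto simp: barrier_grad_def)
        next
          case True
          then have "y x < 2 / M m" using M(1)[of m] by (simp add: less_divide_eq mult.commute)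
          then have "y x < \<kappa>" using M(2)[of m] by linarith
          then have "0 \<le> \<nu> x \<bullet> (c - x)" using flux[of x] True by simp
          then have "0 \<le> (\<theta>' (M m * y x) * M m) * (2 * real (n + 3) * radial_pos c R x ^ (n + 2)) * (\<nu> x \<bullet> (c - x))"
            using \<theta>'_nn M(1)[of m] radial_pos_nonneg[of c R x] by (intro mult_nonneg_nonneg) auto
          then show ?thesis by (simp add: barrier_grad_def inner_diff_right algebra_simps)
        qed
      qed (use v \<theta>01 in \<open>auto intro!: barrier_grad_has_derivative continuous_barrier_hessian\<close>)
    qed
  qed
qed

end

section \<open>Strict positivity of the Neumann heat semigroup\<close>

locale neumann_heat = bounded_open_set \<Omega> for \<Omega> :: "(real ^ 'd) set" +
  fixes \<kappa> :: real and S :: "real \<Rightarrow> (real ^ 'd \<Rightarrow> real) \<Rightarrow> real ^ 'd \<Rightarrow> real"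
  assumes \<Omega>_nonempty: "\<Omega> \<noteq> {}" and \<kappa>_pos: "0 < \<kappa>" and heat_semigroup: "neumann_heat_semigroup \<Omega> \<kappa> S"
begin

lemma heat_generator:
  "continuous_on (closure \<Omega>) u \<Longrightarrow> continuous_on (closure \<Omega>) f \<Longrightarrow>
    generator (closure \<Omega>) S u (\<lambda>x. \<kappa> * f x) \<longleftrightarrow> neumann_laplacian \<Omega> u f"
  using heat_semigroup unfolding neumann_heat_semigroup_def by simp

sublocale markov_semigroup "closure \<Omega>" S
proof
  show "compact (closure \<Omega>)" by (rule compact_closure_\<Omega>)
  show "closure \<Omega> \<noteq> {}" using \<Omega>_nonempty by simp
  show "contraction_semigroup (closure \<Omega>) S" using heat_semigroup by (simp add: neumann_heat_semigroup_def)
  have "generator (closure \<Omega>) S (\<lambda>x. 1) (\<lambda>x. \<kappa> * 0) \<longleftrightarrow> neumann_laplacian \<Omega> (\<lambda>x. 1) (\<lambda>x. 0)"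
    by (rule heat_generator) (rule continuous_on_const)+
  then show "generator (closure \<Omega>) S (\<lambda>x. 1) (\<lambda>x. 0)" using neumann_laplacian_const by simp
qed

section \<open>The L^2 pairing and the symmetry of the semigroup\<close>

definition ip :: "(real ^ 'd \<Rightarrow> real) \<Rightarrow> (real ^ 'd \<Rightarrow> real) \<Rightarrow> real" where
  "ip u v = (LINT x|M\<^sub>\<Omega>. u x * v x)"

definition vol :: real where
  "vol = (LINT x|M\<^sub>\<Omega>. 1)"

lemma ip_integrable: "C u \<Longrightarrow> C v \<Longrightarrow> integrable M\<^sub>\<Omega> (\<lambda>x. u x * v x)"
  by (intro integrable_continuous_closure continuous_intros)

lemma ip_commute: "ip u v = ip v u"
  by (simp add: ip_def mult.commute)

lemma ip_cong: "(\<And>x. x \<in> closure \<Omega> \<Longrightarrow> u x = u' x) \<Longrightarrow> (\<And>x. x \<in> closure \<Omega> \<Longrightarrow> v x = v' x) \<Longrightarrow> ip u v = ip u' v'"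
  unfolding ip_def by (intro Bochner_Integration.integral_cong refl) (simp add: subsetD[OF closure_subset])

lemma ip_diff_left: "C u \<Longrightarrow> C v \<Longrightarrow> C w \<Longrightarrow> ip (\<lambda>x. u x - v x) w = ip u w - ip v w"
  unfolding ip_def by (simp add: left_diff_distrib ip_integrable)

lemma ip_diff_right: "C u \<Longrightarrow> C v \<Longrightarrow> C w \<Longrightarrow> ip w (\<lambda>x. u x - v x) = ip w u - ip w v"
  using ip_diff_left by (simp add: ip_commute)

lemma ip_cmult_left: "ip (\<lambda>x. a * u x) v = a * ip u v"
  unfolding ip_def by (simp add: mult.assoc)

lemma ip_cmult_right: "ip u (\<lambda>x. a * v x) = a * ip u v"
  using ip_cmult_left by (simp add: ip_commute)

lemma ip_sum_left:
  fixes N :: nat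
  shows "(\<And>k. C (u k)) \<Longrightarrow> C v \<Longrightarrow> ip (\<lambda>x. \<Sum>k<N. a * u k x) v = (\<Sum>k<N. a * ip (u k) v)"
  unfolding ip_def by (simp add: sum_distrib_right mult.assoc ip_integrable Bochner_Integration.integral_sum)

lemma vol_nonneg: "0 \<le> vol"
  unfolding vol_def by (rule Bochner_Integration.integral_nonneg) simp

lemma ip_bound:
  assumes "C u" "C v" "\<And>x. x \<in> closure \<Omega> \<Longrightarrow> \<bar>u x\<bar> \<le> A" "\<And>x. x \<in> closure \<Omega> \<Longrightarrow> \<bar>v x\<bar> \<le> B"
  shows "\<bar>ip u v\<bar> \<le> A * B * vol"
proof -
  have "\<bar>ip u v\<bar> \<le> (LINT x|M\<^sub>\<Omega>. \<bar>u x * v x\<bar>)" unfolding ip_def by (rule integral_abs_bound)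
  also have "\<dots> \<le> (LINT x|M\<^sub>\<Omega>. A * B * 1)"
  proof (rule integral_mono)
    show "integrable M\<^sub>\<Omega> (\<lambda>x. \<bar>u x * v x\<bar>)" using ip_integrable[OF assms(1,2)] by simp
    show "integrable M\<^sub>\<Omega> (\<lambda>x. A * B * 1)" by (rule integrable_const_\<Omega>)
    fix x assume "x \<in> space M\<^sub>\<Omega>"
    then have x: "x \<in> closure \<Omega>" using subsetD[OF closure_subset] by auto
    have "0 \<le> A" using assms(3)[OF x] by (rule order_trans[OF abs_ge_zero])
    then show "\<bar>u x * v x\<bar> \<le> A * B * 1" unfolding abs_mult mult_1_right
      using assms(3)[OF x] assms(4)[OF x] by (intro mult_mono) auto
  qed
  also have "\<dots> = A * B * vol" unfolding vol_def by (rule integral_mult_right_zero)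
  finally show ?thesis .
qed

text \<open>The bridge from the semigroup to the form: an orbit integral lies in the domain of the
  generator, hence in that of \<kappa> times the Neumann Laplacian, with image S t u - u.\<close>

lemma orbit_integral_weak:
  assumes "C u" "0 \<le> t"
  obtains g where "H1 \<Omega> (orbit_integral t u) g"
    "\<And>v w. H1 \<Omega> v w \<Longrightarrow> \<kappa> * (LINT x|M\<^sub>\<Omega>. g x \<bullet> w x) = - ip (\<lambda>x. S t u x - u x) v"
proof -
  let ?f = "\<lambda>x. (S t u x - u x) / \<kappa>"
  have "generator (closure \<Omega>) S (orbit_integral t u) (\<lambda>x. \<kappa> * ?f x)"
    using generator_orbit_integral[OF assms] \<kappa>_pos by simp
  moreover have "C ?f" "C (orbit_integral t u)"
    using \<kappa>_pos by (auto intro!: continuous_intros S_cont orbit_integral_cont assms)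
  ultimately have "neumann_laplacian \<Omega> (orbit_integral t u) ?f"
    using heat_generator[of "orbit_integral t u" ?f] by simp
  then obtain g where g: "H1 \<Omega> (orbit_integral t u) g"
    "\<And>v w. H1 \<Omega> v w \<Longrightarrow> (LINT x|M\<^sub>\<Omega>. g x \<bullet> w x) = - (LINT x|M\<^sub>\<Omega>. ?f x * v x)"
    unfolding neumann_laplacian_def by blast
  have "\<kappa> * (LINT x|M\<^sub>\<Omega>. g x \<bullet> w x) = - ip (\<lambda>x. S t u x - u x) v" if "H1 \<Omega> v w" for v w
  proof -
    have "(\<lambda>x. ?f x * v x) = (\<lambda>x. (1 / \<kappa>) * ((S t u x - u x) * v x))" by simp
    then have "(LINT x|M\<^sub>\<Omega>. ?f x * v x) = (1 / \<kappa>) * ip (\<lambda>x. S t u x - u x) v"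
      unfolding ip_def by (simp only: integral_mult_right_zero)
    then show ?thesis using g(2)[OF that] \<kappa>_pos by simp
  qed
  with g(1) show thesis by (rule that)
qed

text \<open>Each of the two orbit integrals serves as test function for the other; both sides are -
  \<kappa> times the same symmetric form.\<close>

lemma orbit_integral_symmetric_increment:
  assumes "C u" "C v" "0 \<le> s" "0 \<le> t"
  shows "ip (\<lambda>x. S s u x - u x) (orbit_integral t v) = ip (orbit_integral s u) (\<lambda>x. S t v x - v x)"
proof -
  obtain g where g: "H1 \<Omega> (orbit_integral s u) g"
    "\<And>v w. H1 \<Omega> v w \<Longrightarrow> \<kappa> * (LINT x|M\<^sub>\<Omega>. g x \<bullet> w x) = - ip (\<lambda>x. S s u x - u x) v"
    using orbit_integral_weak[OF assms(1,3)] by blast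
  obtain h where h: "H1 \<Omega> (orbit_integral t v) h"
    "\<And>u w. H1 \<Omega> u w \<Longrightarrow> \<kappa> * (LINT x|M\<^sub>\<Omega>. h x \<bullet> w x) = - ip (\<lambda>x. S t v x - v x) u"
    using orbit_integral_weak[OF assms(2,4)] by blast
  show ?thesis using g(2)[OF h(1)] h(2)[OF g(1)] by (simp add: inner_commute ip_commute)
qed

text \<open>
  On orbits that are Lipschitz in time the defect of symmetry over a time step \<open>h\<close> is of order
  \<open>h\<^sup>2\<close>, so it disappears after summation over a partition.
\<close>

definition Lipschitz_orbit :: "real \<Rightarrow> (real ^ 'd \<Rightarrow> real) \<Rightarrow> bool" where
  "Lipschitz_orbit L u \<longleftrightarrow> C u \<and> (\<forall>s\<ge>0. \<forall>x\<in>closure \<Omega>. \<bar>S s u x - u x\<bar> \<le> L * s)"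

lemma Lipschitz_orbit_nonneg: "Lipschitz_orbit L u \<Longrightarrow> 0 \<le> L"
proof -
  assume "Lipschitz_orbit L u"
  moreover obtain x where "x \<in> closure \<Omega>" using K_nonempty by (metis all_not_in_conv)
  ultimately have "\<bar>S 1 u x - u x\<bar> \<le> L * 1" unfolding Lipschitz_orbit_def using zero_le_one by blast
  then show ?thesis by linarith
qed

lemma Lipschitz_orbit_S:
  assumes "Lipschitz_orbit L u" "0 \<le> t"
  shows "Lipschitz_orbit L (S t u)"
  unfolding Lipschitz_orbit_def
proof (intro conjI allI impI ballI)
  have Cu: "C u" using assms(1) by (simp add: Lipschitz_orbit_def)
  show "C (S t u)" by (rule S_cont[OF assms(2) Cu])
  fix s x assume s: "0 \<le> (s :: real)" and x: "x \<in> closure \<Omega>"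
  have "\<bar>S (t + s) u x - S t u x\<bar> \<le> L * s"
    by (rule S_increment_bound[OF Cu assms(2) s _ x]) (use assms(1) s in \<open>auto simp: Lipschitz_orbit_def\<close>)
  then show "\<bar>S s (S t u) x - S t u x\<bar> \<le> L * s"
    using S_semigroup[OF s assms(2) Cu x] by (simp add: add.commute)
qed

text \<open>With the time means (1/h) \<open>orbit_integral h\<close> in place of \<open>u\<close>
  and \<open>v\<close> in the unincremented slots the identity is exact. The error of the
  replacement and the increment by which it is multiplied are both at most L h.\<close>

lemma symmetry_defect:
  assumes u: "Lipschitz_orbit L u" and v: "Lipschitz_orbit L v" and h: "0 < h"
  shows "\<bar>ip (S h u) v - ip u (S h v)\<bar> \<le> 2 * (L * h) * (L * h) * vol"
proof -
  have Cu: "C u" "C v" "C (S h u)" "C (S h v)" using u v h by (auto simp: Lipschitz_orbit_def intro!: S_cont)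
  note L = Lipschitz_orbit_nonneg[OF u]
  have CI: "C (orbit_integral h u)" "C (orbit_integral h v)" by (intro orbit_integral_cont Cu)+
  have near: "\<bar>w x - (1 / h) * orbit_integral h w x\<bar> \<le> L * h" if "Lipschitz_orbit L w" "x \<in> closure \<Omega>" for w x
  proof -
    have "\<bar>orbit_integral h w x - h * w x\<bar> \<le> (L * h) * h"
    proof (rule orbit_integral_near)
      show "\<bar>S s w x - w x\<bar> \<le> L * h" if "0 \<le> s" "s \<le> h" "x \<in> closure \<Omega>" for s x
      proof -
        have "\<bar>S s w x - w x\<bar> \<le> L * s" using \<open>Lipschitz_orbit L w\<close> that by (auto simp: Lipschitz_orbit_def)
        also have "\<dots> \<le> L * h" using L that by (intro mult_left_mono)
        finally show ?thesis .
      qed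
    qed (use that h in \<open>auto simp: Lipschitz_orbit_def\<close>)
    then have "\<bar>orbit_integral h w x - h * w x\<bar> / h \<le> L * h" using h by (simp add: divide_le_eq)
    moreover have "\<bar>w x - (1 / h) * orbit_integral h w x\<bar> = \<bar>orbit_integral h w x - h * w x\<bar> / h"
    proof -
      have e: "w x - (1 / h) * orbit_integral h w x = - ((orbit_integral h w x - h * w x) / h)"
        using h by (simp add: field_simps)
      show ?thesis unfolding e abs_minus_cancel abs_divide using h by simp
    qed
    ultimately show ?thesis by simp
  qed
  have 1: "\<bar>ip (\<lambda>x. S h u x - u x) (\<lambda>x. v x - (1 / h) * orbit_integral h v x)\<bar> \<le> (L * h) * (L * h) * vol"
    by (rule ip_bound) (use u v h near in \<open>auto simp: Lipschitz_orbit_def intro!: continuous_intros Cu CI\<close>)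
  have 2: "\<bar>ip (\<lambda>x. u x - (1 / h) * orbit_integral h u x) (\<lambda>x. S h v x - v x)\<bar> \<le> (L * h) * (L * h) * vol"
    by (rule ip_bound) (use u v h near in \<open>auto simp: Lipschitz_orbit_def intro!: continuous_intros Cu CI\<close>)
  have CI': "C (\<lambda>x. (1 / h) * orbit_integral h u x)" "C (\<lambda>x. (1 / h) * orbit_integral h v x)"
    "C (\<lambda>x. S h u x - u x)" "C (\<lambda>x. S h v x - v x)"
    by (intro continuous_intros CI Cu)+
  have "ip (S h u) v - ip u (S h v) = ip (\<lambda>x. S h u x - u x) v - ip u (\<lambda>x. S h v x - v x)"
    using Cu by (simp add: ip_diff_left ip_diff_right)
  also have "\<dots> = ip (\<lambda>x. S h u x - u x) (\<lambda>x. v x - (1 / h) * orbit_integral h v x)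
      - ip (\<lambda>x. u x - (1 / h) * orbit_integral h u x) (\<lambda>x. S h v x - v x)"
    unfolding ip_diff_right[OF Cu(2) CI'(2) CI'(3)] ip_diff_left[OF Cu(1) CI'(1) CI'(4)] ip_cmult_left ip_cmult_right
    using orbit_integral_symmetric_increment[OF Cu(1,2), of h h] h by simp
  finally show ?thesis using 1 2 by simp
qed

lemma ip_S_symmetric_Lipschitz:
  assumes u: "Lipschitz_orbit L u" and v: "Lipschitz_orbit L v" and T: "0 \<le> T"
  shows "ip (S T u) v = ip u (S T v)"
proof (cases "T = 0")
  case True
  then show ?thesis using u v by (auto simp: Lipschitz_orbit_def S_zero intro!: ip_cong)
next
  case False
  with T have T: "0 < T" by simp
  note L = Lipschitz_orbit_nonneg[OF u]
  have Cu: "C u" "C v" using u v by (auto simp: Lipschitz_orbit_def)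
  let ?B = "2 * L * L * vol * T * T"
  have key: "\<bar>ip (S T u) v - ip u (S T v)\<bar> \<le> ?B / N" if N: "N > 0" for N :: nat
  proof -
    define h where "h = T / N"
    have h: "0 < h" "real N * h = T" using N T by (auto simp: h_def)
    \<comment> \<open>Telescoping: the time T is moved from v to u in N steps of length h. Each step
      has a defect of order 1 / N^2, so the total is of order 1 / N.\<close>
    define j where "j k = ip (S (real k * h) u) (S (real (N - k) * h) v)" for k
    have step: "\<bar>j (Suc k) - j k\<bar> \<le> 2 * (L * h) * (L * h) * vol" if k: "k < N" for k
    proof -
      let ?a = "S (real k * h) u" and ?b = "S (real (N - Suc k) * h) v"
      have ab: "Lipschitz_orbit L ?a" "Lipschitz_orbit L ?b"
        using h by (auto intro!: Lipschitz_orbit_S u v)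
      have "j (Suc k) = ip (S h ?a) ?b"
        unfolding j_def
      proof (rule ip_cong)
        fix x assume x: "x \<in> closure \<Omega>"
        have "real (Suc k) * h = h + real k * h" by (simp add: distrib_right)
        then show "S (real (Suc k) * h) u x = S h ?a x" using h S_semigroup[OF _ _ Cu(1) x, of h "real k * h"] by simp
      qed simp
      moreover have "j k = ip ?a (S h ?b)"
        unfolding j_def
      proof (rule ip_cong)
        fix x assume x: "x \<in> closure \<Omega>"
        have "N - k = Suc (N - Suc k)" using k by simp
        then have "real (N - k) * h = h + real (N - Suc k) * h" by (simp only: of_nat_Suc distrib_right mult_1)
        moreover have "S (h + real (N - Suc k) * h) v x = S h ?b x" using h x Cu by (intro S_semigroup) auto
        ultimately show "S (real (N - k) * h) v x = S h ?b x" by (simp only:)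
      qed simp
      ultimately show ?thesis using symmetry_defect[OF ab h(1)] by simp
    qed
    have "\<bar>j n - j 0\<bar> \<le> real n * (2 * (L * h) * (L * h) * vol)" if "n \<le> N" for n
      using that
    proof (induction n)
      case (Suc n)
      then have "\<bar>j n - j 0\<bar> \<le> real n * (2 * (L * h) * (L * h) * vol)" "\<bar>j (Suc n) - j n\<bar> \<le> 2 * (L * h) * (L * h) * vol"
        using step by auto
      moreover have "real (Suc n) * (2 * (L * h) * (L * h) * vol) = real n * (2 * (L * h) * (L * h) * vol) + 2 * (L * h) * (L * h) * vol"
        by (simp only: of_nat_Suc distrib_right mult_1 add.commute)
      ultimately show ?case by linarith
    qed simp
    from this[of N] have "\<bar>j N - j 0\<bar> \<le> real N * (2 * (L * h) * (L * h) * vol)" by simp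
    also have "\<dots> = ?B / N" using N by (simp add: h_def field_simps)
    also have "j N = ip (S T u) v" unfolding j_def h(2) by (intro ip_cong) (auto simp: S_zero Cu)
    also have "j 0 = ip u (S T v)" unfolding j_def by (intro ip_cong) (auto simp: S_zero Cu h(2))
    finally show ?thesis .
  qed
  have "(\<lambda>N. ?B / real (Suc N)) \<longlonglongrightarrow> 0" by (rule LIMSEQ_Suc[OF lim_const_over_n])
  from LIMSEQ_le_const[OF this, of "\<bar>ip (S T u) v - ip u (S T v)\<bar>"] key
  have "\<bar>ip (S T u) v - ip u (S T v)\<bar> \<le> 0" by blast
  then show ?thesis by simp
qed

text \<open>The approximant is a short time mean of the orbit. By
  \<open>orbit_integral_increment\<close> its increment over time s is (1/h) times an integral over
  length s of an orbit bounded by 2 A.\<close>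

lemma Lipschitz_orbit_approx:
  assumes u: "C u" and \<epsilon>: "0 < \<epsilon>"
  obtains L w where "Lipschitz_orbit L w" "\<And>x. x \<in> closure \<Omega> \<Longrightarrow> \<bar>w x - u x\<bar> \<le> \<epsilon>"
proof -
  obtain A where A: "\<And>x. x \<in> closure \<Omega> \<Longrightarrow> \<bar>u x\<bar> \<le> A" using C_bound[OF u] by blast
  obtain d where d: "d > 0" "\<And>h x. 0 \<le> h \<Longrightarrow> h < d \<Longrightarrow> x \<in> closure \<Omega> \<Longrightarrow> \<bar>S h u x - u x\<bar> \<le> \<epsilon>"
    using S_strong_continuity[OF u \<epsilon>] by blast
  define h where "h = d / 2"
  have h: "0 < h" "h < d" using d(1) by (auto simp: h_def)
  let ?w = "\<lambda>x. (1 / h) * orbit_integral h u x"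
  have CI: "C (orbit_integral h u)" by (rule orbit_integral_cont[OF u])
  show thesis
  proof (rule that[of "2 * A / h" ?w])
    show "Lipschitz_orbit (2 * A / h) ?w"
      unfolding Lipschitz_orbit_def
    proof (intro conjI allI impI ballI)
      show "C ?w" by (intro continuous_intros CI)
      fix s x assume s: "0 \<le> (s :: real)" and x: "x \<in> closure \<Omega>"
      let ?G = "\<lambda>y. S h u y - u y"
      have CG: "C ?G" using h by (intro continuous_intros S_cont u) auto
      have "\<bar>?G y\<bar> \<le> 2 * A" if "y \<in> closure \<Omega>" for y
        using A[OF that] S_bound[OF _ u A that, of h] h by linarith
      then have "\<bar>orbit_integral s ?G x - s * 0\<bar> \<le> 2 * A * s"
        using s x by (intro orbit_integral_near[where v = "\<lambda>x. 0"] CG) (auto intro!: S_bound CG)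
      then have "\<bar>S s (orbit_integral h u) x - orbit_integral h u x\<bar> \<le> 2 * A * s"
        using orbit_integral_increment[OF u _ s x, of h] h by simp
      moreover have "S s ?w x - ?w x = (1 / h) * (S s (orbit_integral h u) x - orbit_integral h u x)"
        using S_cmult[OF s CI x, of "1 / h"] by (simp add: right_diff_distrib)
      ultimately show "\<bar>S s ?w x - ?w x\<bar> \<le> 2 * A / h * s"
        using h by (simp add: abs_mult divide_right_mono)
    qed
    show "\<bar>?w x - u x\<bar> \<le> \<epsilon>" if x: "x \<in> closure \<Omega>" for x
    proof -
      have "\<bar>orbit_integral h u x - h * u x\<bar> \<le> \<epsilon> * h"
        using h d(2) by (intro orbit_integral_near u x) auto
      then have "\<bar>orbit_integral h u x - h * u x\<bar> / h \<le> \<epsilon>" using h by (simp add: divide_le_eq)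
      moreover have "?w x - u x = (orbit_integral h u x - h * u x) / h" using h by (simp add: field_simps)
      ultimately show ?thesis using h by simp
    qed
  qed
qed

lemma ip_S_symmetric:
  assumes u: "C u" and v: "C v" and T: "0 \<le> T"
  shows "ip (S T u) v = ip u (S T v)"
proof -
  obtain A where A: "0 \<le> A" "\<And>x. x \<in> closure \<Omega> \<Longrightarrow> \<bar>u x\<bar> \<le> A" using C_bound[OF u] by blast
  obtain B where B: "0 \<le> B" "\<And>x. x \<in> closure \<Omega> \<Longrightarrow> \<bar>v x\<bar> \<le> B" using C_bound[OF v] by blast
  let ?M = "2 * (A + B + 1) * vol"
  have M: "0 \<le> ?M" using A B vol_nonneg by simp
  have key: "\<bar>ip (S T u) v - ip u (S T v)\<bar> \<le> \<epsilon> * ?M" if \<epsilon>: "0 < \<epsilon>" "\<epsilon> \<le> 1" for \<epsilon>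
  proof -
    obtain L1 p where p: "Lipschitz_orbit L1 p" "\<And>x. x \<in> closure \<Omega> \<Longrightarrow> \<bar>p x - u x\<bar> \<le> \<epsilon>"
      using Lipschitz_orbit_approx[OF u \<epsilon>(1)] by blast
    obtain L2 q where q: "Lipschitz_orbit L2 q" "\<And>x. x \<in> closure \<Omega> \<Longrightarrow> \<bar>q x - v x\<bar> \<le> \<epsilon>"
      using Lipschitz_orbit_approx[OF v \<epsilon>(1)] by blast
    have mono: "Lipschitz_orbit (max L1 L2) w" if "Lipschitz_orbit L w" "L \<le> max L1 L2" for L w
      unfolding Lipschitz_orbit_def
    proof (intro conjI allI impI ballI)
      show "C w" using that(1) by (simp add: Lipschitz_orbit_def)
      fix s x assume "0 \<le> (s :: real)" "x \<in> closure \<Omega>"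
      then have "\<bar>S s w x - w x\<bar> \<le> L * s" "L * s \<le> max L1 L2 * s"
        using that by (auto simp: Lipschitz_orbit_def intro: mult_right_mono)
      then show "\<bar>S s w x - w x\<bar> \<le> max L1 L2 * s" by linarith
    qed
    have sym: "ip (S T p) q = ip p (S T q)"
      by (rule ip_S_symmetric_Lipschitz[OF mono[OF p(1)] mono[OF q(1)] T]) auto
    have Cp: "C p" "C q" using p q by (auto simp: Lipschitz_orbit_def)
    have *: "\<bar>ip f1 g1 - ip f2 g2\<bar> \<le> \<epsilon> * ((A + B + 1) * vol)"
      if f: "C f1" "C f2" "\<And>x. x \<in> closure \<Omega> \<Longrightarrow> \<bar>f1 x - f2 x\<bar> \<le> \<epsilon>" "\<And>x. x \<in> closure \<Omega> \<Longrightarrow> \<bar>f1 x\<bar> \<le> A"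
        and g: "C g1" "C g2" "\<And>x. x \<in> closure \<Omega> \<Longrightarrow> \<bar>g1 x - g2 x\<bar> \<le> \<epsilon>" "\<And>x. x \<in> closure \<Omega> \<Longrightarrow> \<bar>g1 x\<bar> \<le> B"
      for f1 f2 g1 g2
    proof -
      have "\<bar>g2 x\<bar> \<le> B + 1" if "x \<in> closure \<Omega>" for x using g(3,4)[OF that] \<epsilon> by linarith
      then have "\<bar>ip (\<lambda>x. f1 x - f2 x) g2\<bar> \<le> \<epsilon> * (B + 1) * vol"
        by (intro ip_bound continuous_intros f g)
      moreover have "\<bar>ip f1 (\<lambda>x. g1 x - g2 x)\<bar> \<le> A * \<epsilon> * vol"
        by (intro ip_bound continuous_intros f g)
      moreover have "ip f1 g1 - ip f2 g2 = ip f1 (\<lambda>x. g1 x - g2 x) + ip (\<lambda>x. f1 x - f2 x) g2"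
        using f g by (simp add: ip_diff_left ip_diff_right)
      ultimately have "\<bar>ip f1 g1 - ip f2 g2\<bar> \<le> A * \<epsilon> * vol + \<epsilon> * (B + 1) * vol" by linarith
      then show ?thesis by (simp add: algebra_simps)
    qed
    have "\<bar>ip (S T u) v - ip (S T p) q\<bar> \<le> \<epsilon> * ((A + B + 1) * vol)"
      using p(2) q(2) A B T
      by (intro * S_cont u v Cp S_diff_bound S_bound[OF T u]) (auto simp: abs_minus_commute)
    moreover have "\<bar>ip u (S T v) - ip p (S T q)\<bar> \<le> \<epsilon> * ((A + B + 1) * vol)"
      using p(2) q(2) A B T
      by (intro * S_cont u v Cp S_diff_bound S_bound[OF T v]) (auto simp: abs_minus_commute)
    ultimately have "\<bar>ip (S T u) v - ip u (S T v)\<bar> \<le> \<epsilon> * ((A + B + 1) * vol) + \<epsilon> * ((A + B + 1) * vol)"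
      using sym by linarith
    then show ?thesis by (simp add: algebra_simps)
  qed
  have "\<bar>ip (S T u) v - ip u (S T v)\<bar> \<le> 0 + e" if "0 < e" for e
  proof -
    define \<epsilon> where "\<epsilon> = min 1 (e / (?M + 1))"
    have \<epsilon>: "0 < \<epsilon>" "\<epsilon> \<le> 1" "\<epsilon> \<le> e / (?M + 1)" using that M by (auto simp: \<epsilon>_def)
    have "\<epsilon> * ?M \<le> e / (?M + 1) * ?M" using \<epsilon>(3) M by (rule mult_right_mono)
    also have "\<dots> \<le> e" using that M by (simp add: divide_le_eq)
    finally show ?thesis using key[OF \<epsilon>(1,2)] by linarith
  qed
  then have "\<bar>ip (S T u) v - ip u (S T v)\<bar> \<le> 0" by (rule field_le_epsilon)
  then show ?thesis by simp
qed

end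

context neumann_heat
begin

text \<open>Uniform Riemann sums do the work of Fubini's theorem.\<close>

lemma ip_orbit_integral_symmetric:
  assumes u: "C u" and v: "C v" and t: "0 \<le> t"
  shows "ip (orbit_integral t u) v = ip u (orbit_integral t v)"
proof -
  obtain A where A: "0 \<le> A" "\<And>x. x \<in> closure \<Omega> \<Longrightarrow> \<bar>u x\<bar> \<le> A" using C_bound[OF u] by blast
  obtain B where B: "0 \<le> B" "\<And>x. x \<in> closure \<Omega> \<Longrightarrow> \<bar>v x\<bar> \<le> B" using C_bound[OF v] by blast
  have M: "0 \<le> (A + B) * vol" using A B vol_nonneg by simp
  have "\<bar>ip (orbit_integral t u) v - ip u (orbit_integral t v)\<bar> \<le> 0 + e" if e: "0 < e" for e
  proof -
    define \<epsilon> where "\<epsilon> = e / ((A + B) * vol + 1)"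
    have \<epsilon>: "0 < \<epsilon>" using e M by (simp add: \<epsilon>_def)
    from eventually_conj[OF joint_riemann_sum[OF orbit_joint[OF u] compact_K t \<epsilon>] joint_riemann_sum[OF orbit_joint[OF v] compact_K t \<epsilon>]]
    obtain N :: nat where N: "\<And>x. x \<in> closure \<Omega> \<Longrightarrow> \<bar>orbit_integral t u x - (\<Sum>k<N. (t / real N) * S (real k * (t / real N)) u x)\<bar> \<le> \<epsilon>"
      "\<And>x. x \<in> closure \<Omega> \<Longrightarrow> \<bar>orbit_integral t v x - (\<Sum>k<N. (t / real N) * S (real k * (t / real N)) v x)\<bar> \<le> \<epsilon>"
      unfolding eventually_sequentially orbit_integral_def by auto
    let ?h = "t / real N"
    let ?U = "\<lambda>x. \<Sum>k<N. ?h * S (real k * ?h) u x" and ?V = "\<lambda>x. \<Sum>k<N. ?h * S (real k * ?h) v x"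
    have Ck: "C (S (real k * ?h) u)" "C (S (real k * ?h) v)" for k using t by (auto intro!: S_cont u v)
    have CU: "C ?U" "C ?V" by (intro continuous_intros Ck)+
    have CI: "C (orbit_integral t u)" "C (orbit_integral t v)" by (intro orbit_integral_cont u v)+
    have "ip ?U v = ip ?V u"
      unfolding ip_sum_left[OF Ck(1) v] ip_sum_left[OF Ck(2) u]
      using t ip_S_symmetric[OF u v] by (simp add: ip_commute)
    moreover have "\<bar>ip (\<lambda>x. orbit_integral t u x - ?U x) v\<bar> \<le> \<epsilon> * B * vol"
      by (intro ip_bound continuous_on_diff CI CU v N B)
    moreover have "\<bar>ip (\<lambda>x. orbit_integral t v x - ?V x) u\<bar> \<le> \<epsilon> * A * vol"
      by (intro ip_bound continuous_on_diff CI CU u N A)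
    ultimately have "\<bar>ip (orbit_integral t u) v - ip u (orbit_integral t v)\<bar> \<le> \<epsilon> * B * vol + \<epsilon> * A * vol"
      unfolding ip_diff_left[OF CI(1) CU(1) v] ip_diff_left[OF CI(2) CU(2) u] ip_commute[of u "orbit_integral t v"]
      by linarith
    also have "\<dots> = \<epsilon> * ((A + B) * vol)" by (simp add: algebra_simps)
    also have "\<dots> \<le> e" unfolding \<epsilon>_def using e M by (simp add: divide_le_eq)
    finally show ?thesis by simp
  qed
  then have "\<bar>ip (orbit_integral t u) v - ip u (orbit_integral t v)\<bar> \<le> 0" by (rule field_le_epsilon)
  then show ?thesis by simp
qed

section \<open>Comparison with barriers\<close>

lemma continuous_integral_0_imp_0:
  assumes h: "C h" "\<And>x. x \<in> \<Omega> \<Longrightarrow> 0 \<le> h x" and 0: "(LINT x|M\<^sub>\<Omega>. h x) = 0" and x: "x \<in> \<Omega>"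
  shows "h x = 0"
proof (rule ccontr)
  assume nz: "h x \<noteq> 0"
  have "AE x in M\<^sub>\<Omega>. 0 \<le> h x" by (rule AE_I2) (use h(2) in simp)
  then have "AE x in M\<^sub>\<Omega>. h x = 0"
    using 0 integral_nonneg_eq_0_iff_AE[OF integrable_continuous_closure[OF h(1)]] by simp
  then have "AE x in lebesgue. x \<in> \<Omega> \<longrightarrow> h x = 0"
    by (simp add: AE_restrict_space_iff)
  then have neg: "negligible {x. \<not> (x \<in> \<Omega> \<longrightarrow> h x = 0)}"
    using AE_iff_null_sets negligible_iff_null_sets eventually_ae_filter_negligible by (metis (no_types, lifting) negligible_subset mem_Collect_eq subsetI)
  have "open (\<Omega> \<inter> h -` (- {0}))"
    using continuous_on_subset[OF h(1) closure_subset] open_\<Omega> by (intro continuous_open_preimage) auto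
  moreover have "x \<in> \<Omega> \<inter> h -` (- {0})" using nz x by simp
  moreover have "\<Omega> \<inter> h -` (- {0}) = {x. \<not> (x \<in> \<Omega> \<longrightarrow> h x = 0)}" by auto
  ultimately show False using open_not_negligible neg by (metis empty_iff)
qed

text \<open>The barrier need not lie in the domain of the generator, so the defect \<open>q\<close>
  is examined by duality. Its negative part g gives the nonnegative \<open>H1\<close> function
  \<open>orbit_integral t g\<close>, which may be inserted into \<open>good_ball\<close>; symmetry
  moves the semigroup back to the barrier and yields that the pairing of q with g is nonnegative. As
  that pairing is minus the integral of g^2, g vanishes.\<close>

lemma barrier_comparison:
  assumes gb: "good_ball a R" and t: "0 \<le> t" and x: "x \<in> closure \<Omega>"
  shows "barrier n a R x + \<kappa> * orbit_integral t (barrier_lap n a R) x \<le> S t (barrier n a R) x"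
proof -
  let ?w = "barrier n a R" and ?f = "barrier_lap n a R"
  have Cw: "C ?w" and Cf: "C ?f" by (rule continuous_barrier continuous_barrier_lap)+
  note CSw = S_cont[OF t Cw] and CIf = orbit_integral_cont[OF Cf, of t]
  define q where "q x = S t ?w x - ?w x - \<kappa> * orbit_integral t ?f x" for x
  have Cq: "C q" unfolding q_def[abs_def] by (intro continuous_intros CSw Cw CIf)
  define g where "g x = max 0 (- q x)" for x
  have Cg: "C g" unfolding g_def[abs_def] by (intro continuous_intros Cq)
  have g0: "0 \<le> g x" for x by (simp add: g_def)
  obtain G where G: "H1 \<Omega> (orbit_integral t g) G"
    "\<And>v w. H1 \<Omega> v w \<Longrightarrow> \<kappa> * (LINT x|M\<^sub>\<Omega>. G x \<bullet> w x) = - ip (\<lambda>x. S t g x - g x) v"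
    using orbit_integral_weak[OF Cg t] by blast
  have Ig: "0 \<le> orbit_integral t g x" if "x \<in> closure \<Omega>" for x
    unfolding orbit_integral_def
    by (intro Henstock_Kurzweil_Integration.integral_nonneg integrable_continuous_real orbit_continuous_time Cg that S_nonneg g0) auto
  have "H1 \<Omega> ?w (barrier_grad n a R)"
    by (rule H1_continuously_differentiable[OF barrier_has_derivative continuous_barrier_grad])
  from G(2)[OF this]
  have "ip (\<lambda>x. S t g x - g x) ?w = - (\<kappa> * (LINT x|M\<^sub>\<Omega>. barrier_grad n a R x \<bullet> G x))"
    by (simp add: inner_commute)
  moreover have "(LINT x|M\<^sub>\<Omega>. barrier_grad n a R x \<bullet> G x) \<le> - ip ?f (orbit_integral t g)"
    using gb[unfolded good_ball_def, rule_format, OF G(1)] Ig[OF subsetD[OF closure_subset]] unfolding ip_def by simp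
  then have "\<kappa> * ip ?f (orbit_integral t g) \<le> - (\<kappa> * (LINT x|M\<^sub>\<Omega>. barrier_grad n a R x \<bullet> G x))"
    using mult_left_mono[of _ "- ip ?f (orbit_integral t g)" \<kappa>] \<kappa>_pos by fastforce
  ultimately have "\<kappa> * ip ?f (orbit_integral t g) \<le> ip (\<lambda>x. S t g x - g x) ?w" by simp
  also have "\<dots> = ip (S t ?w) g - ip ?w g"
    unfolding ip_diff_left[OF S_cont[OF t Cg] Cg Cw] ip_S_symmetric[OF Cg Cw t] by (simp only: ip_commute[of g])
  finally have "0 \<le> ip (S t ?w) g - ip ?w g - \<kappa> * ip (orbit_integral t ?f) g"
    using ip_orbit_integral_symmetric[OF Cf Cg t] by simp
  also have "\<dots> = ip q g"
    unfolding q_def[abs_def] using CSw Cw CIf Cg by (simp add: ip_diff_left ip_cmult_left continuous_intros)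
  also have "\<dots> = - (LINT x|M\<^sub>\<Omega>. g x * g x)"
  proof -
    have "q x * g x = - (g x * g x)" for x by (simp add: g_def max_def)
    then show ?thesis by (simp add: ip_def)
  qed
  finally have "(LINT x|M\<^sub>\<Omega>. g x * g x) \<le> 0" by simp
  moreover have "0 \<le> (LINT x|M\<^sub>\<Omega>. g x * g x)" by (rule Bochner_Integration.integral_nonneg) simp
  ultimately have "(LINT x|M\<^sub>\<Omega>. g x * g x) = 0" by simp
  from continuous_integral_0_imp_0[OF _ _ this] have "g x * g x = 0" if "x \<in> \<Omega>" for x
    using that Cg by (simp add: continuous_intros)
  then have "0 \<le> q x" if "x \<in> \<Omega>" for x using that by (force simp: g_def max_def split: if_splits)
  with continuous_ge_on_closure[OF Cq x, of 0] have "0 \<le> q x" by blast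
  then show ?thesis by (simp add: q_def)
qed

lemma barrier_le: "barrier n a R x \<le> (R\<^sup>2) ^ (n + 3)"
  unfolding barrier_def using radial_pos_nonneg radial_pos_le by (intro power_mono)

text \<open>At distance \<beta> from the centre half of the term quadratic in n absorbs the negative
  one; this is the condition on n. The missing factor p^2 is at most R^4.\<close>

lemma barrier_lap_ge:
  fixes a x :: "real ^ 'd"
  assumes \<beta>: "0 < \<beta>" "\<beta> \<le> norm (x - a)" and R: "0 < R" and n: "real CARD('d) * R\<^sup>2 \<le> real (n + 2) * \<beta>\<^sup>2"
  shows "(real (n + 2))\<^sup>2 * (\<beta>\<^sup>2 / R ^ 4) * barrier n a R x \<le> barrier_lap n a R x"
proof -
  define p where "p = radial_pos a R x"
  define j where "j = real (n + 2)"
  have p: "0 \<le> p" "p \<le> R\<^sup>2" by (simp_all add: p_def radial_pos_nonneg radial_pos_le)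
  have j: "0 < j" "real (n + 3) = j + 1" by (simp_all add: j_def)
  have q: "\<beta>\<^sup>2 \<le> (x - a) \<bullet> (x - a)" using power_mono[OF \<beta>(2), of 2] \<beta>(1) by (simp add: dot_square_norm)
  have "real CARD('d) * p \<le> j * \<beta>\<^sup>2"
    using n unfolding j_def by (rule order_trans[OF mult_left_mono[OF p(2)] , rotated]) simp
  moreover have "2 * j * \<beta>\<^sup>2 \<le> 2 * j * ((x - a) \<bullet> (x - a))" using q j by (intro mult_left_mono) auto
  ultimately have "j * \<beta>\<^sup>2 \<le> 2 * j * ((x - a) \<bullet> (x - a)) - real CARD('d) * p" by linarith
  then have "2 * (j + 1) * p ^ (n + 1) * (j * \<beta>\<^sup>2) \<le> 2 * (j + 1) * p ^ (n + 1) * (2 * j * ((x - a) \<bullet> (x - a)) - real CARD('d) * p)"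
    using j p by (intro mult_left_mono) auto
  also have "\<dots> = barrier_lap n a R x"
    unfolding barrier_lap_def p_def[symmetric] j(2) j_def[symmetric] by (simp add: algebra_simps)
  finally have 1: "2 * (j + 1) * p ^ (n + 1) * (j * \<beta>\<^sup>2) \<le> barrier_lap n a R x" .
  have "p\<^sup>2 / R ^ 4 \<le> 1"
    using power_mono[OF p(2,1), of 2] R by (simp add: divide_le_eq flip: power_mult)
  then have "j\<^sup>2 * \<beta>\<^sup>2 * p ^ (n + 1) * (p\<^sup>2 / R ^ 4) \<le> j\<^sup>2 * \<beta>\<^sup>2 * p ^ (n + 1) * 1"
    using j p by (intro mult_left_mono) auto
  also have "\<dots> \<le> 2 * (j + 1) * p ^ (n + 1) * (j * \<beta>\<^sup>2)"
  proof -
    have "j\<^sup>2 \<le> 2 * (j + 1) * j" using j by (simp add: power2_eq_square)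
    from mult_right_mono[OF this, of "\<beta>\<^sup>2 * p ^ (n + 1)"] show ?thesis using p by (simp add: mult_ac)
  qed
  also have "j\<^sup>2 * \<beta>\<^sup>2 * p ^ (n + 1) * (p\<^sup>2 / R ^ 4) = j\<^sup>2 * (\<beta>\<^sup>2 / R ^ 4) * p ^ (n + 3)"
    by (simp add: power_add power2_eq_square power3_eq_cube)
  finally show ?thesis using 1 by (simp add: barrier_def p_def j_def)
qed

text \<open>
  If the heat started at \<open>z\<close> stays in \<open>N\<close> up to time \<open>t0\<close>, then \<open>S t w z\<close> grows at least like
  \<open>exp (const n\<^sup>2 t)\<close> for the barrier \<open>w\<close> of exponent \<open>n\<close>, whereas the ratio of the supremum of \<open>w\<close>
  to \<open>w z\<close> is only exponential in \<open>n\<close>.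
\<close>

lemma no_confinement:
  assumes gb: "good_ball a R" and R: "0 < R" and z: "z \<in> closure \<Omega>" "z \<in> ball a R"
    and \<beta>: "0 < \<beta>" "\<And>x. x \<in> N \<Longrightarrow> \<beta> \<le> norm (x - a)" and t0: "0 < t0"
    and hit: "\<And>s G. 0 < s \<Longrightarrow> s < t0 \<Longrightarrow> C G \<Longrightarrow> (\<And>x. x \<in> closure \<Omega> \<Longrightarrow> 0 \<le> G x) \<Longrightarrow>
      (\<And>x. x \<in> N \<Longrightarrow> G x = 0) \<Longrightarrow> S s G z = 0"
  shows False
proof -
  define t where "t = t0 / 2"
  have t: "0 < t" "t < t0" using t0 by (auto simp: t_def)
  define p where "p = radial_pos a R z"
  have p: "0 < p" unfolding p_def by (rule radial_pos_pos[OF z(2)])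
  define c where "c = \<kappa> * (\<beta>\<^sup>2 / R ^ 4) * t"
  have c: "0 < c" using \<kappa>_pos \<beta>(1) R t(1) by (simp add: c_def)
  define L where "L = ln (R\<^sup>2 / p)"
  \<comment> \<open>With j = n + 2 the exponential growth reads c j^2 <= (j + 1) L in logarithms, L
    being the logarithm of R^2 / p; the right side is at most 2 j L.\<close>
  have bound: "c * real (n + 2) \<le> 2 * L" if n: "real CARD('d) * R\<^sup>2 \<le> real (n + 2) * \<beta>\<^sup>2" for n
  proof -
    let ?w = "barrier n a R" and ?f = "barrier_lap n a R"
    define j where "j = real (n + 2)"
    have j: "2 \<le> j" by (simp add: j_def)
    define M where "M = j\<^sup>2 * (\<beta>\<^sup>2 / R ^ 4)"
    have M: "0 \<le> M" by (simp add: M_def R less_imp_le)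
    have Cw: "C ?w" and Cf: "C ?f" by (rule continuous_barrier continuous_barrier_lap)+
    define q where "q x = ?f x - M * ?w x" for x
    have Cq: "C q" unfolding q_def[abs_def] by (intro continuous_intros Cf Cw)
    have qN: "0 \<le> q x" if "x \<in> N" for x
      using barrier_lap_ge[OF \<beta>(1) \<beta>(2)[OF that] R n] by (simp add: q_def M_def j_def)
    have Sq: "0 \<le> S r q z" if r: "0 < r" "r < t" for r
    proof -
      \<comment> \<open>The negative part of q vanishes on \<open>N\<close>, so \<open>hit\<close>
        makes its contribution at z zero: seen from z, the barrier satisfies the favourable
        inequality everywhere.\<close>
      let ?qp = "\<lambda>x. max 0 (q x)" and ?qm = "\<lambda>x. max 0 (- q x)"
      have Cqp: "C ?qp" "C ?qm" by (intro continuous_intros Cq)+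
      have "S r (\<lambda>x. ?qp x - ?qm x) z = S r ?qp z - S r ?qm z" using r by (intro S_diff Cqp z) auto
      moreover have "(\<lambda>x. ?qp x - ?qm x) = q" by (auto simp: max_def)
      moreover have "S r ?qm z = 0" using r t qN by (intro hit Cqp) auto
      moreover have "0 \<le> S r ?qp z" using r by (intro S_nonneg Cqp z) auto
      ultimately show ?thesis by simp
    qed
    have Sq: "0 \<le> S r q z" if r: "r \<in> {0..t}" for r
    proof (rule continuous_ge_on_closure[of "{0<..<t}" "\<lambda>r. S r q z"])
      show "continuous_on (closure {0<..<t}) (\<lambda>r. S r q z)"
        using t orbit_continuous_time[OF Cq z(1), of t] by simp
      show "r \<in> closure {0<..<t}" using t r by simp
    qed (use Sq in auto)
    define m where "m s = S s ?w z" for s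
    have cm: "continuous_on {0..s} m" for s unfolding m_def by (rule orbit_continuous_time[OF Cw z(1)])
    have growth: "?w z + (\<kappa> * M) * integral {0..s} m \<le> m s" if s: "s \<in> {0..t}" for s
    proof -
      have "integral {0..s} (\<lambda>r. M * m r) \<le> integral {0..s} (\<lambda>r. S r ?f z)"
      proof (rule integral_le)
        show "(\<lambda>r. M * m r) integrable_on {0..s}" by (intro integrable_continuous_real continuous_intros cm)
        show "(\<lambda>r. S r ?f z) integrable_on {0..s}" by (intro integrable_continuous_real orbit_continuous_time Cf z)
        fix r assume r: "r \<in> {0..s}"
        have "S r q z = S r ?f z - M * m r"
          unfolding q_def[abs_def] m_def using r z Cf Cw S_diff[of r ?f "\<lambda>x. M * ?w x" z] S_cmult[of r ?w z M]
          by (simp add: continuous_intros)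
        then show "M * m r \<le> S r ?f z" using Sq[of r] r s by simp
      qed
      then have "\<kappa> * (M * integral {0..s} m) \<le> \<kappa> * orbit_integral s ?f z"
        unfolding orbit_integral_def using \<kappa>_pos by simp
      then show ?thesis using barrier_comparison[OF gb _ z(1), of s n] s by (simp add: m_def)
    qed
    \<comment> \<open>Gronwall's upper bound for - m, with a negative constant, is the exponential
      lower bound for m.\<close>
    have "- m t \<le> - ?w z * exp ((\<kappa> * M) * t)"
    proof (rule gronwall[where T = t])
      show "continuous_on {0..t} (\<lambda>s. - m s)" by (intro continuous_intros cm)
      show "- m s \<le> - ?w z + \<kappa> * M * integral {0..s} (\<lambda>s. - m s)" if "s \<in> {0..t}" for s
        using growth[OF that] by simp
    qed (use \<kappa>_pos M t in auto)
    moreover have "m t \<le> (R\<^sup>2) ^ (n + 3)"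
      unfolding m_def using t by (intro S_upper_const Cw z barrier_le) auto
    moreover have "?w z = p ^ (n + 3)" by (simp add: barrier_def p_def)
    ultimately have "p ^ (n + 3) * exp (\<kappa> * M * t) \<le> (R\<^sup>2) ^ (n + 3)" by simp
    then have "exp (\<kappa> * M * t) \<le> (R\<^sup>2 / p) ^ (n + 3)"
      using p by (simp add: power_divide le_divide_eq mult.commute)
    then have "ln (exp (\<kappa> * M * t)) \<le> ln ((R\<^sup>2 / p) ^ (n + 3))"
      using p R by (subst ln_le_cancel_iff) auto
    then have "\<kappa> * M * t \<le> real (n + 3) * L"
      using p R by (simp add: ln_realpow L_def)
    also have "real (n + 3) = j + 1" by (simp add: j_def)
    finally have "\<kappa> * M * t \<le> (j + 1) * L" .
    moreover have "\<kappa> * M * t = c * j\<^sup>2" by (simp add: M_def c_def)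
    moreover have "0 \<le> L"
      unfolding L_def using p radial_pos_le[of a R z] by (simp add: p_def)
    then have "(j + 1) * L \<le> (2 * j) * L" using j by (intro mult_right_mono) auto
    ultimately have "j * (c * j) \<le> j * (2 * L)" by (simp add: power2_eq_square mult_ac)
    then show ?thesis using j by (simp add: j_def)
  qed
  obtain n1 :: nat where n1: "real CARD('d) * R\<^sup>2 / \<beta>\<^sup>2 < n1" using reals_Archimedean2 by blast
  obtain n2 :: nat where n2: "2 * L / c < n2" using reals_Archimedean2 by blast
  have "real CARD('d) * R\<^sup>2 / \<beta>\<^sup>2 \<le> real (n1 + n2 + 2)" "2 * L / c < real (n1 + n2 + 2)" using n1 n2 by simp_all
  then have "real CARD('d) * R\<^sup>2 \<le> real (n1 + n2 + 2) * \<beta>\<^sup>2" "2 * L < c * real (n1 + n2 + 2)"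
    using \<beta>(1) c by (simp_all add: divide_le_eq divide_less_eq mult.commute)
  with bound[of "n1 + n2"] show False by linarith
qed

text \<open>Suppose S t v vanishes at z. Splitting off a last time r gives S r (S (t - r) v) z = 0
  with S (t - r) v positive off \<open>N\<close>. A nonnegative G vanishing on \<open>N\<close> is
  dominated by a multiple of it up to \<epsilon>, so S r G vanishes at z as well: the heat started
  at z stays in \<open>N\<close>, which \<open>no_confinement\<close> excludes.\<close>

lemma positivity_spreads:
  assumes v: "C v" "\<And>x. x \<in> closure \<Omega> \<Longrightarrow> 0 \<le> v x" and st: "0 \<le> s" "s < t"
    and gb: "good_ball a R" and R: "0 < R" and z: "z \<in> closure \<Omega>" "z \<in> ball a R"
    and \<beta>: "0 < \<beta>" "\<And>x. x \<in> N \<Longrightarrow> \<beta> \<le> norm (x - a)"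
    and pos: "\<And>\<sigma> x. s < \<sigma> \<Longrightarrow> \<sigma> < t \<Longrightarrow> x \<in> closure \<Omega> \<Longrightarrow> x \<notin> N \<Longrightarrow> 0 < S \<sigma> v x"
  shows "0 < S t v z"
proof (rule ccontr)
  assume "\<not> 0 < S t v z"
  moreover have "0 \<le> S t v z" using st by (intro S_nonneg v z) auto
  ultimately have Sz: "S t v z = 0" by simp
  show False
  proof (rule no_confinement[OF gb R z \<beta>, of N "t - s"])
    show "0 < t - s" using st by simp
    fix r G assume r: "0 < r" "r < t - s" and G: "C G" "\<And>x. x \<in> closure \<Omega> \<Longrightarrow> 0 \<le> G x" "\<And>x. x \<in> N \<Longrightarrow> G x = 0"
    let ?V = "S (t - r) v"
    have V: "C ?V" "\<And>x. x \<in> closure \<Omega> \<Longrightarrow> 0 \<le> ?V x" using r st by (auto intro!: S_cont S_nonneg v)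
    have "S r G z \<le> 0 + \<epsilon>" if \<epsilon>: "0 < \<epsilon>" for \<epsilon>
    proof -
      \<comment> \<open>Where G is at least \<epsilon> the point is off \<open>N\<close>; on this
        compact set S (t - r) v has a positive minimum, and elsewhere \<epsilon> alone dominates
        G.\<close>
      define D where "D = {x \<in> closure \<Omega>. \<epsilon> \<le> G x}"
      have "closedin (top_of_set (closure \<Omega>)) {x \<in> closure \<Omega>. \<epsilon> \<le> G x}"
        using continuous_closedin_preimage[OF G(1) closed_atLeast[of \<epsilon>]] by (simp add: vimage_def Int_def)
      then have cD: "compact D" unfolding D_def using closedin_compact compact_K by blast
      have VD: "0 < ?V x" if "x \<in> D" for x
        using that pos[of "t - r" x] G(3)[of x] r \<epsilon> by (auto simp: D_def)
      obtain \<delta> where \<delta>: "0 < \<delta>" "\<And>x. x \<in> D \<Longrightarrow> \<delta> \<le> ?V x"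
      proof (cases "D = {}")
        case True
        then show ?thesis using that[of 1] by simp
      next
        case False
        have "continuous_on D ?V" by (rule continuous_on_subset[OF V(1)]) (auto simp: D_def)
        from continuous_attains_inf[OF cD False this] obtain x0 where "x0 \<in> D" "\<forall>x\<in>D. ?V x0 \<le> ?V x" by blast
        then show ?thesis using that[of "?V x0"] VD by blast
      qed
      obtain B where B: "0 \<le> B" "\<And>x. x \<in> closure \<Omega> \<Longrightarrow> \<bar>G x\<bar> \<le> B" using C_bound[OF G(1)] by blast
      have le: "G x \<le> \<epsilon> + (B / \<delta>) * ?V x" if x: "x \<in> closure \<Omega>" for x
      proof (cases "x \<in> D")
        case True
        have "B = (B / \<delta>) * \<delta>" using \<delta>(1) by simp
        also have "\<dots> \<le> (B / \<delta>) * ?V x" using \<delta> B True by (intro mult_left_mono) auto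
        finally show ?thesis using B(2)[OF x] \<epsilon> by simp
      next
        case False
        have "0 \<le> (B / \<delta>) * ?V x" using B \<delta> V(2)[OF x] by simp
        then show ?thesis using False x by (simp add: D_def)
      qed
      have CV: "C (\<lambda>x. (B / \<delta>) * ?V x)" by (intro continuous_intros V)
      have "S r G z \<le> S r (\<lambda>x. \<epsilon> + (B / \<delta>) * ?V x) z"
        using r by (intro S_mono G continuous_intros V le z) auto
      also have "\<dots> = \<epsilon> + (B / \<delta>) * S r ?V z"
        using r S_add[OF _ _ CV z(1), of r "\<lambda>x. \<epsilon>"] S_const[OF _ z(1)] S_cmult[OF _ V(1) z(1), of r "B / \<delta>"] by simp
      also have "S r ?V z = S t v z" using S_semigroup[of r "t - r" v z] r st v z by simp
      finally show ?thesis using Sz by simp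
    qed
    then have "S r G z \<le> 0" by (rule field_le_epsilon)
    moreover have "0 \<le> S r G z" using r by (intro S_nonneg G z) auto
    ultimately show "S r G z = 0" by simp
  qed
qed

text \<open>For the cubic barrier the Laplacian is p (24 R^2 - A p), with A = 24 + 6 CARD('d),
  wherever p is positive. It is negative only for large p, where p^3 can pay for it; the constant
  comes from completing the square.\<close>

lemma barrier_lap_lower:
  fixes a x :: "real ^ 'd"
  assumes R: "0 < R"
  shows "- ((24 + 6 * real CARD('d))\<^sup>2 / (96 * R\<^sup>2)) * barrier 0 a R x \<le> barrier_lap 0 a R x"
proof -
  define p where "p = radial_pos a R x"
  define A where "A = 24 + 6 * real CARD('d)"
  have p0: "0 \<le> p" by (simp add: p_def radial_pos_nonneg)
  have *: "p * ((x - a) \<bullet> (x - a)) = p * (R\<^sup>2 - p)" by (simp add: p_def radial_pos_def max_def)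
  have "barrier_lap 0 a R x = 24 * (p * ((x - a) \<bullet> (x - a))) - 6 * real CARD('d) * p\<^sup>2"
    by (simp add: barrier_lap_def p_def power2_eq_square)
  also have "\<dots> = p * (24 * R\<^sup>2 - A * p)" unfolding * by (simp add: A_def algebra_simps power2_eq_square)
  finally have f: "barrier_lap 0 a R x = p * (24 * R\<^sup>2 - A * p)" .
  have "0 \<le> p * (24 * (R - A * p / (48 * R))\<^sup>2)" using p0 by simp
  also have "24 * (R - A * p / (48 * R))\<^sup>2 = 24 * R\<^sup>2 - A * p + A\<^sup>2 / (96 * R\<^sup>2) * p\<^sup>2"
    using R by (simp add: power2_eq_square field_simps)
  finally have "0 \<le> p * (24 * R\<^sup>2 - A * p) + A\<^sup>2 / (96 * R\<^sup>2) * p ^ 3"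
    by (simp add: algebra_simps power2_eq_square power3_eq_cube)
  then show ?thesis unfolding f by (simp add: barrier_def p_def A_def)
qed

text \<open>A small multiple of the cubic barrier centred at a lies below v. Its Laplacian is at
  least - M times itself, so its evolution at a decays at most exponentially.\<close>

lemma positivity_persists:
  assumes v: "C v" "\<And>x. x \<in> closure \<Omega> \<Longrightarrow> 0 \<le> v x" and a: "a \<in> \<Omega>" "0 < v a" and t: "0 \<le> t"
  shows "0 < S t v a"
proof -
  have aK: "a \<in> closure \<Omega>" using a(1) by (rule subsetD[OF closure_subset])
  obtain r0 where r0: "r0 > 0" "ball a r0 \<subseteq> \<Omega>" using open_\<Omega> a(1) open_contains_ball by blast
  obtain r1 where r1: "r1 > 0" "\<And>x. x \<in> closure \<Omega> \<Longrightarrow> dist x a < r1 \<Longrightarrow> dist (v x) (v a) < v a / 2"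
    using v(1) aK a(2) unfolding continuous_on_iff by (meson half_gt_zero)
  define R where "R = min r0 r1 / 2"
  have R: "0 < R" "R < r0" "R < r1" using r0(1) r1(1) by (auto simp: R_def)
  have cb: "cball a R \<subseteq> \<Omega>" using r0(2) R(2) by (auto simp: subset_iff)
  have gb: "good_ball a R" using R(1) cb by (intro good_ball_interior) auto
  let ?w = "barrier 0 a R" and ?f = "barrier_lap 0 a R"
  have Cw: "C ?w" and Cf: "C ?f" by (rule continuous_barrier continuous_barrier_lap)+
  define M where "M = (24 + 6 * real CARD('d))\<^sup>2 / (96 * R\<^sup>2)"
  have M: "0 \<le> M" by (simp add: M_def)
  have fw: "- M * ?w x \<le> ?f x" for x using barrier_lap_lower[OF R(1)] by (simp add: M_def)
  define m where "m s = S s ?w a" for s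
  have cm: "continuous_on {0..s} m" for s unfolding m_def by (rule orbit_continuous_time[OF Cw aK])
  \<comment> \<open>The comparison from time 0 alone, m h >= m 0 - \<kappa> M times the integral of
    m, does not bound m from below by Gronwall. Applying S s to the comparison over t - s bounds
    every earlier value by the final one, and Gronwall is then run backwards from t.\<close>
  have decay: "m s \<le> m t + (\<kappa> * M) * integral {s..t} m" if s: "0 \<le> s" "s \<le> t" for s
  proof -
    let ?h = "t - s"
    have CI: "C (orbit_integral ?h ?w)" by (rule orbit_integral_cont[OF Cw])
    have "?w x - (\<kappa> * M) * orbit_integral ?h ?w x \<le> S ?h ?w x" if x: "x \<in> closure \<Omega>" for x
    proof -
      have "integral {0..?h} (\<lambda>r. - M * S r ?w x) \<le> integral {0..?h} (\<lambda>r. S r ?f x)"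
      proof (rule integral_le)
        fix r assume r: "r \<in> {0..?h}"
        have "S r (\<lambda>x. - M * ?w x) x \<le> S r ?f x" using r fw by (intro S_mono continuous_intros Cw Cf x) auto
        then show "- M * S r ?w x \<le> S r ?f x" using S_cmult[OF _ Cw x, of r "- M"] r by simp
      qed (intro integrable_continuous_real continuous_intros orbit_continuous_time Cw Cf x)+
      then have "- M * orbit_integral ?h ?w x \<le> orbit_integral ?h ?f x"
        unfolding orbit_integral_def by simp
      then have "\<kappa> * (- M * orbit_integral ?h ?w x) \<le> \<kappa> * orbit_integral ?h ?f x"
        using \<kappa>_pos by (intro mult_left_mono) auto
      moreover have "\<kappa> * (- M * orbit_integral ?h ?w x) = - ((\<kappa> * M) * orbit_integral ?h ?w x)" by simp
      ultimately show ?thesis using barrier_comparison[OF gb _ x, of ?h 0] s by linarith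
    qed
    then have "S s (\<lambda>x. ?w x - (\<kappa> * M) * orbit_integral ?h ?w x) a \<le> S s (S ?h ?w) a"
      using s by (intro S_mono continuous_intros Cw CI S_cont aK) auto
    moreover have "S s (S ?h ?w) a = m t" using S_semigroup[of s ?h ?w a] s Cw aK by (simp add: m_def)
    moreover have CI': "C (\<lambda>x. (\<kappa> * M) * orbit_integral ?h ?w x)" by (intro continuous_intros CI)
    have "S s (\<lambda>x. ?w x - (\<kappa> * M) * orbit_integral ?h ?w x) a = m s - (\<kappa> * M) * S s (orbit_integral ?h ?w) a"
      using S_diff[OF s(1) Cw CI' aK] S_cmult[OF s(1) CI aK, of "\<kappa> * M"] by (simp add: m_def)
    moreover have "S s (orbit_integral ?h ?w) a = integral {s..t} m"
      using S_orbit_integral[OF Cw _ s(1) aK, of ?h] s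
        Henstock_Kurzweil_Integration.integral_combine[OF s integrable_continuous_real[OF cm]]
      by (simp add: orbit_integral_def m_def[abs_def])
    ultimately show ?thesis by simp
  qed
  have "m (t - t) \<le> m t * exp ((\<kappa> * M) * t)"
  proof (rule gronwall[where T = t and \<phi> = "\<lambda>s. m (t - s)"])
    show "continuous_on {0..t} (\<lambda>s. m (t - s))"
      by (intro continuous_on_compose2[OF cm[of t]] continuous_intros) auto
    fix s assume s: "s \<in> {0..t}"
    have "integral {0..s} (\<lambda>s. m (t - s)) = integral {t - s..t} m"
    proof -
      have "integral {- s..0} (m \<circ> (\<lambda>x. x + t)) = integral {- s + t..0 + t} m"
        using s by (intro integral_shift continuous_on_subset[OF cm[of t]]) auto
      moreover have "integral {- s..- 0} (\<lambda>x. m (t - - x)) = integral {0..s} (\<lambda>x. m (t - x))"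
        by (rule Henstock_Kurzweil_Integration.integral_reflect_real)
      ultimately show ?thesis by (simp add: o_def add.commute)
    qed
    then show "m (t - s) \<le> m t + \<kappa> * M * integral {0..s} (\<lambda>s. m (t - s))"
      using decay[of "t - s"] s by simp
  qed (use t \<kappa>_pos M in auto)
  moreover have "m 0 = ?w a" by (simp add: m_def S_zero Cw aK)
  moreover have "0 < ?w a" using radial_pos_pos[of a a R] R(1) by (simp add: barrier_def)
  ultimately have "0 < m t * exp (\<kappa> * M * t)" by simp
  then have mt: "0 < m t" by (simp add: zero_less_mult_iff)
  \<comment> \<open>On the ball v exceeds v a / 2, and the barrier is at most (R^2)^3.\<close>
  let ?c = "(v a / 2) / (R\<^sup>2) ^ 3"
  have c: "0 < ?c" using a(2) R(1) by simp
  have "?c * ?w x \<le> v x" if x: "x \<in> closure \<Omega>" for x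
  proof (cases "x \<in> ball a R")
    case True
    have "?c * ?w x \<le> ?c * (R\<^sup>2) ^ 3" using barrier_le[of 0 a R x] c by (intro mult_left_mono) auto
    also have "\<dots> = v a / 2" using R(1) by simp
    also have "\<dots> \<le> v x"
    proof -
      have "dist (v x) (v a) < v a / 2" using r1(2)[OF x] True R(3) by (simp add: dist_commute)
      then show ?thesis unfolding dist_real_def by arith
    qed
    finally show ?thesis .
  next
    case False
    then have "?w x = 0" using radial_pos_eq_0[of R x a] R(1) by (simp add: barrier_def)
    then show ?thesis using v(2)[OF x] by simp
  qed
  then have "S t (\<lambda>x. ?c * ?w x) a \<le> S t v a" using t by (intro S_mono continuous_intros Cw v aK) auto
  then show ?thesis using S_cmult[OF t Cw aK, of ?c] mult_pos_pos[OF c mt] by (simp add: m_def)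
qed

text \<open>The set \<open>P\<close> of points that are positive at all positive times is open and
  relatively closed in \<open>\<Omega>\<close>, because positivity at the centre of a closed ball in
  \<open>\<Omega>\<close> spreads to the open ball.\<close>

lemma interior_positivity:
  assumes v: "C v" "\<And>x. x \<in> closure \<Omega> \<Longrightarrow> 0 \<le> v x" and x0: "x0 \<in> \<Omega>" "0 < v x0"
    and conn: "connected \<Omega>" and x: "x \<in> \<Omega>" and t: "0 < t"
  shows "0 < S t v x"
proof -
  define P where "P = {x \<in> \<Omega>. \<forall>t>0. 0 < S t v x}"
  have spread: "y \<in> P" if a: "a \<in> P" and R: "0 < R" "cball a R \<subseteq> \<Omega>" and y: "y \<in> ball a R" for a R y
    unfolding P_def
  proof (intro CollectI conjI allI impI)
    show "y \<in> \<Omega>" using R(2) y by auto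
    then have yK: "y \<in> closure \<Omega>" by (rule subsetD[OF closure_subset])
    fix t :: real assume t: "0 < t"
    \<comment> \<open>Up to t/2 the solution has become positive on a neighbourhood of a. On (t/2,
      t) it stays so by \<open>positivity_persists\<close>, which keeps the complement
      \<open>N\<close> of that neighbourhood away from the centre.\<close>
    let ?s = "t / 2"
    let ?V = "S ?s v"
    have V: "C ?V" "\<And>x. x \<in> closure \<Omega> \<Longrightarrow> 0 \<le> ?V x" using t by (auto intro!: S_cont S_nonneg v)
    have "0 < ?V a" "a \<in> \<Omega>" using a t by (auto simp: P_def)
    then have aK: "a \<in> closure \<Omega>" by (simp add: subsetD[OF closure_subset])
    obtain d where d: "d > 0" "\<And>x. x \<in> closure \<Omega> \<Longrightarrow> dist x a < d \<Longrightarrow> dist (?V x) (?V a) < ?V a"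
      using V(1) aK \<open>0 < ?V a\<close> unfolding continuous_on_iff by meson
    have Vpos: "0 < ?V x" if "x \<in> closure \<Omega>" "dist x a < d" for x
      using d(2)[OF that] by (simp add: dist_real_def abs_less_iff)
    define \<beta> where "\<beta> = min R d"
    have pos: "0 < S \<sigma> v x" if \<sigma>: "?s < \<sigma>" "\<sigma> < t" and x: "x \<in> closure \<Omega>" "x \<notin> - ball a \<beta>" for \<sigma> x
    proof -
      have xd: "dist x a < d" "x \<in> cball a R" using x(2) by (auto simp: \<beta>_def dist_commute)
      then have "x \<in> \<Omega>" using R(2) by auto
      have "0 < S (\<sigma> - ?s) ?V x"
        using \<sigma> by (intro positivity_persists V \<open>x \<in> \<Omega>\<close> Vpos x xd) auto
      then show ?thesis using S_semigroup[of "\<sigma> - ?s" ?s v x] \<sigma> t v x by simp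
    qed
    show "0 < S t v y"
    proof (rule positivity_spreads[where s = ?s and N = "- ball a \<beta>" and a = a and R = R and \<beta> = \<beta>])
      show "good_ball a R" using R by (intro good_ball_interior) auto
      show "\<beta> \<le> norm (x - a)" if "x \<in> - ball a \<beta>" for x using that by (auto simp: dist_norm norm_minus_commute)
    qed (use v t R y yK pos d(1) in \<open>auto simp: \<beta>_def\<close>)
  qed
  have "open P"
    unfolding open_contains_ball
  proof
    fix a assume a: "a \<in> P"
    then obtain R where R: "0 < R" "cball a R \<subseteq> \<Omega>" using open_\<Omega> open_contains_cball unfolding P_def by blast
    then show "\<exists>e>0. ball a e \<subseteq> P" using spread[OF a R] by blast
  qed
  moreover have "open (\<Omega> - P)"
    unfolding open_contains_ball
  proof
    fix y assume y: "y \<in> \<Omega> - P"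
    then obtain R where R: "0 < R" "cball y R \<subseteq> \<Omega>" using open_\<Omega> open_contains_cball by blast
    \<comment> \<open>Closedness of P in contrapositive form: a point of P within R/2 of y is the
      centre of a ball in \<open>\<Omega>\<close> containing y, and would put y into P.\<close>
    have "ball y (R / 2) \<subseteq> \<Omega> - P"
    proof
      fix a assume a: "a \<in> ball y (R / 2)"
      have sub: "cball a (R / 2) \<subseteq> cball y R"
      proof
        fix w assume "w \<in> cball a (R / 2)"
        then show "w \<in> cball y R" using a dist_triangle[of y w a] by simp
      qed
      have "a \<notin> P"
      proof
        assume "a \<in> P"
        moreover have "y \<in> ball a (R / 2)" using a by (simp add: dist_commute)
        ultimately have "y \<in> P" using R sub by (intro spread[of a "R / 2" y]) auto
        then show False using y by simp
      qed
      moreover have "a \<in> \<Omega>" using a R by (auto simp: subset_iff)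
      ultimately show "a \<in> \<Omega> - P" by simp
    qed
    then show "\<exists>e>0. ball y e \<subseteq> \<Omega> - P" using R by (intro exI[of _ "R / 2"]) auto
  qed
  moreover have "x0 \<in> P"
    using x0 positivity_persists[OF v x0] by (auto simp: P_def)
  moreover have "P \<subseteq> \<Omega>" by (auto simp: P_def)
  ultimately have "\<Omega> - P = {}"
    using connectedD[OF conn, of P "\<Omega> - P"] x0(1) by blast
  then have "x \<in> P" using x by blast
  then show ?thesis using t by (simp add: P_def)
qed

text \<open>At a boundary point the exceptional set is the frontier itself: all interior points are
  positive at every positive time, and the closed frontier keeps a distance from the centre of the
  good ball.\<close>

lemma strict_positivity:
  assumes v: "C v" "\<And>x. x \<in> closure \<Omega> \<Longrightarrow> 0 \<le> v x" and x1: "x1 \<in> closure \<Omega>" "v x1 \<noteq> 0"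
    and conn: "connected \<Omega>" and C1: "C1_boundary \<Omega>" and t: "0 < t" and z: "z \<in> closure \<Omega>"
  shows "0 < S t v z"
proof -
  \<comment> \<open>The given point \<open>x1\<close> may lie on the boundary; continuity yields an
    interior one.\<close>
  obtain x0 where x0: "x0 \<in> \<Omega>" "0 < v x0"
  proof (rule ccontr)
    assume "\<not> thesis"
    with that have "v x \<le> 0" if "x \<in> \<Omega>" for x using \<open>x \<in> \<Omega>\<close> not_le by blast
    with continuous_le_on_closure[OF v(1) x1(1), of 0] have "v x1 \<le> 0" by blast
    then show False using v(2)[OF x1(1)] x1(2) by simp
  qed
  have int: "0 < S t v x" if "x \<in> \<Omega>" "0 < t" for x t
    using interior_positivity[OF v(1) _ x0 conn that] v(2) by simp
  show ?thesis
  proof (cases "z \<in> \<Omega>")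
    case True
    then show ?thesis by (rule int) (rule t)
  next
    case False
    then have zf: "z \<in> frontier \<Omega>" using z open_\<Omega> by (simp add: frontier_def interior_open)
    obtain a R where aR: "0 < R" "z \<in> ball a R" "a \<notin> frontier \<Omega>" "good_ball a R"
      using good_ball_frontier[OF C1 zf] by blast
    have "a \<in> - frontier \<Omega>" "open (- frontier \<Omega>)" using aR(3) by (auto simp: frontier_closed open_Compl)
    then obtain \<beta> where \<beta>: "0 < \<beta>" "ball a \<beta> \<subseteq> - frontier \<Omega>" using open_contains_ball by metis
    show ?thesis
    proof (rule positivity_spreads[where s = 0 and N = "frontier \<Omega>" and a = a and R = R and \<beta> = \<beta>])
      show "\<beta> \<le> norm (x - a)" if "x \<in> frontier \<Omega>" for x
      proof (rule ccontr)
        assume "\<not> \<beta> \<le> norm (x - a)"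
        then have "x \<in> ball a \<beta>" by (simp add: dist_norm norm_minus_commute)
        then show False using \<beta>(2) that by blast
      qed
      show "0 < S \<sigma> v x" if "0 < \<sigma>" "\<sigma> < t" "x \<in> closure \<Omega>" "x \<notin> frontier \<Omega>" for \<sigma> x
        using that open_\<Omega> by (intro int) (auto simp: frontier_def interior_open)
    qed (use v t aR z \<beta> in auto)
  qed
qed

end

section \<open>Mild solutions\<close>

context markov_semigroup
begin

text \<open>
  Adding a large multiple \<open>\<theta> u\<close> to the source term is compensated by the factor \<open>exp (- \<theta> t)\<close>: both
  descriptions come from the derivative of \<open>s \<mapsto> exp (- \<theta> (t - s)) S (t - s) (u s) x\<close>.
\<close>

lemma mild_lower_bound:
  fixes f u :: "real \<Rightarrow> 'a \<Rightarrow> real" and b :: "real \<Rightarrow> real"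
  assumes f: "continuous_on ({0..t} \<times> K) (\<lambda>(s, x). f s x)"
    and u: "\<And>s. s \<in> {0..t} \<Longrightarrow> C (u s)"
    and mild: "\<And>s x. s \<in> {0..t} \<Longrightarrow> x \<in> K \<Longrightarrow> u s x = S s (u 0) x + integral {0..s} (\<lambda>r. S (s - r) (f r) x)"
    and \<theta>: "0 \<le> \<theta>" and b: "continuous_on {0..t} b" "\<And>s. s \<in> {0..t} \<Longrightarrow> 0 \<le> b s"
    and lower: "\<And>s x. s \<in> {0..t} \<Longrightarrow> x \<in> K \<Longrightarrow> - b s \<le> f s x + \<theta> * u s x"
    and t: "0 \<le> t" and x: "x \<in> K"
  shows "exp (- (\<theta> * t)) * S t (u 0) x - integral {0..t} b \<le> u t x"
proof -
  have Cf: "C (f s)" if "s \<in> {0..t}" for s by (rule joint_continuous_slice[OF f that])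
  have C0: "C (u 0)" using u t by simp
  define h where "h r = S (t - r) (f r) x" for r
  have ch: "continuous_on {0..t} h"
    unfolding h_def
    by (rule joint_continuous_time[OF S_joint_continuous[OF f] x]) (auto intro!: continuous_intros)
  \<comment> \<open>The state at time s transported freely to the final time t: as s grows only the
    source contributes, so the derivative is \<open>h s\<close>.\<close>
  define g where "g s = S t (u 0) x + integral {0..s} h" for s
  have g: "S (t - s) (u s) x = g s" if s: "s \<in> {0..t}" for s
  proof -
    have fs: "continuous_on ({0..s} \<times> K) (\<lambda>(r, x). f r x)"
      by (rule continuous_on_subset[OF f]) (use s in auto)
    have \<Phi>: "continuous_on ({0..s} \<times> K) (\<lambda>(r, x). S (s - r) (f r) x)"
      by (rule S_joint_continuous[OF fs]) (auto intro!: continuous_intros)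
    have CI: "C (\<lambda>x. integral {0..s} (\<lambda>r. S (s - r) (f r) x))" by (rule continuous_on_time_integral[OF \<Phi>])
    have "S (t - s) (u s) x = S (t - s) (\<lambda>x. S s (u 0) x + integral {0..s} (\<lambda>r. S (s - r) (f r) x)) x"
      using s u mild x by (intro S_cong) auto
    also have "\<dots> = S (t - s) (S s (u 0)) x + S (t - s) (\<lambda>x. integral {0..s} (\<lambda>r. S (s - r) (f r) x)) x"
      using s by (intro S_add CI S_cont C0 x) auto
    also have "S (t - s) (S s (u 0)) x = S t (u 0) x"
      using S_semigroup[of "t - s" s "u 0" x] s C0 x by simp
    also have "S (t - s) (\<lambda>x. integral {0..s} (\<lambda>r. S (s - r) (f r) x)) x = integral {0..s} (\<lambda>r. S (t - s) (S (s - r) (f r)) x)"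
      using s by (intro S_time_integral \<Phi> x) auto
    also have "\<dots> = integral {0..s} h"
      using s S_semigroup[of "t - s" "s - _" "f _" x] x Cf
      by (intro Henstock_Kurzweil_Integration.integral_cong) (auto simp: h_def)
    finally show ?thesis by (simp add: g_def)
  qed
  have g': "(g has_real_derivative h s) (at s within {0..t})" if "s \<in> {0..t}" for s
    unfolding g_def[abs_def]
    by (rule derivative_eq_intros integral_has_real_derivative[OF ch that] refl)+ simp
  define E where "E s = exp (- (\<theta> * (t - s))) * g s" for s
  define E' where "E' s = exp (- (\<theta> * (t - s))) * (h s + \<theta> * g s)" for s
  have I1: "(E' has_integral (E t - E 0)) {0..t}"
  proof (rule fundamental_theorem_of_calculus[OF t])
    fix s assume s: "s \<in> {0..t}"
    have "(E has_real_derivative E' s) (at s within {0..t})"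
      unfolding E_def[abs_def] E'_def
      by (rule derivative_eq_intros g'[OF s] refl)+ (simp add: algebra_simps)
    then show "(E has_vector_derivative E' s) (at s within {0..t})"
      by (simp add: has_real_derivative_iff_has_vector_derivative)
  qed
  have I2: "((\<lambda>s. - b s) has_integral (- integral {0..t} b)) {0..t}"
    by (intro has_integral_neg integrable_integral integrable_continuous_real b)
  have "- integral {0..t} b \<le> E t - E 0"
  proof (rule has_integral_le[OF I2 I1])
    fix s assume s: "s \<in> {0..t}"
    have "h s + \<theta> * g s = S (t - s) (\<lambda>x. f s x + \<theta> * u s x) x"
      using s S_add[OF _ Cf[OF s] continuous_on_mult_left[OF u[OF s]] x, of "t - s" \<theta>] S_cmult[OF _ u[OF s] x, of "t - s" \<theta>] g[OF s]
      by (simp add: h_def)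
    also have "- b s \<le> \<dots>"
      using s by (intro S_lower_const lower x continuous_intros Cf u) auto
    finally have "exp (- (\<theta> * (t - s))) * (- b s) \<le> E' s" unfolding E'_def by (intro mult_left_mono) auto
    moreover have "exp (- (\<theta> * (t - s))) * b s \<le> 1 * b s"
      using s b(2)[OF s] \<theta> by (intro mult_right_mono) auto
    ultimately show "- b s \<le> E' s" by simp
  qed
  moreover have "E t = u t x" using g[of t] t u x by (simp add: E_def S_zero)
  moreover have "E 0 = exp (- (\<theta> * t)) * S t (u 0) x" by (simp add: E_def g_def)
  ultimately show ?thesis by simp
qed

end

section \<open>The nonlinearity\<close>

lemma locally_Lipschitz_continuous:
  fixes F :: "'a :: metric_space \<Rightarrow> 'b :: metric_space"
  assumes "locally_Lipschitz F"
  shows "continuous_on A F"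
proof -
  have "isCont F x" for x
  proof -
    obtain r L where r: "r > 0" "L-lipschitz_on (cball x r) F"
      using assms unfolding locally_Lipschitz_def by blast
    have "continuous_on (ball x r) F"
      by (rule continuous_on_subset[OF lipschitz_on_continuous_on[OF r(2)]]) auto
    then show ?thesis using r(1) by (simp add: continuous_on_eq_continuous_at)
  qed
  then show ?thesis by (simp add: continuous_at_imp_continuous_on)
qed

lemma locally_Lipschitz_compact:
  fixes F :: "'a :: metric_space \<Rightarrow> 'b :: metric_space"
  assumes "locally_Lipschitz F" "compact A"
  obtains L where "L-lipschitz_on A F"
proof -
  have "local_lipschitz {0 :: real} A (\<lambda>_. F)"
  proof (rule local_lipschitzI)
    fix x assume "x \<in> A"
    obtain r L where r: "r > 0" "L-lipschitz_on (cball x r) F"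
      using assms(1) unfolding locally_Lipschitz_def by blast
    have "L-lipschitz_on (cball x r \<inter> A) F" by (rule lipschitz_on_subset[OF r(2)]) auto
    then show "\<exists>u>0. \<exists>L. \<forall>t'\<in>cball t u \<inter> {0}. L-lipschitz_on (cball x u \<inter> A) F" for t :: real
      using r(1) by blast
  qed
  from local_lipschitz_compact_implies_lipschitz[OF this assms(2)] that show thesis by auto
qed

text \<open>
  Compare \<open>u\<close> with the point obtained by replacing negative coordinates, and the coordinate \<open>i\<close>, by \<open>0\<close>.
\<close>

lemma cond_P_lower_bound:
  fixes F :: "real ^ 'n \<Rightarrow> real ^ 'n"
  assumes P: "cond_P F" and L: "L-lipschitz_on (cball 0 R) F" and u: "norm u \<le> R"
    and m: "0 \<le> m" "\<And>j. - m \<le> u $ j"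
  shows "- (L * (real CARD('n) + 2) * m) \<le> F u $ i + L * u $ i"
proof -
  define w where "w = (\<chi> j. if j = i then 0 else max 0 (u $ j))"
  have "0 \<le> F w $ i" using P unfolding cond_P_def by (simp add: w_def)
  have "norm w \<le> norm u" by (rule norm_le_componentwise_cart) (auto simp: w_def max_def)
  have L0: "0 \<le> L" by (rule lipschitz_on_nonneg[OF L])
  have "norm (u - w) \<le> (\<Sum>j\<in>UNIV. \<bar>(u - w) $ j\<bar>)" by (rule norm_le_l1_cart)
  also have "\<dots> \<le> (\<Sum>j\<in>UNIV. m + (if j = i then \<bar>u $ i\<bar> else 0))"
  proof (rule sum_mono)
    fix j show "\<bar>(u - w) $ j\<bar> \<le> m + (if j = i then \<bar>u $ i\<bar> else 0)"
      using m(1) m(2)[of j] by (auto simp: w_def max_def)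
  qed
  also have "\<dots> = real CARD('n) * m + \<bar>u $ i\<bar>" by (simp add: sum.distrib)
  finally have d: "norm (u - w) \<le> real CARD('n) * m + \<bar>u $ i\<bar>" .
  have "\<bar>F u $ i - F w $ i\<bar> \<le> norm (F u - F w)"
    using component_le_norm_cart[of "F u - F w" i] by simp
  also have "\<dots> \<le> L * norm (u - w)"
    using lipschitz_onD[OF L, of u w] u \<open>norm w \<le> norm u\<close> by (simp add: dist_norm)
  also have "\<dots> \<le> L * (real CARD('n) * m + \<bar>u $ i\<bar>)" using d L0 by (rule mult_left_mono)
  finally have "- (L * (real CARD('n) * m + \<bar>u $ i\<bar>)) \<le> F u $ i" using \<open>0 \<le> F w $ i\<close> by linarith
  \<comment> \<open>Passing from |u_i| to u_i costs 2 m; with one m for each coordinate this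
    explains the factor \<open>CARD('n) + 2\<close>.\<close>
  moreover have "L * (\<bar>u $ i\<bar> - u $ i) \<le> L * (2 * m)"
    using m(2)[of i] m(1) L0 by (intro mult_left_mono) auto
  ultimately show ?thesis by (simp add: algebra_simps)
qed

section \<open>The system: nonnegativity and strict positivity of mild solutions\<close>

locale reaction_diffusion =
  fixes \<Omega> :: "(real ^ 'd) set" and d :: "'n :: finite \<Rightarrow> real" and F :: "real ^ 'n \<Rightarrow> real ^ 'n"
    and S :: "'n \<Rightarrow> real \<Rightarrow> (real ^ 'd \<Rightarrow> real) \<Rightarrow> real ^ 'd \<Rightarrow> real"
  assumes open_dom: "open \<Omega>" and dom_nonempty: "\<Omega> \<noteq> {}" and bounded_dom: "bounded \<Omega>"
    and d_pos: "\<And>i. 0 < d i" and F_Lipschitz: "locally_Lipschitz F"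
    and S_heat: "\<And>i. neumann_heat_semigroup \<Omega> (d i) (S i)"
begin

sublocale heat: neumann_heat \<Omega> "d i" "S i" for i
  by unfold_locales (use open_dom dom_nonempty bounded_dom d_pos S_heat in auto)

abbreviation K :: "(real ^ 'd) set" where "K \<equiv> closure \<Omega>"

lemma time_interval_initial: "t \<in> time_interval T \<Longrightarrow> {0..t} \<subseteq> time_interval T"
  unfolding time_interval_def by (auto intro: le_less_trans[of "ereal _" "ereal t" T])

lemma mild_joint_continuous:
  assumes "mild_solution \<Omega> S F T U"
  shows "continuous_on (time_interval T \<times> K) (\<lambda>(s, x). U s i x)"
proof (rule joint_continuousI)
  show "continuous_on K (U s i)" if "s \<in> time_interval T" for s
    using assms that unfolding mild_solution_def by blast
  fix s \<epsilon> assume s: "s \<in> time_interval T" and \<epsilon>: "0 < (\<epsilon> :: real)"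
  have "uniform_limit K (\<lambda>s. U s i) (U s i) (at s within time_interval T)"
    using assms s unfolding mild_solution_def by blast
  then have "\<forall>\<^sub>F r in at s within time_interval T. \<forall>x\<in>K. dist (U r i x) (U s i x) < \<epsilon>"
    using \<epsilon> unfolding uniform_limit_iff by blast
  then obtain e where e: "e > 0" "\<And>r. r \<in> time_interval T \<Longrightarrow> r \<noteq> s \<Longrightarrow> dist r s < e \<Longrightarrow> \<forall>x\<in>K. dist (U r i x) (U s i x) < \<epsilon>"
    unfolding eventually_at by blast
  have "\<bar>U r i x - U s i x\<bar> \<le> \<epsilon>" if "r \<in> time_interval T" "\<bar>r - s\<bar> < e" "x \<in> K" for r x
  proof (cases "r = s")
    case False
    then show ?thesis using e(2)[of r] that by (force simp: dist_real_def)
  qed (use \<epsilon> in simp)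
  then show "\<exists>\<delta>>0. \<forall>r\<in>time_interval T. \<bar>r - s\<bar> < \<delta> \<longrightarrow> (\<forall>x\<in>K. \<bar>U r i x - U s i x\<bar> \<le> \<epsilon>)"
    using e(1) by blast
qed

lemma source_joint_continuous:
  assumes "\<And>j. continuous_on (I \<times> K) (\<lambda>(s, x). U s j x)"
  shows "continuous_on (I \<times> K) (\<lambda>(s, x). F (\<chi> j. U s j x) $ i)"
proof -
  have "continuous_on (I \<times> K) (\<lambda>p. U (fst p) j (snd p))" for j
    using assms[of j] by (simp add: split_beta)
  then have "continuous_on (I \<times> K) (\<lambda>p. \<chi> j. U (fst p) j (snd p))"
    by (rule continuous_on_vec_lambda)
  then have "continuous_on (I \<times> K) (\<lambda>p. F (\<chi> j. U (fst p) j (snd p)))"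
    by (rule continuous_on_compose2[OF locally_Lipschitz_continuous[OF F_Lipschitz, of UNIV]]) auto
  then show ?thesis
    unfolding split_beta by (rule continuous_on_component)
qed

text \<open>The iteration uses explicit continuous majorants of the negative parts, R (c s)^k / k!,
  as in Picard's scheme; the supremum over x of the negative part is never itself treated as a
  function of time. The constant R bounds the whole trajectory on {0..t}, so L is one Lipschitz
  constant for all its values.\<close>

lemma mild_nonneg:
  assumes P: "cond_P F" and mild: "mild_solution \<Omega> S F T U" and init: "\<And>i x. x \<in> \<Omega> \<Longrightarrow> 0 \<le> U 0 i x"
    and t: "t \<in> time_interval T"
  shows "\<And>i x. x \<in> K \<Longrightarrow> 0 \<le> U t i x"
    and "\<exists>\<theta>\<ge>0. \<forall>i. \<forall>x\<in>K. exp (- (\<theta> * t)) * S i t (U 0 i) x \<le> U t i x"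
proof -
  have t0: "0 \<le> t" using t by (simp add: time_interval_def)
  have sub: "{0..t} \<subseteq> time_interval T" by (rule time_interval_initial[OF t])
  have jU: "continuous_on ({0..t} \<times> K) (\<lambda>(s, x). U s i x)" for i
    by (rule continuous_on_subset[OF mild_joint_continuous[OF mild]]) (use sub in auto)
  have CU: "continuous_on K (U s i)" if "s \<in> {0..t}" for s i
    by (rule joint_continuous_slice[OF jU that])
  note jf = source_joint_continuous[OF jU]
  have eq: "U s i x = S i s (U 0 i) x + integral {0..s} (\<lambda>r. S i (s - r) (\<lambda>y. F (\<chi> j. U r j y) $ i) x)"
    if "s \<in> {0..t}" "x \<in> K" for s i x
    using mild subsetD[OF sub that(1)] that(2) unfolding mild_solution_def by blast
  have "continuous_on ({0..t} \<times> K) (\<lambda>p. U (fst p) j (snd p))" for j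
    using jU[of j] by (simp add: split_beta)
  then have "continuous_on ({0..t} \<times> K) (\<lambda>p. \<chi> j. U (fst p) j (snd p))"
    by (rule continuous_on_vec_lambda)
  moreover have "compact ({0..t} \<times> K)" by (intro compact_Times heat.compact_K) auto
  ultimately have "bounded ((\<lambda>p. \<chi> j. U (fst p) j (snd p)) ` ({0..t} \<times> K))"
    by (intro compact_imp_bounded compact_continuous_image)
  then obtain R where R: "\<forall>w\<in>(\<lambda>p. \<chi> j. U (fst p) j (snd p)) ` ({0..t} \<times> K). norm w \<le> R"
    unfolding bounded_iff by blast
  have R: "norm (\<chi> j. U s j x) \<le> R" if "s \<in> {0..t}" "x \<in> K" for s x
    using bspec[OF R imageI[of "(s, x)"]] that by simp
  obtain L where L: "L-lipschitz_on (cball 0 R) F"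
    by (rule locally_Lipschitz_compact[OF F_Lipschitz compact_cball])
  have L0: "0 \<le> L" by (rule lipschitz_on_nonneg[OF L])
  have R0: "0 \<le> R"
  proof -
    obtain x where "x \<in> K" using heat.K_nonempty by (metis all_not_in_conv)
    then show ?thesis using R[of 0 x] t0 norm_ge_zero order_trans by (metis atLeastAtMost_iff order_refl)
  qed
  have init: "0 \<le> U 0 i x" if "x \<in> K" for i x
    using continuous_ge_on_closure[OF CU[of 0 i] that, of 0] t0 init by simp
  define c where "c = L * (real CARD('n) + 2)"
  have c0: "0 \<le> c" using L0 by (simp add: c_def)
  \<comment> \<open>One round of the iteration: any common majorant m of the negative parts of all
    components is replaced by c times its time integral.\<close>
  have step: "exp (- (L * s)) * S i s (U 0 i) x - integral {0..s} (\<lambda>r. c * m r) \<le> U s i x"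
    if m: "continuous_on {0..t} m" "\<And>r. r \<in> {0..t} \<Longrightarrow> 0 \<le> m r" "\<And>r j x. r \<in> {0..t} \<Longrightarrow> x \<in> K \<Longrightarrow> - m r \<le> U r j x"
      and s: "s \<in> {0..t}" and x: "x \<in> K" for m s i x
  proof (rule heat.mild_lower_bound[where f = "\<lambda>s x. F (\<chi> j. U s j x) $ i" and u = "\<lambda>s. U s i"])
    have ss: "{0..s} \<subseteq> {0..t}" using s by auto
    show "continuous_on ({0..s} \<times> K) (\<lambda>(s, x). F (\<chi> j. U s j x) $ i)"
      by (rule continuous_on_subset[OF jf]) (use ss in auto)
    show "continuous_on {0..s} (\<lambda>r. c * m r)"
      by (intro continuous_intros continuous_on_subset[OF m(1) ss])
    show "- (c * m r) \<le> F (\<chi> j. U r j y) $ i + L * U r i y" if "r \<in> {0..s}" "y \<in> K" for r y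
      using cond_P_lower_bound[OF P L R m(2), of r y r i] m(3)[of r y] that ss by (simp add: c_def subset_iff)
    show "0 \<le> c * m r" if "r \<in> {0..s}" for r using m(2)[of r] that ss c0 by (auto simp: subset_iff)
  qed (use s x L0 CU eq in auto)
  have iter: "- (R * (c * s) ^ k / fact k) \<le> U s j x" if "s \<in> {0..t}" "x \<in> K" for k s j x
    using that
  proof (induction k arbitrary: s j x)
    case 0
    then show ?case using R[OF 0] component_le_norm_cart[of "\<chi> j. U s j x" j] by simp
  next
    case (Suc k)
    let ?m = "\<lambda>s. R * (c * s) ^ k / fact k"
    have "exp (- (L * s)) * S j s (U 0 j) x - integral {0..s} (\<lambda>r. c * ?m r) \<le> U s j x"
      using R0 c0 Suc by (intro step) (auto intro!: continuous_intros)
    moreover have "0 \<le> S j s (U 0 j) x"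
      using Suc.prems t0 by (intro heat.S_nonneg init CU) auto
    moreover have "integral {0..s} (\<lambda>r. c * ?m r) = R * (c * s) ^ Suc k / fact (Suc k)"
    proof (rule integral_unique)
      have "((\<lambda>r. c * ?m r) has_integral (R * (c * s) ^ Suc k / fact (Suc k) - R * (c * 0) ^ Suc k / fact (Suc k))) {0..s}"
      proof (rule fundamental_theorem_of_calculus)
        fix r
        have "((\<lambda>r. R * (c * r) ^ Suc k / fact (Suc k)) has_real_derivative R * (real (Suc k) * (c * r) ^ k * c) / fact (Suc k)) (at r within {0..s})"
          by (rule derivative_eq_intros refl)+ (simp_all del: fact_Suc power_Suc of_nat_Suc add: field_simps)
        moreover have "R * (real (Suc k) * (c * r) ^ k * c) / fact (Suc k) = c * ?m r"
          by (simp add: field_simps del: of_nat_Suc)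
        ultimately show "((\<lambda>r. R * (c * r) ^ Suc k / fact (Suc k)) has_vector_derivative c * ?m r) (at r within {0..s})"
          by (simp only: has_real_derivative_iff_has_vector_derivative)
      qed (use Suc.prems in simp)
      then show "((\<lambda>r. c * ?m r) has_integral R * (c * s) ^ Suc k / fact (Suc k)) {0..s}" by simp
    qed
    ultimately show ?case
      by (smt (verit) exp_ge_zero mult_nonneg_nonneg)
  qed
  have nonneg: "0 \<le> U s j x" if "s \<in> {0..t}" "x \<in> K" for s j x
  proof -
    have "(\<lambda>k. (c * s) ^ k /\<^sub>R fact k) \<longlonglongrightarrow> 0" by (rule summable_LIMSEQ_zero[OF summable_exp_generic])
    then have "(\<lambda>k. - (R * ((c * s) ^ k /\<^sub>R fact k))) \<longlonglongrightarrow> - (R * 0)" by (intro tendsto_intros)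
    moreover have "(\<lambda>k. - (R * ((c * s) ^ k /\<^sub>R fact k))) = (\<lambda>k. - (R * (c * s) ^ k / fact k))"
      by (simp add: fun_eq_iff divide_inverse mult_ac)
    ultimately have "(\<lambda>k. - (R * (c * s) ^ k / fact k)) \<longlonglongrightarrow> 0" by simp
    from LIMSEQ_le_const2[OF this] iter[OF that] show ?thesis by blast
  qed
  show "0 \<le> U t i x" if "x \<in> K" for i x using nonneg that t0 by simp
  \<comment> \<open>Once nonnegativity is known the majorant 0 is admissible, and the same
    inequality becomes the lower bound with \<theta> = L.\<close>
  have "exp (- (L * t)) * S i t (U 0 i) x \<le> U t i x" if "x \<in> K" for i x
    using step[of "\<lambda>_. 0" t x i] nonneg that t0 by simp
  then show "\<exists>\<theta>\<ge>0. \<forall>i. \<forall>x\<in>K. exp (- (\<theta> * t)) * S i t (U 0 i) x \<le> U t i x"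
    using L0 by blast
qed

lemma mild_strictly_positive:
  assumes P: "cond_P F" and mild: "mild_solution \<Omega> S F T U" and init: "\<And>i x. x \<in> \<Omega> \<Longrightarrow> 0 \<le> U 0 i x"
    and t: "0 < t" "ereal t < T" and conn: "connected \<Omega>" and C1: "C1_boundary \<Omega>"
    and nz: "x1 \<in> K" "U 0 j x1 \<noteq> 0"
  shows "0 < (INF x\<in>K. U t j x)"
proof -
  have tT: "t \<in> time_interval T" "0 \<in> time_interval T"
    using t by (auto simp: time_interval_def intro: less_trans[of 0 "ereal t" T] simp flip: zero_ereal_def)
  have CU: "continuous_on K (U s j)" if "s \<in> time_interval T" for s
    using mild that unfolding mild_solution_def by blast
  obtain \<theta> where \<theta>: "\<And>x. x \<in> K \<Longrightarrow> exp (- (\<theta> * t)) * S j t (U 0 j) x \<le> U t j x"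
    using mild_nonneg(2)[OF P mild init tT(1)] by blast
  have pos: "0 < U t j x" if "x \<in> K" for x
  proof -
    have "0 < S j t (U 0 j) x"
    proof (rule heat.strict_positivity[OF CU[OF tT(2)] _ nz conn C1 t(1) that])
      show "0 \<le> U 0 j x" if "x \<in> K" for x by (rule mild_nonneg(1)[OF P mild init tT(2) that])
    qed
    then have "0 < exp (- (\<theta> * t)) * S j t (U 0 j) x" by simp
    with \<theta>[OF that] show ?thesis by linarith
  qed
  obtain x0 where x0: "x0 \<in> K" "\<And>x. x \<in> K \<Longrightarrow> U t j x0 \<le> U t j x"
    using continuous_attains_inf[OF heat.compact_K heat.K_nonempty CU[OF tT(1)]] by blast
  have "U t j x0 \<le> (INF x\<in>K. U t j x)" using heat.K_nonempty x0(2) by (intro cINF_greatest) auto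
  with pos[OF x0(1)] show ?thesis by linarith
qed

end

section \<open>Existence of maximal trajectories with constant initial data\<close>

text \<open>A Banach fixed point on bounded continuous functions on the whole line. The time \<tau>
  makes the map a contraction with factor 1/2 and keeps its values within r/2 of v, hence in the
  ball where \<open>G\<close> and \<open>F\<close> agree.\<close>

lemma picard_lindelof:
  fixes F :: "real ^ 'n \<Rightarrow> real ^ 'n"
  assumes L: "L-lipschitz_on (cball u r) F" and B: "\<And>v. v \<in> cball u r \<Longrightarrow> norm (F v) \<le> B"
    and r: "0 < r" and \<tau>: "0 < \<tau>" "\<tau> * L \<le> 1 / 2" "\<tau> * B \<le> r / 2"
    and v: "v \<in> cball u (r / 2)"
  obtains y where "continuous_on {0..\<tau>} y" "\<And>t. t \<in> {0..\<tau>} \<Longrightarrow> y t \<in> cball u r"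
    "\<And>t. t \<in> {0..\<tau>} \<Longrightarrow> y t = v + integral {0..t} (\<lambda>s. F (y s))"
proof -
  \<comment> \<open>Projecting onto the ball makes the field globally Lipschitz and bounded with the
    same constants.\<close>
  define G where "G w = F (closest_point (cball u r) w)" for w
  have L0: "0 \<le> L" by (rule lipschitz_on_nonneg[OF L])
  have cp: "closest_point (cball u r) w \<in> cball u r" for w
    using r by (intro closest_point_in_set) auto
  have GL: "norm (G w - G w') \<le> L * norm (w - w')" for w w'
  proof -
    have "norm (G w - G w') \<le> L * dist (closest_point (cball u r) w) (closest_point (cball u r) w')"
      using lipschitz_onD[OF L cp cp, of w w'] by (simp add: G_def dist_norm)
    also have "\<dots> \<le> L * dist w w'"
      using L0 r by (intro mult_left_mono closest_point_lipschitz) auto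
    finally show ?thesis by (simp add: dist_norm)
  qed
  have GB: "norm (G w) \<le> B" for w unfolding G_def by (rule B[OF cp])
  have B0: "0 \<le> B" using GB[of u] norm_ge_zero order_trans by blast
  have cG: "continuous_on UNIV G"
    by (rule lipschitz_on_continuous_on[of L], rule lipschitz_onI) (use GL L0 in \<open>auto simp: dist_norm\<close>)
  \<comment> \<open>Clamping time to {0..\<tau>} turns a function on the interval into one on the
    line, constant outside.\<close>
  define cl where "cl t = max 0 (min t \<tau>)" for t :: real
  have cl: "0 \<le> cl t" "cl t \<le> \<tau>" for t using \<tau>(1) by (auto simp: cl_def)
  define P where "P g t = v + integral {0..cl t} (\<lambda>s. G (apply_bcontfun g s))" for g t
  have cGg: "continuous_on A (\<lambda>s. G (apply_bcontfun g s))" for A g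
    by (rule continuous_on_compose2[OF cG]) auto
  have P_dev: "norm (P g t - v) \<le> \<tau> * B" for g t
  proof -
    have "norm (integral {0..cl t} (\<lambda>s. G (apply_bcontfun g s))) \<le> B * (cl t - 0)"
      by (rule integral_bound) (use cl GB cGg in auto)
    also have "\<dots> \<le> \<tau> * B" using mult_right_mono[OF cl(2)[of t] B0] by (simp add: mult.commute)
    finally show ?thesis by (simp add: P_def)
  qed
  have PB: "P g \<in> bcontfun" for g
  proof (rule bcontfun_normI)
    have "continuous_on {0..\<tau>} (\<lambda>t. integral {0..t} (\<lambda>s. G (apply_bcontfun g s)))"
      by (intro indefinite_integral_continuous_1 integrable_continuous_real cGg)
    then have "continuous_on UNIV (\<lambda>t. integral {0..cl t} (\<lambda>s. G (apply_bcontfun g s)))"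
      by (rule continuous_on_compose2) (use \<tau>(1) in \<open>auto simp: cl_def intro!: continuous_intros\<close>)
    then show "continuous_on UNIV (P g)" unfolding P_def[abs_def] by (intro continuous_intros)
    show "norm (P g t) \<le> norm v + \<tau> * B" for t
      using P_dev[of g t] norm_triangle_sub[of "P g t" v] by linarith
  qed
  define \<Phi> where "\<Phi> g = Bcontfun (P g)" for g
  have \<Phi>: "apply_bcontfun (\<Phi> g) = P g" for g unfolding \<Phi>_def by (rule Bcontfun_inverse[OF PB])
  have "\<exists>!g. \<Phi> g = g"
  proof (rule banach_fix_type[of "1 / 2"])
    show "\<forall>g h. dist (\<Phi> g) (\<Phi> h) \<le> 1 / 2 * dist g h"
    proof (intro allI dist_bound)
      fix g h :: "real \<Rightarrow>\<^sub>C (real ^ 'n)" and t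
      have le: "norm (G (apply_bcontfun g s) - G (apply_bcontfun h s)) \<le> L * dist g h" for s
      proof -
        have "norm (G (apply_bcontfun g s) - G (apply_bcontfun h s)) \<le> L * norm (apply_bcontfun g s - apply_bcontfun h s)"
          by (rule GL)
        also have "\<dots> \<le> L * dist g h" using dist_bounded[of g s h] L0 by (intro mult_left_mono) (auto simp: dist_norm)
        finally show ?thesis .
      qed
      have "P g t - P h t = integral {0..cl t} (\<lambda>s. G (apply_bcontfun g s)) - integral {0..cl t} (\<lambda>s. G (apply_bcontfun h s))"
        by (simp add: P_def)
      also have "\<dots> = integral {0..cl t} (\<lambda>s. G (apply_bcontfun g s) - G (apply_bcontfun h s))"
        by (intro Henstock_Kurzweil_Integration.integral_diff[symmetric] integrable_continuous_real cGg)
      also have "norm \<dots> \<le> L * dist g h * (cl t - 0)"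
        by (rule integral_bound) (use cl le in \<open>auto intro!: continuous_intros cGg\<close>)
      also have "\<dots> \<le> L * dist g h * \<tau>" using cl[of t] L0 by (intro mult_left_mono) auto
      also have "\<dots> \<le> 1 / 2 * dist g h" using mult_right_mono[OF \<tau>(2), of "dist g h"] by (simp add: mult_ac)
      finally show "dist (apply_bcontfun (\<Phi> g) t) (apply_bcontfun (\<Phi> h) t) \<le> 1 / 2 * dist g h"
        by (simp add: \<Phi> dist_norm)
    qed
  qed auto
  then obtain g where g: "\<Phi> g = g" by blast
  let ?y = "apply_bcontfun g"
  have y: "?y t = P g t" for t using \<Phi>[of g] g by simp
  have in_r: "?y t \<in> cball u r" for t
  proof -
    have "norm (?y t - v) \<le> r / 2" using P_dev[of g t] \<tau>(3) y by simp
    then show ?thesis using v norm_triangle_ineq[of "?y t - v" "v - u"] by (simp add: dist_norm norm_minus_commute)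
  qed
  show thesis
  proof (rule that[of ?y])
    show "continuous_on {0..\<tau>} ?y" by simp
    show "?y t \<in> cball u r" if "t \<in> {0..\<tau>}" for t by (rule in_r)
    show "?y t = v + integral {0..t} (\<lambda>s. F (?y s))" if "t \<in> {0..\<tau>}" for t
    proof -
      have "G (?y s) = F (?y s)" for s using in_r[of s] by (simp add: G_def closest_point_self)
      moreover have "cl t = t" using that by (simp add: cl_def)
      ultimately show ?thesis using y[of t] by (simp add: P_def)
    qed
  qed
qed

context reaction_diffusion
begin

lemma source_continuous:
  assumes "\<And>j. continuous_on K (V j)"
  shows "continuous_on K (\<lambda>y. F (\<chi> j. V j y) $ i)"
proof -
  have "continuous_on K (\<lambda>y. \<chi> j. V j y)" using assms by (rule continuous_on_vec_lambda)
  then have "continuous_on K (\<lambda>y. F (\<chi> j. V j y))"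
    by (rule continuous_on_compose2[OF locally_Lipschitz_continuous[OF F_Lipschitz, of UNIV]]) auto
  then show ?thesis by (rule continuous_on_component)
qed

text \<open>Mildness at time t involves only {0..t} and an arbitrarily small neighbourhood of t, so
  it can be checked on pieces; this makes unions of chains of solutions solutions.\<close>

lemma mild_solution_glue:
  assumes "\<And>t. t \<in> time_interval T \<Longrightarrow> \<exists>T' V. T' \<le> T \<and> t \<in> time_interval T' \<and> mild_solution \<Omega> S F T' V \<and>
      (\<forall>s\<in>time_interval T'. \<forall>i. \<forall>x\<in>K. W s i x = V s i x)"
  shows "mild_solution \<Omega> S F T W"
  unfolding mild_solution_def
proof (intro allI ballI conjI)
  fix i t assume t: "t \<in> time_interval T"
  obtain T' V where T': "T' \<le> T" "t \<in> time_interval T'" and V: "mild_solution \<Omega> S F T' V"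
    and eq: "\<And>s i x. s \<in> time_interval T' \<Longrightarrow> x \<in> K \<Longrightarrow> W s i x = V s i x"
    using assms[OF t] by blast
  have t0: "0 \<le> t" using t by (simp add: time_interval_def)
  have sub: "{0..t} \<subseteq> time_interval T'" by (rule time_interval_initial[OF T'(2)])
  have CV: "continuous_on K (V s j)" if "s \<in> time_interval T'" for s j
    using V that unfolding mild_solution_def by blast
  have CW: "continuous_on K (W s j)" if "s \<in> time_interval T'" for s j
    using CV[OF that, of j] eq[OF that] continuous_on_cong[of K K "W s j" "V s j"] by simp
  show "continuous_on K (W t i)" by (rule CW[OF T'(2)])
  show "uniform_limit K (\<lambda>s. W s i) (W t i) (at t within time_interval T)"
  proof -
    \<comment> \<open>Up to a real r strictly between t and T' both time intervals agree, so they
      define the same limits at t.\<close>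
    obtain r where r: "ereal t < ereal r" "ereal r < T'"
      using T'(2) ereal_dense2[of "ereal t" T'] by (auto simp: time_interval_def)
    have "at t within time_interval T = at t within time_interval T'"
    proof (rule at_within_nhd[of t "{..<r}"])
      show "time_interval T \<inter> {..<r} - {t} = time_interval T' \<inter> {..<r} - {t}"
        using T'(1) r(2) by (auto simp: time_interval_def intro: less_le_trans less_trans[of "ereal _" "ereal r"])
    qed (use r(1) in auto)
    moreover have "uniform_limit K (\<lambda>s. V s i) (V t i) (at t within time_interval T')"
      using V T'(2) unfolding mild_solution_def by blast
    moreover have "uniform_limit K (\<lambda>s. W s i) (W t i) (at t within time_interval T') \<longleftrightarrow>
        uniform_limit K (\<lambda>s. V s i) (V t i) (at t within time_interval T')"
      by (rule uniform_limit_cong) (use eq T'(2) in \<open>auto simp: eventually_at_filter\<close>)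
    ultimately show ?thesis by simp
  qed
  fix x assume x: "x \<in> K"
  have "V t i x = S i t (V 0 i) x + integral {0..t} (\<lambda>s. S i (t - s) (\<lambda>y. F (\<chi> j. V s j y) $ i) x)"
    using V T'(2) x unfolding mild_solution_def by blast
  moreover have "S i t (V 0 i) x = S i t (W 0 i) x"
    using sub t0 eq by (intro heat.S_cong CV x) auto
  moreover have "integral {0..t} (\<lambda>s. S i (t - s) (\<lambda>y. F (\<chi> j. V s j y) $ i) x)
      = integral {0..t} (\<lambda>s. S i (t - s) (\<lambda>y. F (\<chi> j. W s j y) $ i) x)"
  proof (rule Henstock_Kurzweil_Integration.integral_cong)
    fix s assume s: "s \<in> {0..t}"
    have sT: "s \<in> time_interval T'" by (rule subsetD[OF sub s])
    show "S i (t - s) (\<lambda>y. F (\<chi> j. V s j y) $ i) x = S i (t - s) (\<lambda>y. F (\<chi> j. W s j y) $ i) x"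
      using s eq[OF sT] by (intro heat.S_cong source_continuous CV[OF sT] x) auto
  qed
  ultimately show "W t i x = S i t (W 0 i) x + integral {0..t} (\<lambda>s. S i (t - s) (\<lambda>y. F (\<chi> j. W s j y) $ i) x)"
    using eq[OF T'(2) x] by simp
qed

text \<open>The hypothesis of part (b) speaks about maximal trajectories only, so a local solution
  has to be continued to one. Zorn's lemma does this without a uniqueness theorem.\<close>

lemma maximal_extension:
  assumes U: "mild_solution \<Omega> S F T0 U" and T0: "0 < T0"
  obtains T V where "maximal_trajectory \<Omega> S F T V" "T0 \<le> T"
    "\<And>t i x. t \<in> time_interval T0 \<Longrightarrow> x \<in> K \<Longrightarrow> V t i x = U t i x"
proof -
  \<comment> \<open>Graphs over K make extension of solutions set inclusion and disregard values off
    K or outside the time interval.\<close>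
  define gr where "gr T V = {(t, i, x, y). t \<in> time_interval T \<and> x \<in> K \<and> y = V t i x}"
    for T and V :: "real \<Rightarrow> 'n \<Rightarrow> real ^ 'd \<Rightarrow> real"
  define ext where "ext T V \<longleftrightarrow> T0 \<le> T \<and> mild_solution \<Omega> S F T V \<and>
    (\<forall>t\<in>time_interval T0. \<forall>i. \<forall>x\<in>K. V t i x = U t i x)" for T V
  obtain k where k: "k \<in> K" using heat.K_nonempty by (metis all_not_in_conv)
  have mono: "time_interval T \<subseteq> time_interval T'" if "T \<le> T'" for T T'
    using that by (auto simp: time_interval_def)
  \<comment> \<open>The bound below by T0 > 0 is essential: \<open>time_interval\<close> is empty
    for every T <= 0 and does not determine such a T.\<close>
  have anti: "T \<le> T'" if "time_interval T \<subseteq> time_interval T'" "T0 \<le> T'" for T T'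
  proof (rule ccontr)
    assume "\<not> T \<le> T'"
    then have "T' < T" by simp
    then obtain r where r: "T' < ereal r" "ereal r < T" using ereal_dense2 by blast
    have "0 < ereal r" by (rule less_trans[OF less_le_trans[OF T0 that(2)] r(1)])
    then have "r \<in> time_interval T" using r(2) by (simp add: time_interval_def)
    then have "r \<in> time_interval T'" using that(1) by blast
    then show False using r(1) by (auto simp: time_interval_def dest: less_asym)
  qed
  have gr_sub: "time_interval T \<subseteq> time_interval T'" "\<And>t i x. t \<in> time_interval T \<Longrightarrow> x \<in> K \<Longrightarrow> V' t i x = V t i x"
    if "gr T V \<subseteq> gr T' V'" for T V T' V'
  proof -
    have *: "(t, i, x, V t i x) \<in> gr T' V'" if "t \<in> time_interval T" "x \<in> K" for t i x
      using subsetD[OF \<open>gr T V \<subseteq> gr T' V'\<close>, of "(t, i, x, V t i x)"] that by (simp add: gr_def)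
    show "time_interval T \<subseteq> time_interval T'" using *[OF _ k] by (auto simp: gr_def)
    show "V' t i x = V t i x" if "t \<in> time_interval T" "x \<in> K" for t i x using *[OF that] by (simp add: gr_def)
  qed
  define \<A> where "\<A> = {G. \<exists>T V. ext T V \<and> G = gr T V}"
  have "\<exists>M\<in>\<A>. \<forall>X\<in>\<A>. M \<subseteq> X \<longrightarrow> X = M"
  proof (rule subset_Zorn_nonempty)
    have "ext T0 U" using U by (simp add: ext_def)
    then show "\<A> \<noteq> {}" by (auto simp: \<A>_def)
    fix \<C> assume ne: "\<C> \<noteq> {}" and chain: "subset.chain \<A> \<C>"
    have "\<forall>G\<in>\<C>. \<exists>T V. ext T V \<and> G = gr T V" using chain by (auto simp: subset_chain_def \<A>_def)
    then obtain TT VV where TV: "\<And>G. G \<in> \<C> \<Longrightarrow> ext (TT G) (VV G)" "\<And>G. G \<in> \<C> \<Longrightarrow> G = gr (TT G) (VV G)"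
      by metis
    define T where "T = (SUP G\<in>\<C>. TT G)"
    have T: "t \<in> time_interval T \<longleftrightarrow> (\<exists>G\<in>\<C>. t \<in> time_interval (TT G))" for t
    proof -
      obtain G0 where "G0 \<in> \<C>" using ne by blast
      then show ?thesis by (auto simp: time_interval_def T_def less_SUP_iff)
    qed
    \<comment> \<open>Any member of the chain defined at t may supply the value, since the members
      are comparable and hence agree on K.\<close>
    define pick where "pick t = (SOME G. G \<in> \<C> \<and> t \<in> time_interval (TT G))" for t
    define V where "V t = VV (pick t) t" for t
    have V: "V t i x = VV G t i x" if G: "G \<in> \<C>" "t \<in> time_interval (TT G)" and x: "x \<in> K" for t i x G
    proof -
      have "\<exists>G. G \<in> \<C> \<and> t \<in> time_interval (TT G)" using G by blast
      then have p: "pick t \<in> \<C>" "t \<in> time_interval (TT (pick t))"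
        unfolding pick_def by (metis (mono_tags, lifting) someI_ex)+
      have "pick t \<subseteq> G \<or> G \<subseteq> pick t" using chain p(1) G(1) by (auto simp: subset_chain_def)
      then show ?thesis
      proof
        assume "pick t \<subseteq> G"
        then have "gr (TT (pick t)) (VV (pick t)) \<subseteq> gr (TT G) (VV G)" using TV(2)[OF p(1)] TV(2)[OF G(1)] by simp
        from gr_sub(2)[OF this p(2) x] show ?thesis by (simp add: V_def)
      next
        assume "G \<subseteq> pick t"
        then have "gr (TT G) (VV G) \<subseteq> gr (TT (pick t)) (VV (pick t))" using TV(2)[OF p(1)] TV(2)[OF G(1)] by simp
        from gr_sub(2)[OF this G(2) x] show ?thesis by (simp add: V_def)
      qed
    qed
    have le: "TT G \<le> T" if "G \<in> \<C>" for G unfolding T_def by (rule SUP_upper[OF that])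
    have "ext T V"
      unfolding ext_def
    proof (intro conjI ballI allI)
      obtain G where G: "G \<in> \<C>" using ne by blast
      have G': "T0 \<le> TT G" "\<And>t i x. t \<in> time_interval T0 \<Longrightarrow> x \<in> K \<Longrightarrow> VV G t i x = U t i x"
        using TV(1)[OF G] by (auto simp: ext_def)
      show "T0 \<le> T" by (rule order_trans[OF G'(1) le[OF G]])
      show "V t i x = U t i x" if "t \<in> time_interval T0" "x \<in> K" for t i x
        using V[OF G subsetD[OF mono[OF G'(1)] that(1)] that(2)] G'(2)[OF that] by simp
      show "mild_solution \<Omega> S F T V"
      proof (rule mild_solution_glue)
        fix t assume "t \<in> time_interval T"
        then obtain G where G: "G \<in> \<C>" "t \<in> time_interval (TT G)" using T by blast
        then show "\<exists>T' V'. T' \<le> T \<and> t \<in> time_interval T' \<and> mild_solution \<Omega> S F T' V' \<and>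
            (\<forall>s\<in>time_interval T'. \<forall>i. \<forall>x\<in>K. V s i x = V' s i x)"
          using le[OF G(1)] TV(1)[OF G(1)] V[OF G(1)] by (intro exI[of _ "TT G"] exI[of _ "VV G"]) (auto simp: ext_def)
      qed
    qed
    moreover have "\<Union>\<C> = gr T V"
    proof
      show "\<Union>\<C> \<subseteq> gr T V"
      proof
        fix p assume "p \<in> \<Union>\<C>"
        then obtain G where G: "G \<in> \<C>" "p \<in> gr (TT G) (VV G)" using TV(2) by blast
        then show "p \<in> gr T V" using V[OF G(1)] T by (auto simp: gr_def)
      qed
      show "gr T V \<subseteq> \<Union>\<C>"
      proof
        fix p assume "p \<in> gr T V"
        then obtain t i x where p: "p = (t, i, x, V t i x)" "t \<in> time_interval T" "x \<in> K" by (auto simp: gr_def)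
        then obtain G where G: "G \<in> \<C>" "t \<in> time_interval (TT G)" using T by blast
        have "p \<in> gr (TT G) (VV G)" using V[OF G p(3)] G p by (simp add: gr_def)
        then show "p \<in> \<Union>\<C>" using TV(2)[OF G(1)] G(1) by blast
      qed
    qed
    ultimately show "\<Union>\<C> \<in> \<A>" by (auto simp: \<A>_def)
  qed
  then obtain M where M: "M \<in> \<A>" "\<forall>X\<in>\<A>. M \<subseteq> X \<longrightarrow> X = M" by (rule bexE)
  from M(1) obtain T V where TV: "ext T V" "M = gr T V" by (auto simp: \<A>_def)
  have max: "gr T' V' = gr T V" if "ext T' V'" "gr T V \<subseteq> gr T' V'" for T' V'
  proof -
    have "gr T' V' \<in> \<A>" using that(1) by (auto simp: \<A>_def)
    then show ?thesis using M(2) TV(2) that(2) by simp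
  qed
  show thesis
  proof (rule that[of T V])
    show "T0 \<le> T" "\<And>t i x. t \<in> time_interval T0 \<Longrightarrow> x \<in> K \<Longrightarrow> V t i x = U t i x"
      using TV by (auto simp: ext_def)
    have "False" if "T < T'" "mild_solution \<Omega> S F T' V'" and eq: "\<forall>t\<in>time_interval T. \<forall>i. \<forall>x\<in>K. V' t i x = V t i x" for T' V'
    proof -
      have "T \<le> T'" using that(1) by simp
      have "V' t i x = U t i x" if "t \<in> time_interval T0" "x \<in> K" for t i x
      proof -
        have "T0 \<le> T" using TV(1) unfolding ext_def by simp
        from subsetD[OF mono[OF this] that(1)] have "t \<in> time_interval T" .
        then show ?thesis using eq TV(1) that unfolding ext_def by simp
      qed
      moreover have "T0 \<le> T" using TV(1) unfolding ext_def by simp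
      then have "T0 \<le> T'" using \<open>T \<le> T'\<close> by (rule order_trans)
      ultimately have "ext T' V'" using that(2) unfolding ext_def by simp
      moreover have "gr T V \<subseteq> gr T' V'"
        using eq subsetD[OF mono[OF \<open>T \<le> T'\<close>]] by (auto simp: gr_def)
      ultimately have "gr T' V' = gr T V" by (rule max)
      then have "time_interval T' \<subseteq> time_interval T" using gr_sub(1)[of T' V' T V] by simp
      then have "T' \<le> T" by (rule anti) (use TV(1) in \<open>simp add: ext_def\<close>)
      then show False using that(1) by simp
    qed
    moreover have "0 < T" by (rule less_le_trans[OF T0]) (use TV(1) in \<open>simp add: ext_def\<close>)
    moreover have "mild_solution \<Omega> S F T V" using TV(1) by (simp add: ext_def)
    ultimately show "maximal_trajectory \<Omega> S F T V" unfolding maximal_trajectory_def by blast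
  qed
qed

text \<open>The nonlinearity sends spatially constant states to constants, and every S i fixes
  those, so Duhamel's formula reduces to the integrated differential equation.\<close>

lemma constant_mild_solution:
  assumes y: "continuous_on {0..\<tau>} y" "\<And>t. t \<in> {0..\<tau>} \<Longrightarrow> y t = v + integral {0..t} (\<lambda>s. F (y s))"
  shows "mild_solution \<Omega> S F (ereal \<tau>) (\<lambda>t j x. y t $ j)"
  unfolding mild_solution_def
proof (intro allI ballI conjI)
  fix i t assume t: "t \<in> time_interval (ereal \<tau>)"
  have I: "time_interval (ereal \<tau>) \<subseteq> {0..\<tau>}" by (auto simp: time_interval_def)
  have tt: "0 \<le> t" "t \<in> {0..\<tau>}" "0 \<in> {0..\<tau>}" using t by (auto simp: time_interval_def)
  show "continuous_on K (\<lambda>x. y t $ i)" by (rule continuous_on_const)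
  have "continuous_on (time_interval (ereal \<tau>)) (\<lambda>s. y s $ i)"
    by (intro continuous_intros continuous_on_subset[OF y(1) I])
  then have "((\<lambda>s. y s $ i) \<longlongrightarrow> y t $ i) (at t within time_interval (ereal \<tau>))"
    using t unfolding continuous_on_def by blast
  then show "uniform_limit K (\<lambda>s x. y s $ i) (\<lambda>x. y t $ i) (at t within time_interval (ereal \<tau>))"
    unfolding uniform_limit_iff tendsto_iff by (auto elim: eventually_mono)
  fix x assume x: "x \<in> K"
  have F: "continuous_on {0..t} (\<lambda>s. F (y s))"
    by (rule continuous_on_compose2[OF locally_Lipschitz_continuous[OF F_Lipschitz, of UNIV]])
      (use tt in \<open>auto intro: continuous_on_subset[OF y(1)]\<close>)
  have "y 0 = v" using y(2)[OF tt(3)] by simp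
  then have "y t $ i = y 0 $ i + integral {0..t} (\<lambda>s. F (y s)) $ i" using y(2)[OF tt(2)] by simp
  also have "integral {0..t} (\<lambda>s. F (y s)) $ i = integral {0..t} (\<lambda>s. F (y s) $ i)"
    by (rule integral_component_eq_cart[symmetric, OF integrable_continuous_real[OF F]])
  also have "\<dots> = integral {0..t} (\<lambda>s. S i (t - s) (\<lambda>z. F (\<chi> j. y s $ j) $ i) x)"
    using heat.S_const[OF _ x] by (intro Henstock_Kurzweil_Integration.integral_cong) simp
  also have "y 0 $ i = S i t (\<lambda>x. y 0 $ i) x" using heat.S_const[OF tt(1) x] by simp
  finally show "y t $ i = S i t (\<lambda>x. y 0 $ i) x + integral {0..t} (\<lambda>s. S i (t - s) (\<lambda>z. F (\<chi> j. y s $ j) $ i) x)" .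
qed

lemma cond_P_necessary:
  assumes pos: "\<And>T U i x t. maximal_trajectory \<Omega> S F T U \<Longrightarrow> (\<And>i x. x \<in> K \<Longrightarrow> 0 < U 0 i x) \<Longrightarrow>
      x \<in> \<Omega> \<Longrightarrow> t \<in> time_interval T \<Longrightarrow> 0 \<le> U t i x"
  shows "cond_P F"
  unfolding cond_P_def
proof (intro allI impI)
  fix i and u :: "real ^ 'n"
  assume u: "u $ i = 0 \<and> (\<forall>j. j \<noteq> i \<longrightarrow> 0 \<le> u $ j)"
  show "0 \<le> F u $ i"
  proof (rule ccontr)
    assume neg: "\<not> 0 \<le> F u $ i"
    \<comment> \<open>Half of the violation, so that the i-th component of F stays below - \<eta> on
      a whole ball around u.\<close>
    define \<eta> where "\<eta> = - (F u $ i) / 2"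
    have \<eta>: "0 < \<eta>" using neg by (simp add: \<eta>_def)
    have cF: "continuous_on UNIV (\<lambda>w. F w $ i)"
      by (intro continuous_on_component locally_Lipschitz_continuous F_Lipschitz)
    obtain r1 where r1: "r1 > 0" "\<And>w. dist w u < r1 \<Longrightarrow> dist (F w $ i) (F u $ i) < \<eta>"
      using cF \<eta> unfolding continuous_on_iff by blast
    obtain r2 L where r2: "r2 > 0" "L-lipschitz_on (cball u r2) F"
      using F_Lipschitz unfolding locally_Lipschitz_def by blast
    define r where "r = min (r1 / 2) r2"
    have r: "0 < r" "r < r1" "r \<le> r2" using r1(1) r2(1) by (auto simp: r_def)
    have L: "L-lipschitz_on (cball u r) F" by (rule lipschitz_on_subset[OF r2(2)]) (use r in auto)
    have L0: "0 \<le> L" by (rule lipschitz_on_nonneg[OF L])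
    have Fneg: "F w $ i \<le> - \<eta>" if "w \<in> cball u r" for w
    proof -
      have "dist (F w $ i) (F u $ i) < \<eta>" using that r by (intro r1(2)) (auto simp: dist_commute)
      then have "F w $ i < F u $ i + \<eta>" unfolding dist_real_def by arith
      also have "F u $ i = - 2 * \<eta>" by (simp add: \<eta>_def)
      finally show ?thesis by simp
    qed
    have "bounded (F ` cball u r)"
      by (intro compact_imp_bounded compact_continuous_image compact_cball locally_Lipschitz_continuous F_Lipschitz)
    then obtain B where B: "\<And>w. w \<in> cball u r \<Longrightarrow> norm (F w) \<le> B" unfolding bounded_iff by blast
    \<comment> \<open>The added 1s avoid division by zero; both smallness conditions of
      \<open>picard_lindelof\<close> follow.\<close>
    define \<tau> where "\<tau> = min (1 / (2 * (L + 1))) (r / (2 * (\<bar>B\<bar> + 1)))"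
    have \<tau>0: "0 < \<tau>" using L0 r by (simp add: \<tau>_def)
    have "\<tau> * (L + 1) \<le> 1 / (2 * (L + 1)) * (L + 1)" using L0 by (intro mult_right_mono) (auto simp: \<tau>_def)
    also have "\<dots> = 1 / 2" using L0 by (simp add: field_simps)
    finally have "\<tau> * (L + 1) \<le> 1 / 2" .
    moreover have "\<tau> * L \<le> \<tau> * (L + 1)" using \<tau>0 by simp
    ultimately have \<tau>1: "\<tau> * L \<le> 1 / 2" by linarith
    have "\<tau> * (\<bar>B\<bar> + 1) \<le> r / (2 * (\<bar>B\<bar> + 1)) * (\<bar>B\<bar> + 1)" by (intro mult_right_mono) (auto simp: \<tau>_def)
    also have "\<dots> = r / 2" by (simp add: field_simps add_nonneg_eq_0_iff)
    finally have "\<tau> * (\<bar>B\<bar> + 1) \<le> r / 2" .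
    moreover have "\<tau> * B \<le> \<tau> * (\<bar>B\<bar> + 1)" using \<tau>0 by (intro mult_left_mono) auto
    ultimately have \<tau>2: "\<tau> * B \<le> r / 2" by linarith
    \<comment> \<open>The i-th component starts at \<epsilon> and loses at least \<eta> \<tau> / 2
      by time \<tau> / 2, which exceeds \<epsilon> by the first bound. The second bound keeps v in
      the half ball.\<close>
    define \<epsilon> where "\<epsilon> = min (\<eta> * \<tau> / 4) (r / (2 * real CARD('n)))"
    have \<epsilon>: "0 < \<epsilon>" "\<epsilon> \<le> \<eta> * \<tau> / 4" "\<epsilon> \<le> r / (2 * real CARD('n))" using \<eta> \<tau>0 r by (auto simp: \<epsilon>_def)
    \<comment> \<open>All components are raised, since the hypothesis covers strictly positive
      initial data only.\<close>
    define v where "v = (\<chi> j. u $ j + \<epsilon>)"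
    have v: "v \<in> cball u (r / 2)"
    proof -
      have "norm (v - u) \<le> (\<Sum>j\<in>UNIV. \<bar>(v - u) $ j\<bar>)" by (rule norm_le_l1_cart)
      also have "\<dots> = real CARD('n) * \<epsilon>" using \<epsilon>(1) by (simp add: v_def)
      also have "\<dots> \<le> real CARD('n) * (r / (2 * real CARD('n)))" by (intro mult_left_mono \<epsilon>) auto
      also have "\<dots> = r / 2" by simp
      finally show ?thesis by (simp add: dist_norm norm_minus_commute)
    qed
    obtain y where y: "continuous_on {0..\<tau>} y" "\<And>t. t \<in> {0..\<tau>} \<Longrightarrow> y t \<in> cball u r"
      "\<And>t. t \<in> {0..\<tau>} \<Longrightarrow> y t = v + integral {0..t} (\<lambda>s. F (y s))"
      using picard_lindelof[OF L B r(1) \<tau>0 \<tau>1 \<tau>2 v] by blast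
    obtain T V where TV: "maximal_trajectory \<Omega> S F T V" "ereal \<tau> \<le> T"
      "\<And>t i x. t \<in> time_interval (ereal \<tau>) \<Longrightarrow> x \<in> K \<Longrightarrow> V t i x = y t $ i"
      using maximal_extension[OF constant_mild_solution[OF y(1,3)]] \<tau>0 by (auto simp flip: zero_ereal_def)
    obtain x where x: "x \<in> \<Omega>" using dom_nonempty by blast
    then have xK: "x \<in> K" by (rule subsetD[OF closure_subset])
    let ?t = "\<tau> / 2"
    have t: "?t \<in> time_interval (ereal \<tau>)" "0 \<in> time_interval (ereal \<tau>)" "?t \<in> {0..\<tau>}" "0 \<in> {0..\<tau>}"
      using \<tau>0 by (auto simp: time_interval_def)
    have "0 < V 0 j z" if "z \<in> K" for j z
    proof -
      have "V 0 j z = v $ j" using TV(3)[OF t(2) that, of j] y(3)[OF t(4)] by simp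
      then show ?thesis using u \<epsilon>(1) by (cases "j = i") (auto simp: v_def add_nonneg_pos)
    qed
    moreover have "ereal ?t < T" by (rule less_le_trans[OF _ TV(2)]) (use \<tau>0 in simp)
    then have "?t \<in> time_interval T" using \<tau>0 by (simp add: time_interval_def)
    ultimately have "0 \<le> V ?t i x" using pos[OF TV(1) _ x] by blast
    then have "0 \<le> y ?t $ i" using TV(3)[OF t(1) xK] by simp
    moreover have "y ?t $ i \<le> \<epsilon> - \<eta> * ?t"
    proof -
      have F: "continuous_on {0..?t} (\<lambda>s. F (y s))"
        by (rule continuous_on_compose2[OF locally_Lipschitz_continuous[OF F_Lipschitz, of UNIV]])
          (use \<tau>0 in \<open>auto intro: continuous_on_subset[OF y(1)]\<close>)
      have "integral {0..?t} (\<lambda>s. F (y s) $ i) \<le> integral {0..?t} (\<lambda>s. - \<eta>)"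
        using Fneg y(2) by (intro integral_le integrable_continuous_real continuous_on_component F) auto
      also have "\<dots> = - (\<eta> * ?t)" using \<tau>0 by simp
      finally have "integral {0..?t} (\<lambda>s. F (y s)) $ i \<le> - (\<eta> * ?t)"
        by (simp only: integral_component_eq_cart[OF integrable_continuous_real[OF F]])
      moreover have "v $ i = \<epsilon>" using u by (simp add: v_def)
      ultimately show ?thesis using y(3)[OF t(3)] by simp
    qed
    moreover have "\<epsilon> - \<eta> * ?t < 0" using \<epsilon>(2) mult_pos_pos[OF \<eta> \<tau>0] by simp
    ultimately show False by linarith
  qed
qed

end

theorem theorem4p1:
  fixes \<Omega> :: "(real ^ 'd) set"
    and d :: "'n :: finite \<Rightarrow> real"
    and F :: "real ^ 'n \<Rightarrow> real ^ 'n"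
    and S :: "'n \<Rightarrow> real \<Rightarrow> (real ^ 'd \<Rightarrow> real) \<Rightarrow> real ^ 'd \<Rightarrow> real"
  assumes "open \<Omega>" and "connected \<Omega>" and "\<Omega> \<noteq> {}" and "bounded \<Omega>" and "C1_boundary \<Omega>"
    and "\<And>i. 0 < d i"
    and "locally_Lipschitz F"
    and "\<And>i. neumann_heat_semigroup \<Omega> (d i) (S i)"
  shows
    "(cond_P F \<longrightarrow>
        (\<forall>T U. maximal_trajectory \<Omega> S F T U \<longrightarrow> (\<forall>i. \<forall>x \<in> \<Omega>. 0 \<le> U 0 i x) \<longrightarrow>
           (\<forall>i. \<forall>x \<in> \<Omega>. \<forall>t \<in> time_interval T. 0 \<le> U t i x)))
     \<and>
     ((\<forall>T U. maximal_trajectory \<Omega> S F T U \<longrightarrow> (\<forall>i. \<forall>x \<in> closure \<Omega>. 0 < U 0 i x) \<longrightarrow>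
           (\<forall>i. \<forall>x \<in> \<Omega>. \<forall>t \<in> time_interval T. 0 \<le> U t i x))
        \<longrightarrow> cond_P F)
     \<and>
     (cond_P F \<longrightarrow>
        (\<forall>T U. maximal_trajectory \<Omega> S F T U \<longrightarrow> (\<forall>i. \<forall>x \<in> \<Omega>. 0 \<le> U 0 i x) \<longrightarrow>
           (\<forall>j. (\<exists>x \<in> closure \<Omega>. U 0 j x \<noteq> 0) \<longrightarrow>
              (\<forall>t. 0 < t \<and> ereal t < T \<longrightarrow> 0 < (INF x \<in> closure \<Omega>. U t j x)))))"
proof -
  interpret reaction_diffusion \<Omega> d F S
    using assms by unfold_locales auto
  show ?thesis
  proof (intro conjI impI allI ballI)
    fix T U i x t
    assume P: "cond_P F" and U: "maximal_trajectory \<Omega> S F T U" and init: "\<forall>i. \<forall>x \<in> \<Omega>. 0 \<le> U 0 i x"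
      and x: "x \<in> \<Omega>" and t: "t \<in> time_interval T"
    show "0 \<le> U t i x"
    proof (rule mild_nonneg(1)[OF P _ _ t])
      show "mild_solution \<Omega> S F T U" using U by (simp add: maximal_trajectory_def)
      show "x \<in> closure \<Omega>" using x by (rule subsetD[OF closure_subset])
    qed (use init in blast)
  next
    assume *: "\<forall>T U. maximal_trajectory \<Omega> S F T U \<longrightarrow> (\<forall>i. \<forall>x \<in> closure \<Omega>. 0 < U 0 i x) \<longrightarrow>
      (\<forall>i. \<forall>x \<in> \<Omega>. \<forall>t \<in> time_interval T. 0 \<le> U t i x)"
    show "cond_P F"
    proof (rule cond_P_necessary)
      fix T U i x t
      assume "maximal_trajectory \<Omega> S F T U" "\<And>i x. x \<in> closure \<Omega> \<Longrightarrow> 0 < U 0 i x" "x \<in> \<Omega>" "t \<in> time_interval T"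
      then show "0 \<le> U t i x" using * by blast
    qed
  next
    fix T U j t
    assume P: "cond_P F" and U: "maximal_trajectory \<Omega> S F T U" and init: "\<forall>i. \<forall>x \<in> \<Omega>. 0 \<le> U 0 i x"
      and nz: "\<exists>x \<in> closure \<Omega>. U 0 j x \<noteq> 0" and t: "0 < t \<and> ereal t < T"
    obtain x1 where "x1 \<in> closure \<Omega>" "U 0 j x1 \<noteq> 0" using nz by blast
    then show "0 < (INF x \<in> closure \<Omega>. U t j x)"
      using mild_strictly_positive[OF P _ _ _ _ assms(2,5), of T U t x1 j] U init t
      by (simp add: maximal_trajectory_def)
  qed
qed

end
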